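(* Suppose that $x_0\in\mathcal X_0\cap\mathcal M_0(t_0)$ holds. Let Assumption F, Assumption Y and Assumption T (stated in the context) hold. Assume that $J:\mathcal X\times\mathcal Y\times\mathcal U_{ad}\to\mathbb R$ is non-negative and weakly lower semi-continuous. Then there is a solution $(\tilde x,\tilde y,\tilde u)\in\mathcal X\times\mathcal Y\times\mathcal U_{ad}$ to the optimal control problem $$\min J(x,y,u)=\int_{t_0}^{t_f}f_0(t,x(t),y(t),u(t))\,dt\quad\text{s.t. } u\in\mathcal U_{ad}\text{ and}\quad\begin{cases}\dot x(t)=f(t,x(t),y(t),u(t))&\text{for a.a. }t\in(t_0,t_f],\quad x(t_0)=x_0,\\ 0=g(t,x(t),y(t),u(t))&\text{for a.a. }t\in(t_0,t_f].\end{cases}$$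
   Context: Setting. $0\le t_0<t_f$ are fixed; $u_a\le u_b$ in $\mathbb R^{n_u}$ (componentwise); $U_{ad}=\{\mathsf u\in\mathbb R^{n_u}\mid u_a\le\mathsf u\le u_b\}$; $\mathcal U=L^2(t_0,t_f;\mathbb R^{n_u})$; $\mathcal U_{ad}=\{u\in\mathcal U\mid u(t)\in U_{ad}\text{ for a.a. }t\}$. The functions are $f_0:[t_0,t_f]\times\mathbb R^{n_x}\times\mathbb R^{n_y}\times\mathbb R^{n_u}\to\mathbb R$, $f:[t_0,t_f]\times\mathbb R^{n_x}\times\mathbb R^{n_y}\times\mathbb R^{n_u}\to\mathbb R^{n_x}$, $g:[t_0,t_f]\times\mathbb R^{n_x}\times\mathbb R^{n_y}\times\mathbb R^{n_u}\to\mathbb R^{n_y}$. $\mathcal X_0\subset\mathbb R^{n_x}$ is the set of admissible initial values. $\|\cdot\|_2$ is the Euclidean norm, $\|\cdot\|_F$ the Frobenius norm, $B_\rho(\cdot)$ an open ball. $\mathcal X=AC([t_0,t_f];\mathbb R^{n_x})$ is the Banach space of absolutely continuous functions with norm $\max_t\|\varphi(t)\|_2+\int_{t_0}^{t_f}\|\varphi'(t)\|_2\,dt$; $\mathcal Y=L^2(t_0,t_f;\mathbb R^{n_y})$. Weak lower semi-continuity refers to weak convergence in $\mathcal X\times\mathcal Y\times\mathcal U$. The state equation is the differential-algebraic system in the constraint, for given $u\in\mathcal U_{ad}$. For $t_e\in(t_0,t_f]$, a solution in the extended sense on $[t_0,t_e]$ is a pair $(x,y)\in AC([t_0,t_e];\mathbb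 R^{n_x})\times L^2(t_0,t_e;\mathbb R^{n_y})$ satisfying the state equation on $[t_0,t_e]$. $\mathcal D_x\subset\mathbb R^{n_x}$, $\mathcal D_y\subset\mathbb R^{n_y}$ are the non-empty open sets of Assumption F below, $\mathcal D=\mathcal D_x\times\mathcal D_y$. Differentiation index and consistency (for a fixed control $u$, with $\mathsf g(t,\mathsf x,\mathsf y):=g(t,\mathsf x,\mathsf y,u(t))$). The state equation is supposed to have differentiation index 1: $\mathsf g(t,\cdot,\cdot)$ is continuously differentiable in $\mathcal D$ and $\partial_{\mathsf y}\mathsf g(t,\mathsf x,\mathsf y)$ is regular for all $(\mathsf x,\mathsf y)\in\mathcal D$ and a.a. $t$. The set of consistent initial values at time $t$ is $\mathcal M_0(t)=\{\mathsf x\in\mathcal D_x\mid\text{there exists }\mathsf y\in\mathcal D_y\text{ with }\mathsf g(t,\mathsf x,\mathsf y)=0\}$. Assumption F. There exist open subsets $\mathcal D_x\subset\mathbb R^{n_x}$, $\mathcal D_y\subset\mathbb R^{n_y}$ and functions $f_1:[t_0,t_f]\times\mathcal D_x\to\mathbb R^{n_x\times n_y}$, $f_2:[t_0,t_f]\times\mathcal D_x\to\mathbb R^{n_x\times n_u}$, $f_3:[t_0,t_f]\times\mathcal D_x\to\mathbb R^{n_x}$ with $f(t,\mathsf x,\mathsf y,\mathsf u)=f_1(t,\mathsf x)\mathsf y+f_2(t,\mathsf x)\mathsf u+f_3(t,\mathsf x)$ for $(t,\mathsf x,\mathsf y,\mathsf u)\in[t_0,t_f]\times\mathcal D_x\times\mathcal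 D_y\times U_{ad}$, and: 1) $f_i(\cdot,\mathsf x)$ is measurable on $[t_0,t_f]$ for all $\mathsf x\in\mathcal D_x$, $i=1,2,3$; 2) $f_i(t,\cdot)$ is continuous on $\mathcal D_x$ for a.a. $t\in[t_0,t_f]$, $i=1,2,3$; 3) for all $\mathsf z_\circ=(\mathsf x_\circ,\mathsf y_\circ)\in\mathcal D$ there are $\rho_\circ>0$ and $\alpha_1,\alpha_2\in L^4(t_0,t_f)$ with $\|f(t,\mathsf z,\mathsf u)-f(t,\tilde{\mathsf z},\mathsf u)\|_2\le(\alpha_1(t)\|\mathsf u\|_2+\alpha_2(t))\|\mathsf z-\tilde{\mathsf z}\|_2$ for a.a. $t$, all $\mathsf z,\tilde{\mathsf z}\in B_{\rho_\circ}(\mathsf z_\circ)\subset\mathcal D$ and all $\mathsf u\in U_{ad}$; 4) for all $\mathsf x_\circ\in\mathcal D_x$ there are $\rho_\circ>0$ and $\iota_1,\iota_2,\iota_3\in L^4(t_0,t_f)$ with $\|f_j(t,\mathsf x)\|_F\le\iota_j(t)$ ($j=1,2$) and $\|f_3(t,\mathsf x)\|_2\le\iota_3(t)$ for a.a. $t$ and all $\mathsf x\in B_{\rho_\circ}(\mathsf x_\circ)$. Assumption Y. There is $\mathsf y\in L^2_{loc}((t_0,t_f)\times\mathcal D_x\times U_{ad};\mathbb R^{n_y})$ with $g(t,\mathsf x,\mathsf y(t,\mathsf x,\mathsf u),\mathsf u)=0$ for a.a. $t\in[t_0,t_f]$ and all $(\mathsf x,\mathsf u)\in\mathcal D_x\times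 U_{ad}$. Additionally, there are $\mathsf y_1:[t_0,t_f]\times\mathcal D_x\to\mathbb R^{n_y\times n_u}$ and $\mathsf y_2:[t_0,t_f]\times\mathcal D_x\to\mathbb R^{n_y}$ with $\mathsf y(t,\mathsf x,\mathsf u)=\mathsf y_1(t,\mathsf x)\mathsf u+\mathsf y_2(t,\mathsf x)$ for a.a. $t$ and all $(\mathsf x,\mathsf u)\in\mathcal D_x\times U_{ad}$, such that: 1) $\mathsf y(t,\mathsf x,\mathsf u)\in\mathcal D_y$ for a.a. $t$ and all $(\mathsf x,\mathsf u)\in\mathcal D_x\times U_{ad}$; 2) $\mathsf y_1(\cdot,\mathsf x)$, $\mathsf y_2(\cdot,\mathsf x)$ are measurable on $[t_0,t_f]$ for all $\mathsf x\in\mathcal D_x$; 3) $\mathsf y_1(t,\cdot)$, $\mathsf y_2(t,\cdot)$ are continuous on $\mathcal D_x$ for a.a. $t$; 4) for all $\mathsf x_\circ\in\mathcal D_x$ there are $\rho_\circ>0$ and $\gamma_1,\gamma_2\in L^4(t_0,t_f)$ with $\|\mathsf y_1(t,\mathsf x)-\mathsf y_1(t,\tilde{\mathsf x})\|_F\le\gamma_1(t)\|\mathsf x-\tilde{\mathsf x}\|_2$ and $\|\mathsf y_2(t,\mathsf x)-\mathsf y_2(t,\tilde{\mathsf x})\|_2\le\gamma_2(t)\|\mathsf x-\tilde{\mathsf x}\|_2$ for a.a. $t$ and all $\mathsf x,\tilde{\mathsf x}\in B_{\rho_\circ}(\mathsf x_\circ)\subset\mathcal D_x$; 5) for all $\mathsf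 x_\circ\in\mathcal X_0$ there are $\beta_1,\beta_2\in L^2(t_0,t_f)$ with $\|f(t,\mathsf x_\circ,\mathsf y(t,\mathsf x_\circ,\mathsf u),\mathsf u)\|_2\le\beta_1(t)\|\mathsf u\|_2+\beta_2(t)$ for a.a. $t$ and all $\mathsf u\in U_{ad}$; 6) for all $\mathsf x_\circ\in\mathcal D_x$ there are $\rho_\circ>0$ and $\kappa_1,\kappa_2\in L^4(t_0,t_f)$ with $\|\mathsf y_1(t,\mathsf x)\|_F\le\kappa_1(t)$ and $\|\mathsf y_2(t,\mathsf x)\|_2\le\kappa_2(t)$ for a.a. $t$ and all $\mathsf x\in B_{\rho_\circ}(\mathsf x_\circ)$. The time $t_e$. If $x_0\in\mathcal X_0\cap\mathcal M_0(t_0)$ and Assumptions F and Y hold, then (a result proved beforehand) there is a $t_e\in(t_0,t_f]$, independent of $u$, such that for all $u\in\mathcal U_{ad}$ there exists a unique solution pair $(x,y)$ in the extended sense to the state equation on $[t_0,t_e]$. It is further remarked that, after possibly choosing a smaller $t_e>t_0$, one can suppose that there is a radius $\rho_\circ>0$ such that $x(t)\in B_{\rho_\circ}(x_0)\subset\mathcal D_x$ for all $t\in[t_0,t_e]$ and all $u\in\mathcal U_{ad}$. In what follows $t_e$ is this time. Assumption T. $t_e=t_f$, i.e. $[t_0,t_e]=[t_0,t_f]$. (Hence for every $u\in\mathcal U_{ad}$ the state equation has a unique solution pair $(x,y)\in\mathcal X\times\mathcal Y$ in the extended sense on $[t_0,t_f]$.) *)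

theory Defs
  imports "HOL-Analysis.Analysis"
begin

text \<open>
  Functions on an interval are represented by total functions on \<^typ>\<open>real\<close>; their values off the
  interval never matter. Elements of Lebesgue spaces are represented by functions, not by classes
  modulo almost everywhere equality, so the norms below are seminorms on these representatives.
\<close>

definition Lp :: "nat \<Rightarrow> real \<Rightarrow> real \<Rightarrow> (real \<Rightarrow> 'a::euclidean_space) set" where
  "Lp p a b = {h. h \<in> borel_measurable (lebesgue_on {a..b}) \<and>
                  integrable (lebesgue_on {a..b}) (\<lambda>t. norm (h t) ^ p)}"

definition L2_norm :: "real \<Rightarrow> real \<Rightarrow> (real \<Rightarrow> 'a::euclidean_space) \<Rightarrow> real" where
  "L2_norm a b h = sqrt (LINT t|lebesgue_on {a..b}. (norm (h t))\<^sup>2)"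

definition L2_loc :: "'a::euclidean_space set \<Rightarrow> ('a \<Rightarrow> 'b::euclidean_space) set" where
  "L2_loc S = {h. \<forall>K. compact K \<and> K \<subseteq> S \<longrightarrow>
                   h \<in> borel_measurable (lebesgue_on K) \<and>
                   integrable (lebesgue_on K) (\<lambda>z. (norm (h z))\<^sup>2)}"

text \<open>
  The families \<open>D\<close> are the finite families of non-overlapping closed subintervals
  \<open>{Inf K..Sup K}\<close> of \<open>{a..b}\<close>.
\<close>

definition AC :: "real \<Rightarrow> real \<Rightarrow> (real \<Rightarrow> 'a::euclidean_space) set" where
  "AC a b = {x. \<forall>\<epsilon>>0. \<exists>\<delta>>0. \<forall>D. D division_of \<Union>D \<and> \<Union>D \<subseteq> {a..b} \<and> (\<Sum>K\<in>D. Sup K - Inf K) < \<delta>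
                  \<longrightarrow> (\<Sum>K\<in>D. norm (x (Sup K) - x (Inf K))) < \<epsilon>}"

definition AC_norm :: "real \<Rightarrow> real \<Rightarrow> (real \<Rightarrow> 'a::euclidean_space) \<Rightarrow> real" where
  "AC_norm a b x = (SUP t\<in>{a..b}. norm (x t)) +
     (LINT t|lebesgue_on {a..b}. norm (vector_derivative x (at t within {a..b})))"

text \<open>
  Weak convergence in a space \<open>V\<close> of functions with (semi)norm \<open>N\<close>: a functional that is bounded
  with respect to \<open>N\<close> does not see differences of \<open>N\<close>-value zero, so these are the continuous
  linear functionals of the normed space of equivalence classes.
\<close>

definition bounded_functional ::
  "('t \<Rightarrow> 'v::real_vector) set \<Rightarrow> (('t \<Rightarrow> 'v) \<Rightarrow> real) \<Rightarrow> (('t \<Rightarrow> 'v) \<Rightarrow> real) \<Rightarrow> bool" where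
  "bounded_functional V N \<phi> \<longleftrightarrow>
     (\<forall>z\<in>V. \<forall>w\<in>V. \<phi> (\<lambda>t. z t + w t) = \<phi> z + \<phi> w) \<and>
     (\<forall>c. \<forall>z\<in>V. \<phi> (\<lambda>t. c *\<^sub>R z t) = c * \<phi> z) \<and>
     (\<exists>C. \<forall>z\<in>V. \<bar>\<phi> z\<bar> \<le> C * N z)"

definition weakly_converges ::
  "('t \<Rightarrow> 'v::real_vector) set \<Rightarrow> (('t \<Rightarrow> 'v) \<Rightarrow> real) \<Rightarrow> (nat \<Rightarrow> 't \<Rightarrow> 'v) \<Rightarrow> ('t \<Rightarrow> 'v) \<Rightarrow> bool" where
  "weakly_converges V N zs z \<longleftrightarrow>
     (\<forall>n. zs n \<in> V) \<and> z \<in> V \<and>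
     (\<forall>\<phi>. bounded_functional V N \<phi> \<longrightarrow> (\<lambda>n. \<phi> (zs n)) \<longlonglongrightarrow> \<phi> z)"

text \<open>
  The product of the spaces of \<open>x\<close>, \<open>y\<close> and \<open>u\<close>, its elements being written as single functions
  \<open>\<lambda>t. (x t, y t, u t)\<close>.
\<close>

definition XYU :: "real \<Rightarrow> real \<Rightarrow> (real \<Rightarrow> (real^'nx) \<times> (real^'ny) \<times> (real^'nu)) set" where
  "XYU t0 tf = {z. (\<lambda>t. fst (z t)) \<in> AC t0 tf \<and> (\<lambda>t. fst (snd (z t))) \<in> Lp 2 t0 tf \<and>
                   (\<lambda>t. snd (snd (z t))) \<in> Lp 2 t0 tf}"

definition XYU_norm ::
  "real \<Rightarrow> real \<Rightarrow> (real \<Rightarrow> (real^'nx) \<times> (real^'ny) \<times> (real^'nu)) \<Rightarrow> real" where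
  "XYU_norm t0 tf z = AC_norm t0 tf (\<lambda>t. fst (z t)) + L2_norm t0 tf (\<lambda>t. fst (snd (z t))) +
                      L2_norm t0 tf (\<lambda>t. snd (snd (z t)))"

definition admissible_controls ::
  "real \<Rightarrow> real \<Rightarrow> real^'nu \<Rightarrow> real^'nu \<Rightarrow> (real \<Rightarrow> real^'nu) set" where
  "admissible_controls t0 tf ua ub =
     {u \<in> Lp 2 t0 tf. AE t in lebesgue_on {t0..tf}. u t \<in> {ua..ub}}"

definition state_solution ::
  "(real \<Rightarrow> real^'nx \<Rightarrow> real^'ny \<Rightarrow> real^'nu \<Rightarrow> real^'nx) \<Rightarrow>
   (real \<Rightarrow> real^'nx \<Rightarrow> real^'ny \<Rightarrow> real^'nu \<Rightarrow> real^'ny) \<Rightarrow>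
   real \<Rightarrow> real \<Rightarrow> real^'nx \<Rightarrow> (real \<Rightarrow> real^'nu) \<Rightarrow> (real \<Rightarrow> real^'nx) \<Rightarrow> (real \<Rightarrow> real^'ny) \<Rightarrow> bool" where
  "state_solution f g t0 te x0 u x y \<longleftrightarrow>
     x \<in> AC t0 te \<and> y \<in> Lp 2 t0 te \<and> x t0 = x0 \<and>
     (AE t in lebesgue_on {t0..te}.
        (x has_vector_derivative f t (x t) (y t) (u t)) (at t within {t0..te})) \<and>
     (AE t in lebesgue_on {t0..te}. g t (x t) (y t) (u t) = 0)"

definition continuously_differentiable_on ::
  "('a::euclidean_space \<Rightarrow> 'b::euclidean_space) \<Rightarrow> 'a set \<Rightarrow> bool" where
  "continuously_differentiable_on h D \<longleftrightarrow>
     (\<exists>h'. (\<forall>z\<in>D. (h has_derivative blinfun_apply (h' z)) (at z)) \<and> continuous_on D h')"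

definition index_one ::
  "(real \<Rightarrow> real^'nx \<Rightarrow> real^'ny \<Rightarrow> real^'nu \<Rightarrow> real^'ny) \<Rightarrow> real \<Rightarrow> real \<Rightarrow>
   (real^'nx) set \<Rightarrow> (real^'ny) set \<Rightarrow> (real \<Rightarrow> real^'nu) \<Rightarrow> bool" where
  "index_one g t0 tf Dx Dy u \<longleftrightarrow>
     (AE t in lebesgue_on {t0..tf}.
        continuously_differentiable_on (\<lambda>(x, y). g t x y (u t)) (Dx \<times> Dy) \<and>
        (\<forall>x\<in>Dx. \<forall>y\<in>Dy. invertible (jacobian (\<lambda>\<eta>. g t x \<eta> (u t)) (at y))))"

definition consistent_values ::
  "(real \<Rightarrow> real^'nx \<Rightarrow> real^'ny \<Rightarrow> real^'nu \<Rightarrow> real^'ny) \<Rightarrow> (real^'nx) set \<Rightarrow> (real^'ny) set \<Rightarrow>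
   (real \<Rightarrow> real^'nu) \<Rightarrow> real \<Rightarrow> (real^'nx) set" where
  "consistent_values g Dx Dy u t = {x \<in> Dx. \<exists>y\<in>Dy. g t x y (u t) = 0}"

text \<open>On matrices, \<^const>\<open>norm\<close> is the Frobenius norm.\<close>

definition assumption_F ::
  "(real \<Rightarrow> real^'nx \<Rightarrow> real^'ny \<Rightarrow> real^'nu \<Rightarrow> real^'nx) \<Rightarrow> real \<Rightarrow> real \<Rightarrow>
   real^'nu \<Rightarrow> real^'nu \<Rightarrow> (real^'nx) set \<Rightarrow> (real^'ny) set \<Rightarrow> bool" where
  "assumption_F f t0 tf ua ub Dx Dy \<longleftrightarrow>
     open Dx \<and> Dx \<noteq> {} \<and> open Dy \<and> Dy \<noteq> {} \<and>
     (\<exists>(f1 :: real \<Rightarrow> real^'nx \<Rightarrow> real^'ny^'nx) (f2 :: real \<Rightarrow> real^'nx \<Rightarrow> real^'nu^'nx)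
       (f3 :: real \<Rightarrow> real^'nx \<Rightarrow> real^'nx).
        (\<forall>t\<in>{t0..tf}. \<forall>x\<in>Dx. \<forall>y\<in>Dy. \<forall>u\<in>{ua..ub}. f t x y u = f1 t x *v y + f2 t x *v u + f3 t x) \<and>
        (\<forall>x\<in>Dx. (\<lambda>t. f1 t x) \<in> borel_measurable (lebesgue_on {t0..tf}) \<and>
                (\<lambda>t. f2 t x) \<in> borel_measurable (lebesgue_on {t0..tf}) \<and>
                (\<lambda>t. f3 t x) \<in> borel_measurable (lebesgue_on {t0..tf})) \<and>
        (AE t in lebesgue_on {t0..tf}.
           continuous_on Dx (f1 t) \<and> continuous_on Dx (f2 t) \<and> continuous_on Dx (f3 t)) \<and>
        (\<forall>z0\<in>Dx \<times> Dy. \<exists>\<rho>>0. \<exists>\<alpha>1\<in>Lp 4 t0 tf. \<exists>\<alpha>2\<in>Lp 4 t0 tf. ball z0 \<rho> \<subseteq> Dx \<times> Dy \<and>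
           (AE t in lebesgue_on {t0..tf}. \<forall>z\<in>ball z0 \<rho>. \<forall>w\<in>ball z0 \<rho>. \<forall>u\<in>{ua..ub}.
              norm (f t (fst z) (snd z) u - f t (fst w) (snd w) u)
                \<le> (\<alpha>1 t * norm u + \<alpha>2 t) * norm (z - w))) \<and>
        (\<forall>xc\<in>Dx. \<exists>\<rho>>0. \<exists>\<iota>1\<in>Lp 4 t0 tf. \<exists>\<iota>2\<in>Lp 4 t0 tf. \<exists>\<iota>3\<in>Lp 4 t0 tf. ball xc \<rho> \<subseteq> Dx \<and>
           (AE t in lebesgue_on {t0..tf}. \<forall>x\<in>ball xc \<rho>.
              norm (f1 t x) \<le> \<iota>1 t \<and> norm (f2 t x) \<le> \<iota>2 t \<and> norm (f3 t x) \<le> \<iota>3 t)))"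

text \<open>
  The function \<open>yy\<close>, which expresses the algebraic variable through \<open>(t, x, u)\<close>, lives on \<open>x \<in> Dx\<close>
  only, so the growth condition at admissible initial values is imposed for the points of
  \<open>X0 \<inter> Dx\<close>.
\<close>

definition assumption_Y ::
  "(real \<Rightarrow> real^'nx \<Rightarrow> real^'ny \<Rightarrow> real^'nu \<Rightarrow> real^'nx) \<Rightarrow>
   (real \<Rightarrow> real^'nx \<Rightarrow> real^'ny \<Rightarrow> real^'nu \<Rightarrow> real^'ny) \<Rightarrow> real \<Rightarrow> real \<Rightarrow>
   real^'nu \<Rightarrow> real^'nu \<Rightarrow> (real^'nx) set \<Rightarrow> (real^'nx) set \<Rightarrow> (real^'ny) set \<Rightarrow> bool" where
  "assumption_Y f g t0 tf ua ub X0 Dx Dy \<longleftrightarrow>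
     (\<exists>(yy :: real \<Rightarrow> real^'nx \<Rightarrow> real^'nu \<Rightarrow> real^'ny)
       (y1 :: real \<Rightarrow> real^'nx \<Rightarrow> real^'nu^'ny) (y2 :: real \<Rightarrow> real^'nx \<Rightarrow> real^'ny).
        (\<lambda>(t, x, u). yy t x u) \<in> L2_loc ({t0<..<tf} \<times> Dx \<times> {ua..ub}) \<and>
        (AE t in lebesgue_on {t0..tf}. \<forall>x\<in>Dx. \<forall>u\<in>{ua..ub}. g t x (yy t x u) u = 0) \<and>
        (AE t in lebesgue_on {t0..tf}. \<forall>x\<in>Dx. \<forall>u\<in>{ua..ub}. yy t x u = y1 t x *v u + y2 t x) \<and>
        (AE t in lebesgue_on {t0..tf}. \<forall>x\<in>Dx. \<forall>u\<in>{ua..ub}. yy t x u \<in> Dy) \<and>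
        (\<forall>x\<in>Dx. (\<lambda>t. y1 t x) \<in> borel_measurable (lebesgue_on {t0..tf}) \<and>
                (\<lambda>t. y2 t x) \<in> borel_measurable (lebesgue_on {t0..tf})) \<and>
        (AE t in lebesgue_on {t0..tf}. continuous_on Dx (y1 t) \<and> continuous_on Dx (y2 t)) \<and>
        (\<forall>xc\<in>Dx. \<exists>\<rho>>0. \<exists>\<gamma>1\<in>Lp 4 t0 tf. \<exists>\<gamma>2\<in>Lp 4 t0 tf. ball xc \<rho> \<subseteq> Dx \<and>
           (AE t in lebesgue_on {t0..tf}. \<forall>x\<in>ball xc \<rho>. \<forall>w\<in>ball xc \<rho>.
              norm (y1 t x - y1 t w) \<le> \<gamma>1 t * norm (x - w) \<and>
              norm (y2 t x - y2 t w) \<le> \<gamma>2 t * norm (x - w))) \<and>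
        (\<forall>xc\<in>X0 \<inter> Dx. \<exists>\<beta>1\<in>Lp 2 t0 tf. \<exists>\<beta>2\<in>Lp 2 t0 tf.
           AE t in lebesgue_on {t0..tf}. \<forall>u\<in>{ua..ub}.
             norm (f t xc (yy t xc u) u) \<le> \<beta>1 t * norm u + \<beta>2 t) \<and>
        (\<forall>xc\<in>Dx. \<exists>\<rho>>0. \<exists>\<kappa>1\<in>Lp 4 t0 tf. \<exists>\<kappa>2\<in>Lp 4 t0 tf. ball xc \<rho> \<subseteq> Dx \<and>
           (AE t in lebesgue_on {t0..tf}. \<forall>x\<in>ball xc \<rho>.
              norm (y1 t x) \<le> \<kappa>1 t \<and> norm (y2 t x) \<le> \<kappa>2 t)))"

text \<open>
  The defining properties of the time \<open>te\<close>. Uniqueness is equality in \<open>AC \<times> L\<^sup>2\<close>: on \<open>[t0, te]\<close>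
  everywhere for the differential and almost everywhere for the algebraic component.
\<close>

definition existence_time ::
  "(real \<Rightarrow> real^'nx \<Rightarrow> real^'ny \<Rightarrow> real^'nu \<Rightarrow> real^'nx) \<Rightarrow>
   (real \<Rightarrow> real^'nx \<Rightarrow> real^'ny \<Rightarrow> real^'nu \<Rightarrow> real^'ny) \<Rightarrow> real \<Rightarrow> real \<Rightarrow>
   real^'nu \<Rightarrow> real^'nu \<Rightarrow> (real^'nx) set \<Rightarrow> real^'nx \<Rightarrow> real \<Rightarrow> bool" where
  "existence_time f g t0 tf ua ub Dx x0 te \<longleftrightarrow>
     t0 < te \<and> te \<le> tf \<and>
     (\<forall>u\<in>admissible_controls t0 tf ua ub.
        (\<exists>x y. state_solution f g t0 te x0 u x y) \<and>
        (\<forall>x y x' y'. state_solution f g t0 te x0 u x y \<and> state_solution f g t0 te x0 u x' y' \<longrightarrow>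
           (\<forall>t\<in>{t0..te}. x t = x' t) \<and> (AE t in lebesgue_on {t0..te}. y t = y' t))) \<and>
     (\<exists>\<rho>>0. ball x0 \<rho> \<subseteq> Dx \<and>
        (\<forall>u\<in>admissible_controls t0 tf ua ub. \<forall>x y. state_solution f g t0 te x0 u x y \<longrightarrow>
           (\<forall>t\<in>{t0..te}. x t \<in> ball x0 \<rho>)))"

definition cost ::
  "(real \<Rightarrow> real^'nx \<Rightarrow> real^'ny \<Rightarrow> real^'nu \<Rightarrow> real) \<Rightarrow> real \<Rightarrow> real \<Rightarrow>
   (real \<Rightarrow> real^'nx) \<Rightarrow> (real \<Rightarrow> real^'ny) \<Rightarrow> (real \<Rightarrow> real^'nu) \<Rightarrow> real" where
  "cost f0 t0 tf x y u = (LINT t|lebesgue_on {t0..tf}. f0 t (x t) (y t) (u t))"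

definition weakly_lsc_cost ::
  "((real \<Rightarrow> real^'nx) \<Rightarrow> (real \<Rightarrow> real^'ny) \<Rightarrow> (real \<Rightarrow> real^'nu) \<Rightarrow> real) \<Rightarrow>
   real \<Rightarrow> real \<Rightarrow> real^'nu \<Rightarrow> real^'nu \<Rightarrow> bool" where
  "weakly_lsc_cost J t0 tf ua ub \<longleftrightarrow>
     (\<forall>xs ys us. \<forall>x\<in>AC t0 tf. \<forall>y\<in>Lp 2 t0 tf. \<forall>u\<in>admissible_controls t0 tf ua ub.
        (\<forall>n. xs n \<in> AC t0 tf \<and> ys n \<in> Lp 2 t0 tf \<and> us n \<in> admissible_controls t0 tf ua ub) \<and>
        weakly_converges (XYU t0 tf) (XYU_norm t0 tf)
          (\<lambda>n t. (xs n t, ys n t, us n t)) (\<lambda>t. (x t, y t, u t)) \<longrightarrow>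
        ereal (J x y u) \<le> liminf (\<lambda>n. ereal (J (xs n) (ys n) (us n))))"

definition feasible ::
  "(real \<Rightarrow> real^'nx \<Rightarrow> real^'ny \<Rightarrow> real^'nu \<Rightarrow> real^'nx) \<Rightarrow>
   (real \<Rightarrow> real^'nx \<Rightarrow> real^'ny \<Rightarrow> real^'nu \<Rightarrow> real^'ny) \<Rightarrow> real \<Rightarrow> real \<Rightarrow>
   real^'nu \<Rightarrow> real^'nu \<Rightarrow> real^'nx \<Rightarrow>
   (real \<Rightarrow> real^'nx) \<Rightarrow> (real \<Rightarrow> real^'ny) \<Rightarrow> (real \<Rightarrow> real^'nu) \<Rightarrow> bool" where
  "feasible f g t0 tf ua ub x0 x y u \<longleftrightarrow>
     u \<in> admissible_controls t0 tf ua ub \<and> state_solution f g t0 tf x0 u x y"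

end

theory Submission
  imports Defs "HOL-Complex_Analysis.Great_Picard"
begin

text \<open>
  Take a minimizing sequence of controls and pass to a subsequence that converges weakly-* to some
  admissible \<open>u\<close>. Inserting the root \<open>Y (t, x, u) = y1 (t, x) u + y2 (t, x)\<close> turns the state equation into
  a differential equation whose right-hand side \<open>F\<close> is affine in \<open>u\<close> and, near compact subsets of \<open>Dx\<close>,
  bounded and Lipschitz in \<open>x\<close> with integrable constants. In a tube around the state \<open>x\<close> of \<open>u\<close>,
  Gronwall's lemma bounds the distance between the states of \<open>u\<^sub>n\<close> and \<open>u\<close> by the primitives of
  \<open>F (t, x, u\<^sub>n) - F (t, x, u)\<close>, which tend to zero uniformly because \<open>F\<close> is affine in \<open>u\<close>. So the states
  converge uniformly, their derivatives and the algebraic components converge weakly in \<open>L\<^sup>2\<close>, and the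
  weak lower semi-continuity of the cost applies.

  That the algebraic component of the given solution is \<open>Y\<close>, and not some other root of \<open>g\<close>, has to be
  extracted from the uniqueness of solutions.
\<close>


section \<open>Absolutely continuous functions and the fundamental theorem of calculus\<close>

text \<open>The exponent 4 in the assumptions makes the pieces fit. The reduced right-hand side
  contains the product of \<open>f1\<close> and \<open>y1\<close>, so it is of size \<kappa>^2 with
  \<kappa> in L^4; hence derivatives of states lie in L^2, and \<kappa>^2 is an integrable kernel
  for Gronwall's lemma. Paired with an L^2 test function, however, the coefficient of the control is
  only integrable. Weak L^2 convergence of the controls would not suffice, and their pointwise
  bounds are used to get convergence against all integrable functions. The second obstacle is that
  the estimates hold only near the limit trajectory, and nothing places the states of the other
  controls there beforehand. They are reached indirectly: the equation is cut off outside the tube,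
  its solution is estimated and found to stay in the tube, and uniqueness for the full system
  identifies it with the given state. The same construction, started at a later time, excludes other
  roots of \<open>g\<close>. Derivatives exist almost everywhere only, so all of this rests on both
  halves of Lebesgue's fundamental theorem, proved here with gauge integrals.\<close>

lemma negligible_small_open:
  fixes N :: "'a::euclidean_space set"
  assumes "negligible N" "0 < e"
  obtains G where "open G" "N \<subseteq> G" "G \<in> lmeasurable" "measure lebesgue G < e"
proof -
  obtain T where T: "open T" "N \<subseteq> T" "T - N \<in> lmeasurable" "emeasure lebesgue (T - N) < ennreal e"
    using sets_lebesgue_outer_open[OF negligible_imp_sets[OF assms(1)] assms(2)] by metis
  have Nl: "N \<in> lmeasurable" and N0: "measure lebesgue N = 0"
    using assms(1) negligible_iff_measure by auto
  have Te: "T = (T - N) \<union> N" using T(2) by auto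
  have Tl: "T \<in> lmeasurable"
    using fmeasurable.Un[OF T(3) Nl] Te by simp
  have "measure lebesgue T \<le> measure lebesgue (T - N) + measure lebesgue N"
    using measure_Un_le[of "T - N" lebesgue N] T(3) Nl Te by auto
  moreover have "measure lebesgue (T - N) < e"
    using T(3,4) assms(2) by (simp add: emeasure_eq_measure2 fmeasurableD2 ennreal_less_iff)
  ultimately show ?thesis using that T Tl N0 by auto
qed

text \<open>Absolute continuity speaks of sets of intervals, a Riemann sum of tagged pairs. Two tags
  can share an interval only if it is degenerate, because interiors are disjoint, and there
  \<open>F\<close> vanishes; so forgetting the tags loses nothing.\<close>

lemma sum_tagged_division_snd:
  fixes F :: "real set \<Rightarrow> 'b::comm_monoid_add"
  assumes p: "p tagged_partial_division_of {a..b::real}"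
    and F: "\<And>c. F {c..c} = 0"
  shows "(\<Sum>(x,K)\<in>p. F K) = (\<Sum>K\<in>snd ` p. F K)"
proof -
  have "F K1 = 0" if q: "(x1,K1) \<in> p" "(x2,K1) \<in> p" "x1 \<noteq> x2" for x1 x2 K1
  proof -
    obtain u v where K: "K1 = cbox u v" using tagged_partial_division_ofD(4)[OF p q(1)] by auto
    have "interior K1 \<inter> interior K1 = {}"
      using tagged_partial_division_ofD(5)[OF p that(1,2)] that(3) by auto
    moreover have "x1 \<in> K1" using tagged_partial_division_ofD(2)[OF p that(1)] by auto
    ultimately have "u = v" using K by (auto simp: box_eq_empty)
    then show ?thesis using K F by simp
  qed
  then show ?thesis
    using sum.reindex_nontrivial[OF tagged_partial_division_ofD(1)[OF p], of snd F]
    by (fastforce simp: case_prod_unfold)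
qed

text \<open>The gauge does two jobs. At a tag outside \<open>N\<close> it makes the increment of
  \<open>x\<close> close to the length times \<open>h\<close>; around tags in \<open>N\<close> it
  confines the intervals to an open set of measure below the \<delta> of absolute continuity, so
  that the increments over them are small in total. Integrability of \<open>h\<close> is a result of
  the argument, not a premise.\<close>

lemma AC_has_integral_negligible:
  fixes x h :: "real \<Rightarrow> 'a::euclidean_space"
  assumes x: "x \<in> AC a b" and ab: "a \<le> b" and N: "negligible N"
    and d: "\<And>t. t \<in> {a..b} - N \<Longrightarrow> (x has_vector_derivative h t) (at t within {a..b})"
  shows "(h has_integral (x b - x a)) {a..b}"
proof -
  \<comment> \<open>With the value 0 on \<open>N\<close>, a term tagged in \<open>N\<close> is just
    an increment of \<open>x\<close>, which absolute continuity controls however wild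
    \<open>h\<close> is there.\<close>
  define g where "g t = (if t \<in> N then 0 else h t)" for t
  have "(g has_integral (x b - x a)) (cbox a b)"
    unfolding has_integral
  proof (intro allI impI)
    fix e :: real assume e: "0 < e"
    \<comment> \<open>The \<open>+ 1\<close> covers \<open>a = b\<close> and makes the total error
      outside \<open>N\<close> strictly smaller than \<open>e / 2\<close>.\<close>
    define e2 where "e2 = e / (2 * (b - a + 1))"
    have e2: "0 < e2" "e2 * (b - a) < e / 2" using e ab by (auto simp: e2_def field_simps)
    obtain \<delta> where \<delta>: "\<delta> > 0" and AC\<delta>: "\<And>D. D division_of \<Union>D \<Longrightarrow> \<Union>D \<subseteq> {a..b} \<Longrightarrow>
        (\<Sum>K\<in>D. Sup K - Inf K) < \<delta> \<Longrightarrow> (\<Sum>K\<in>D. norm (x (Sup K) - x (Inf K))) < e / 2"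
      using x e unfolding AC_def by (force dest: spec[of _ "e/2"])
    obtain G where G: "open G" "N \<subseteq> G" "G \<in> lmeasurable" "measure lebesgue G < \<delta>"
      using negligible_small_open[OF N \<delta>] .
    have "\<exists>\<gamma>>0. (t \<in> N \<longrightarrow> ball t \<gamma> \<subseteq> G) \<and> (t \<in> {a..b} - N \<longrightarrow>
           (\<forall>s\<in>{a..b}. norm (s-t) < \<gamma> \<longrightarrow> norm (x s - x t - (s-t) *\<^sub>R h t) \<le> e2 * norm (s-t)))" for t
    proof (cases "t \<in> N")
      case True
      then show ?thesis using G by (meson DiffD2 openE subsetD)
    next
      case False
      show ?thesis
      proof (cases "t \<in> {a..b}")
        case True
        then show ?thesis using d[of t] False e2
          unfolding has_vector_derivative_def has_derivative_within_alt by auto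
      next
        case False
        then show ?thesis using \<open>t \<notin> N\<close> by (intro exI[of _ 1]) auto
      qed
    qed
    then obtain \<gamma> where \<gamma>: "\<And>t. \<gamma> t > 0" "\<And>t. t \<in> N \<Longrightarrow> ball t (\<gamma> t) \<subseteq> G"
      "\<And>t s. t \<in> {a..b} - N \<Longrightarrow> s \<in> {a..b} \<Longrightarrow> norm (s-t) < \<gamma> t \<Longrightarrow> norm (x s - x t - (s-t) *\<^sub>R h t) \<le> e2 * norm (s-t)"
      by metis
    show "\<exists>\<gamma>. gauge \<gamma> \<and> (\<forall>\<D>. \<D> tagged_division_of cbox a b \<and> \<gamma> fine \<D> \<longrightarrow>
        norm ((\<Sum>(x, k)\<in>\<D>. measure lborel k *\<^sub>R g x) - (x b - x a)) < e)"
    proof (intro exI[of _ "\<lambda>t. ball t (\<gamma> t)"] conjI allI impI; (elim conjE)?)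
      show "gauge (\<lambda>t. ball t (\<gamma> t))" using \<gamma>(1) gauge_ball_dependent by blast
      fix p assume p: "p tagged_division_of cbox a b" and fine: "(\<lambda>t. ball t (\<gamma> t)) fine p"
      have fin: "finite p" using p by blast
      have ba: "b - a = (\<Sum>(t,K)\<in>p. Sup K - Inf K)" "x b - x a = (\<Sum>(t,K)\<in>p. x(Sup K) - x(Inf K))"
        using additive_tagged_division_1[where f= "\<lambda>x. x"] additive_tagged_division_1[where f= x] ab p by auto
      define pN where "pN = {q \<in> p. fst q \<in> N}"
      have pN: "pN \<subseteq> p" by (auto simp: pN_def)
      have Kuv: "\<exists>u v. K = {u..v} \<and> u \<le> t \<and> t \<le> v \<and> a \<le> u \<and> v \<le> b" if tK: "(t,K) \<in> p" for t K
      proof -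
        obtain u v where "K = cbox u v" using tagged_division_ofD(4)[OF p tK] by blast
        moreover have "t \<in> K" "K \<subseteq> cbox a b" using tagged_division_ofD(2,3)[OF p tK] by auto
        ultimately show ?thesis by auto
      qed
      \<comment> \<open>Both endpoints are compared with the tag; as the tag lies between them, the
        two error bounds add up to \<open>e2\<close> times the length of the interval.\<close>
      have good: "norm (measure lborel K *\<^sub>R g t - (x (Sup K) - x (Inf K))) \<le> e2 * (Sup K - Inf K)"
        if tK: "(t,K) \<in> p" and tN: "t \<notin> N" for t K
      proof -
        obtain u v where K: "K = {u..v}" "u \<le> t" "t \<le> v" "a \<le> u" "v \<le> b" using Kuv[OF tK] by blast
        have sub: "K \<subseteq> ball t (\<gamma> t)" using fine tK by auto
        have tab: "t \<in> {a..b} - N" using K tN by auto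
        have 1: "norm (x v - x t - (v-t) *\<^sub>R h t) \<le> e2 * norm (v-t)"
        proof (rule \<gamma>(3)[OF tab])
          show "v \<in> {a..b}" using K by auto
          have "v \<in> ball t (\<gamma> t)" using subsetD[OF sub, of v] K by simp
          then show "norm (v-t) < \<gamma> t" by (simp add: dist_norm norm_minus_commute)
        qed
        have 2: "norm (x u - x t - (u-t) *\<^sub>R h t) \<le> e2 * norm (u-t)"
        proof (rule \<gamma>(3)[OF tab])
          show "u \<in> {a..b}" using K by auto
          have "u \<in> ball t (\<gamma> t)" using subsetD[OF sub, of u] K by simp
          then show "norm (u-t) < \<gamma> t" by (simp add: dist_norm norm_minus_commute)
        qed
        have "measure lborel K *\<^sub>R g t - (x (Sup K) - x (Inf K)) = (x u - x t - (u-t) *\<^sub>R h t) - (x v - x t - (v-t) *\<^sub>R h t)"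
          using K tN by (simp add: g_def algebra_simps)
        then have "norm (measure lborel K *\<^sub>R g t - (x (Sup K) - x (Inf K))) \<le> e2 * norm (u-t) + e2 * norm (v-t)"
          using 1 2 norm_triangle_ineq4 by (smt (verit))
        also have "\<dots> = e2 * (Sup K - Inf K)" using K by (simp add: algebra_simps)
        finally show ?thesis .
      qed
      have I: "norm (\<Sum>(t,K)\<in>p - pN. measure lborel K *\<^sub>R g t - (x (Sup K) - x (Inf K))) < e / 2"
      proof -
        have "norm (\<Sum>(t,K)\<in>p - pN. measure lborel K *\<^sub>R g t - (x (Sup K) - x (Inf K))) \<le> (\<Sum>(t,K)\<in>p - pN. e2 * (Sup K - Inf K))"
          by (rule sum_norm_le) (auto simp: pN_def intro!: good)
        also have "\<dots> \<le> (\<Sum>(t,K)\<in>p. e2 * (Sup K - Inf K))"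
          using fin e2(1) by (intro sum_mono2) (auto dest!: Kuv)
        also have "\<dots> = e2 * (b - a)" unfolding ba(1) sum_distrib_left by (simp add: case_prod_unfold)
        finally show ?thesis using e2 by simp
      qed
      have II: "norm (\<Sum>(t,K)\<in>pN. measure lborel K *\<^sub>R g t - (x (Sup K) - x (Inf K))) < e / 2"
      proof -
        have pp: "pN tagged_partial_division_of {a..b}"
          using p pN tagged_partial_division_subset unfolding tagged_division_of_def box_real by blast
        have div: "snd ` pN division_of \<Union>(snd ` pN)" using partial_division_of_tagged_division[OF pp] .
        have sub: "\<Union>(snd ` pN) \<subseteq> {a..b}" using tagged_partial_division_ofD(3)[OF pp] by (auto simp: subset_eq)
        have subG: "\<Union>(snd ` pN) \<subseteq> G"
        proof -
          have "K \<subseteq> G" if "(t,K) \<in> pN" for t K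
          proof -
            have "(t,K) \<in> p" "t \<in> N" using that by (auto simp: pN_def)
            then have "K \<subseteq> ball t (\<gamma> t)" using fine by auto
            then show ?thesis using \<gamma>(2)[OF \<open>t \<in> N\<close>] by blast
          qed
          then show ?thesis by (intro Union_least) force
        qed
        have cont: "Sup K - Inf K = measure lebesgue K" if "K \<in> snd ` pN" for K
          using that Kuv pN by (fastforce simp: )
        have "(\<Sum>K\<in>snd ` pN. Sup K - Inf K) = (\<Sum>K\<in>snd ` pN. measure lebesgue K)"
          using cont by (rule sum.cong[OF refl])
        also have "\<dots> = measure lebesgue (\<Union>(snd ` pN))"
          using content_division[OF div] .
        also have "\<dots> \<le> measure lebesgue G"
          using subG G(3) lmeasurable_division[OF div] by (intro measure_mono_fmeasurable) auto
        finally have "(\<Sum>K\<in>snd ` pN. Sup K - Inf K) < \<delta>" using G(4) by simp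
        then have "(\<Sum>K\<in>snd ` pN. norm (x (Sup K) - x (Inf K))) < e / 2"
          using AC\<delta> div sub by blast
        then have "(\<Sum>(t,K)\<in>pN. norm (x (Sup K) - x (Inf K))) < e / 2"
          using sum_tagged_division_snd[OF pp, of "\<lambda>K. norm (x (Sup K) - x (Inf K))"] by simp
        moreover have "norm (\<Sum>(t,K)\<in>pN. measure lborel K *\<^sub>R g t - (x (Sup K) - x (Inf K)))
            \<le> (\<Sum>(t,K)\<in>pN. norm (x (Sup K) - x (Inf K)))"
          by (rule sum_norm_le) (auto simp: pN_def g_def norm_minus_commute)
        ultimately show ?thesis by simp
      qed
      have "(\<Sum>(t, K)\<in>p. measure lborel K *\<^sub>R g t) - (x b - x a) = (\<Sum>(t,K)\<in>p. measure lborel K *\<^sub>R g t - (x (Sup K) - x (Inf K)))"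
        unfolding ba(2) by (simp add: sum_subtractf case_prod_unfold)
      also have "\<dots> = (\<Sum>(t,K)\<in>p - pN. measure lborel K *\<^sub>R g t - (x (Sup K) - x (Inf K))) +
          (\<Sum>(t,K)\<in>pN. measure lborel K *\<^sub>R g t - (x (Sup K) - x (Inf K)))"
        by (rule sum.subset_diff[OF pN fin])
      finally show "norm ((\<Sum>(t, K)\<in>p. measure lborel K *\<^sub>R g t) - (x b - x a)) < e"
        using I II norm_triangle_ineq by (smt (verit) field_sum_of_halves)
    qed
  qed
  then have "(g has_integral (x b - x a)) {a..b}" by simp
  then show ?thesis
    by (rule has_integral_spike[OF N, rotated]) (auto simp: g_def)
qed

lemma AC_subinterval:
  assumes "x \<in> AC a b" "a \<le> s" "t \<le> b"
  shows "x \<in> AC s t"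
  unfolding AC_def
proof (intro CollectI allI impI)
  fix e :: real assume "0 < e"
  then obtain \<delta> where \<delta>: "\<delta> > 0" "\<And>D. D division_of \<Union>D \<and> \<Union>D \<subseteq> {a..b} \<and>
        (\<Sum>K\<in>D. Sup K - Inf K) < \<delta> \<longrightarrow> (\<Sum>K\<in>D. norm (x (Sup K) - x (Inf K))) < e"
    using assms unfolding AC_def by blast
  have "{s..t} \<subseteq> {a..b}" using assms by auto
  then show "\<exists>\<delta>>0. \<forall>D. D division_of \<Union>D \<and> \<Union>D \<subseteq> {s..t} \<and> (\<Sum>K\<in>D. Sup K - Inf K) < \<delta> \<longrightarrow>
       (\<Sum>K\<in>D. norm (x (Sup K) - x (Inf K))) < e"
    using \<delta> by (intro exI[of _ \<delta>]) blast
qed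

lemma AE_lebesgue_on_iff_negligible:
  assumes "S \<in> sets lebesgue"
  shows "(AE t in lebesgue_on S. P t) \<longleftrightarrow> (\<exists>N. negligible N \<and> (\<forall>t\<in>S - N. P t))"
proof
  assume "AE t in lebesgue_on S. P t"
  then have "AE t in lebesgue. t \<in> S \<longrightarrow> P t" using AE_restrict_space_iff assms by (metis sets.Int_space_eq2 sets_lebesgue_on_refl)
  then obtain N where "N \<in> null_sets lebesgue" "{t \<in> space lebesgue. \<not> (t \<in> S \<longrightarrow> P t)} \<subseteq> N"
    by (auto simp: eventually_ae_filter)
  then show "\<exists>N. negligible N \<and> (\<forall>t\<in>S - N. P t)"
    by (intro exI[of _ N]) (auto simp: negligible_iff_null_sets)
next
  assume "\<exists>N. negligible N \<and> (\<forall>t\<in>S - N. P t)"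
  then obtain N where N: "negligible N" "\<forall>t\<in>S - N. P t" by blast
  then have "AE t in lebesgue. t \<in> S \<longrightarrow> P t"
    by (intro AE_I'[of N]) (auto simp: negligible_iff_null_sets)
  then show "AE t in lebesgue_on S. P t"
    using AE_restrict_space_iff assms by (metis sets.Int_space_eq2 sets_lebesgue_on_refl)
qed

theorem AC_has_integral:
  fixes x h :: "real \<Rightarrow> 'a::euclidean_space"
  assumes x: "x \<in> AC a b"
    and d: "AE t in lebesgue_on {a..b}. (x has_vector_derivative h t) (at t within {a..b})"
    and st: "a \<le> s" "s \<le> t" "t \<le> b"
  shows "(h has_integral (x t - x s)) {s..t}"
proof -
  obtain N where N: "negligible N" "\<And>r. r \<in> {a..b} - N \<Longrightarrow> (x has_vector_derivative h r) (at r within {a..b})"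
    using d AE_lebesgue_on_iff_negligible[of "{a..b}"] by auto
  show ?thesis
    by (rule AC_has_integral_negligible[OF AC_subinterval[OF x] _ N(1)])
       (use st in \<open>auto intro!: has_vector_derivative_within_subset[OF N(2)]\<close>)
qed

text \<open>The premise bounds only finite disjoint subfamilies. Vitali's covering lemma selects a
  countable disjoint subfamily whose fivefold enlargements still cover \<open>E\<close>, and its
  finite parts bound the measure of the whole enlarged union.\<close>

lemma negligible_Vitali_intervals:
  fixes E :: "real set"
  assumes e: "\<And>e. 0 < e \<Longrightarrow> \<exists>(K::(real\<times>real) set). (\<forall>i\<in>K. 0 < snd i \<and> snd i \<le> B) \<and> E \<subseteq> (\<Union>i\<in>K. cball (fst i) (snd i)) \<and>
     (\<forall>F. finite F \<and> F \<subseteq> K \<and> pairwise (\<lambda>i j. disjnt (cball (fst i) (snd i)) (cball (fst j) (snd j))) F \<longrightarrow> (\<Sum>i\<in>F. snd i) \<le> e)"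
  shows "negligible E"
  unfolding negligible_outer_le
proof (intro allI impI)
  fix e :: real assume "0 < e"
  \<comment> \<open>The fivefold enlargement of an interval of radius r has length 10 r.\<close>
  then have e10: "0 < e / 10" by simp
  obtain K :: "(real\<times>real) set" where K': "(\<forall>i\<in>K. 0 < snd i \<and> snd i \<le> B) \<and> E \<subseteq> (\<Union>i\<in>K. cball (fst i) (snd i)) \<and>
     (\<forall>F. finite F \<and> F \<subseteq> K \<and> pairwise (\<lambda>i j. disjnt (cball (fst i) (snd i)) (cball (fst j) (snd j))) F \<longrightarrow> (\<Sum>i\<in>F. snd i) \<le> e / 10)"
    using e[OF e10] by (elim exE) (rule that)
  have K: "\<And>i. i \<in> K \<Longrightarrow> 0 < snd i \<and> snd i \<le> B" using K' by blast
  have cov: "E \<subseteq> (\<Union>i\<in>K. cball (fst i) (snd i))" using K' by blast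
  have sm: "\<And>F. finite F \<Longrightarrow> F \<subseteq> K \<Longrightarrow> pairwise (\<lambda>i j. disjnt (cball (fst i) (snd i)) (cball (fst j) (snd j))) F \<Longrightarrow> (\<Sum>i\<in>F. snd i) \<le> e / 10"
    using K' by blast
  obtain C where C: "countable C" "C \<subseteq> K" "pairwise (\<lambda>i j. disjnt (cball (fst i) (snd i)) (cball (fst j) (snd j))) C"
     "E \<subseteq> (\<Union>i\<in>C. cball (fst i) (5 * snd i))"
    by (rule Vitali_covering_lemma_cballs[OF cov K])
  have fb: "measure lebesgue (\<Union>i\<in>F. cball (fst i) (5 * snd i)) \<le> e" if "finite F" "F \<subseteq> C" for F
  proof -
    have "measure lebesgue (\<Union>i\<in>F. cball (fst i) (5 * snd i)) \<le> (\<Sum>i\<in>F. measure lebesgue (cball (fst i) (5 * snd i)))"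
      using that by (intro measure_UNION_le) auto
    also have "\<dots> = 10 * (\<Sum>i\<in>F. snd i)"
      unfolding sum_distrib_left using that C(2) K by (intro sum.cong refl) (force simp: cball_eq_atLeastAtMost)
    also have "\<dots> \<le> e" using sm[OF that(1) subset_trans[OF that(2) C(2)] pairwise_subset[OF C(3) that(2)]] by simp
    finally show ?thesis .
  qed
  show "\<exists>T. E \<subseteq> T \<and> T \<in> lmeasurable \<and> measure lebesgue T \<le> e"
  proof (intro exI conjI)
    show "E \<subseteq> (\<Union>i\<in>C. cball (fst i) (5 * snd i))" by fact
    show "(\<Union>i\<in>C. cball (fst i) (5 * snd i)) \<in> lmeasurable"
      using fb by (intro fmeasurable_UN_bound[OF C(1), of _ _ e]) auto
    show "measure lebesgue (\<Union>i\<in>C. cball (fst i) (5 * snd i)) \<le> e"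
      using fb by (intro measure_UN_bound[OF C(1)]) auto
  qed
qed

text \<open>If the difference quotients at the points of a set stay away from \<open>h\<close>, then the intervals on which
  they do so form a Vitali covering of this set, and Henstock's lemma makes their total length small.\<close>

theorem has_vector_derivative_integral_AE:
  fixes h :: "real \<Rightarrow> 'a::euclidean_space"
  assumes h: "h integrable_on {a..b}"
  shows "AE t in lebesgue_on {a..b}. ((\<lambda>t. integral {a..t} h) has_vector_derivative h t) (at t within {a..b})"
proof -
  define H where "H t = integral {a..t} h" for t
  have Hd: "H v - H u = integral {u..v} h" if "a \<le> u" "u \<le> v" "v \<le> b" for u v
    using Henstock_Kurzweil_Integration.integral_combine[of a u v h] that integrable_on_subinterval[OF h, of a v]
    by (auto simp: H_def algebra_simps)
  define E where "E n = {t \<in> {a..b}. \<forall>d>0. \<exists>s\<in>{a..b}. 0 < \<bar>s-t\<bar> \<and> \<bar>s-t\<bar> < d \<and> norm (H s - H t - (s-t) *\<^sub>R h t) > \<bar>s-t\<bar> / real (Suc n)}" for n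
  have neg: "negligible (E n)" for n
  proof (rule negligible_Vitali_intervals[where B = "b - a"])
    fix e :: real assume e: "0 < e"
    \<comment> \<open>Each interval of the covering will contribute more than its length divided by
      \<open>Suc n\<close> to the Henstock sum, so this tolerance forces a total length below
      \<open>e\<close>.\<close>
    obtain \<gamma> where \<gamma>: "gauge \<gamma>" and small: "\<And>p. p tagged_partial_division_of (cbox a b) \<Longrightarrow> \<gamma> fine p \<Longrightarrow>
             (\<Sum>(x,k)\<in>p. norm(measure lborel k *\<^sub>R h x - integral k h)) < e / real (Suc n)"
      using Henstock_lemma[of h a b "e / real (Suc n)"] h e by auto
    \<comment> \<open>The tag \<open>t\<close> is an endpoint of the interval, while the covering
      lemma wants balls; hence the interval is recorded by centre and radius and its length is
      \<open>2 * r\<close>.\<close>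
    define good where "good t c r \<longleftrightarrow> 0 < r \<and> (t = c - r \<or> t = c + r) \<and> {c-r..c+r} \<subseteq> {a..b} \<and> {c-r..c+r} \<subseteq> \<gamma> t \<and>
       norm (integral {c-r..c+r} h - (2*r) *\<^sub>R h t) > 2 * r / real (Suc n)" for t c r
    define K where "K = {(c,r). \<exists>t. good t c r}"
    show "\<exists>(K::(real\<times>real) set). (\<forall>i\<in>K. 0 < snd i \<and> snd i \<le> b - a) \<and> E n \<subseteq> (\<Union>i\<in>K. cball (fst i) (snd i)) \<and>
     (\<forall>F. finite F \<and> F \<subseteq> K \<and> pairwise (\<lambda>i j. disjnt (cball (fst i) (snd i)) (cball (fst j) (snd j))) F \<longrightarrow> (\<Sum>i\<in>F. snd i) \<le> e)"
    proof (intro exI[of _ K] conjI allI impI)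
      show "\<forall>i\<in>K. 0 < snd i \<and> snd i \<le> b - a" by (auto simp: K_def good_def)
      show "E n \<subseteq> (\<Union>i\<in>K. cball (fst i) (snd i))"
      proof
        fix t assume t: "t \<in> E n"
        obtain d where d: "d > 0" "ball t d \<subseteq> \<gamma> t" using \<gamma> unfolding gauge_def by (meson openE)
        obtain s where s: "s \<in> {a..b}" "0 < \<bar>s-t\<bar>" "\<bar>s-t\<bar> < d" "norm (H s - H t - (s-t) *\<^sub>R h t) > \<bar>s-t\<bar> / real (Suc n)"
          using t d(1) unfolding E_def by blast
        have tab: "t \<in> {a..b}" using t by (auto simp: E_def)
        define c where "c = (s+t)/2"
        define r where "r = \<bar>s-t\<bar>/2"
        have int: "{c-r..c+r} = {min s t..max s t}" by (auto simp: c_def r_def field_simps abs_if min_def max_def)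
        have i: "norm (integral {min s t..max s t} h - (2*r) *\<^sub>R h t) = norm (H s - H t - (s-t) *\<^sub>R h t)"
        proof (cases "s \<le> t")
          case True
          have r2: "2 * r = t - s" using True by (simp add: r_def)
          have "integral {min s t..max s t} h - (2*r) *\<^sub>R h t = - (H s - H t - (s-t) *\<^sub>R h t)"
            unfolding r2 using Hd[of s t] s(1) tab True by (simp add: min_def max_def algebra_simps)
          then show ?thesis by (metis norm_minus_cancel)
        next
          case False
          have r2: "2 * r = s - t" using False by (simp add: r_def)
          show ?thesis
            unfolding r2 using False Hd[of t s] s(1) tab by (simp add: min_def max_def algebra_simps)
        qed
        have "good t c r"
          unfolding good_def int i
        proof (intro conjI)
          show "0 < r" using s(2) by (simp add: r_def)
          show "t = c - r \<or> t = c + r" by (cases "s \<le> t") (simp_all add: c_def r_def field_simps)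
          show "{min s t..max s t} \<subseteq> {a..b}" using s(1) tab by auto
          have "{min s t..max s t} \<subseteq> ball t d" using s(3) by (auto simp: dist_real_def min_def max_def split: if_splits)
          then show "{min s t..max s t} \<subseteq> \<gamma> t" using d(2) by blast
          show "2 * r / real (Suc n) < norm (H s - H t - (s-t) *\<^sub>R h t)" using s(4) by (simp add: r_def)
        qed
        moreover have "t \<in> cball c r" using \<open>good t c r\<close> by (auto simp: good_def dist_real_def)
        ultimately show "t \<in> (\<Union>i\<in>K. cball (fst i) (snd i))" by (force simp: K_def)
      qed
      fix F assume F: "finite F \<and> F \<subseteq> K \<and> pairwise (\<lambda>i j. disjnt (cball (fst i) (snd i)) (cball (fst j) (snd j))) F"
      have "\<forall>i\<in>F. \<exists>t. good t (fst i) (snd i)" using F by (force simp: K_def)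
      then obtain \<tau> where \<tau>: "\<And>i. i \<in> F \<Longrightarrow> good (\<tau> i) (fst i) (snd i)" by metis
      define q where "q i = (\<tau> i, {fst i - snd i..fst i + snd i})" for i
      have inj: "inj_on q F"
      proof (rule inj_onI)
        fix i j assume ij: "i \<in> F" "j \<in> F" "q i = q j"
        show "i = j"
        proof (rule ccontr)
          assume "i \<noteq> j"
          then have "disjnt (cball (fst i) (snd i)) (cball (fst j) (snd j))" using F ij by (meson pairwiseD)
          moreover have "cball (fst i) (snd i) = cball (fst j) (snd j)" using ij(3) by (simp add: q_def cball_eq_atLeastAtMost)
          moreover have "snd i > 0" using \<tau>[OF ij(1)] by (simp add: good_def)
          ultimately show False by (simp add: disjnt_def)
        qed
      qed
      have disj: "interior {fst i - snd i..fst i + snd i} \<inter> interior {fst j - snd j..fst j + snd j} = {}"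
        if "i \<in> F" "j \<in> F" "i \<noteq> j" for i j
      proof -
        have "disjnt (cball (fst i) (snd i)) (cball (fst j) (snd j))" using F that by (meson pairwiseD)
        then show ?thesis unfolding cball_eq_atLeastAtMost disjnt_def using interior_subset by blast
      qed
      have "q ` F tagged_partial_division_of cbox a b"
        unfolding tagged_partial_division_of_def
      proof (intro conjI allI impI)
        show "finite (q ` F)" using F by auto
        fix x k assume xk: "(x,k) \<in> q ` F"
        then obtain i where i: "i \<in> F" "x = \<tau> i" "k = {fst i - snd i..fst i + snd i}" by (auto simp: q_def)
        show "x \<in> k" "k \<subseteq> cbox a b" using \<tau>[OF i(1)] i by (auto simp: good_def)
        show "\<exists>a b. k = cbox a b" using i by (metis box_real(2))
      next
        fix x1 k1 x2 k2 assume A: "(x1,k1) \<in> q ` F \<and> (x2,k2) \<in> q ` F \<and> (x1,k1) \<noteq> (x2,k2)"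
        then obtain i j where "i \<in> F" "(x1,k1) = q i" "j \<in> F" "(x2,k2) = q j" by (elim conjE imageE)
        moreover from this have "i \<noteq> j" using A by auto
        ultimately have "i \<in> F" "(x1,k1) = q i" "j \<in> F" "(x2,k2) = q j" "i \<noteq> j" by blast+
        then show "interior k1 \<inter> interior k2 = {}" using disj[of i j] by (auto simp: q_def)
      qed
      moreover have "\<gamma> fine q ` F" using \<tau> by (auto simp: fine_def q_def good_def)
      ultimately have "(\<Sum>(x,k)\<in>q ` F. norm(measure lborel k *\<^sub>R h x - integral k h)) < e / real (Suc n)" by (rule small)
      then have *: "(\<Sum>i\<in>F. norm((2 * snd i) *\<^sub>R h (\<tau> i) - integral {fst i - snd i..fst i + snd i} h)) < e / real (Suc n)"
      proof (subst (asm) sum.reindex[OF inj])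
        have "(\<Sum>i\<in>F. norm((2 * snd i) *\<^sub>R h (\<tau> i) - integral {fst i - snd i..fst i + snd i} h)) =
          sum ((\<lambda>(x, k). norm (measure lborel k *\<^sub>R h x - integral k h)) \<circ> q) F"
          using \<tau> by (intro sum.cong refl) (force simp: q_def good_def)
        then show "sum ((\<lambda>(x, k). norm (measure lborel k *\<^sub>R h x - integral k h)) \<circ> q) F < e / real (Suc n) \<Longrightarrow> ?thesis" by simp
      qed
      have "(\<Sum>i\<in>F. 2 * snd i / real (Suc n)) \<le> (\<Sum>i\<in>F. norm((2 * snd i) *\<^sub>R h (\<tau> i) - integral {fst i - snd i..fst i + snd i} h))"
        using \<tau> by (intro sum_mono) (auto simp: good_def norm_minus_commute less_imp_le)
      then have "2 * (\<Sum>i\<in>F. snd i) / real (Suc n) < e / real (Suc n)"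
        using * by (simp add: sum_distrib_left sum_divide_distrib)
      then have "2 * (\<Sum>i\<in>F. snd i) < e" by (simp add: divide_less_cancel)
      moreover have "(\<Sum>i\<in>F. snd i) \<ge> 0" using \<tau> by (intro sum_nonneg) (auto simp: good_def less_imp_le)
      ultimately show "(\<Sum>i\<in>F. snd i) \<le> e" by simp
    qed
  qed
  have "(H has_vector_derivative h t) (at t within {a..b})" if t: "t \<in> {a..b} - (\<Union>n. E n)" for t
    unfolding has_vector_derivative_def has_derivative_within_alt
  proof (intro conjI allI impI)
    show "bounded_linear (\<lambda>x. x *\<^sub>R h t)" by (rule bounded_linear_scaleR_left)
    fix e :: real assume "0 < e"
    then obtain n where n: "1 / real (Suc n) < e" using nat_approx_posE by blast
    have "t \<notin> E n" "t \<in> {a..b}" using t by auto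
    then obtain d where d: "d > 0" "\<And>s. s \<in> {a..b} \<Longrightarrow> 0 < \<bar>s-t\<bar> \<Longrightarrow> \<bar>s-t\<bar> < d \<Longrightarrow> norm (H s - H t - (s-t) *\<^sub>R h t) \<le> \<bar>s-t\<bar> / real (Suc n)"
      unfolding E_def mem_Collect_eq not_less[symmetric] by blast
    have "norm (H s - H t - (s-t) *\<^sub>R h t) \<le> e * norm (s - t)" if "s \<in> {a..b}" "norm (s-t) < d" for s
    proof (cases "s = t")
      case False
      then have "norm (H s - H t - (s-t) *\<^sub>R h t) \<le> \<bar>s-t\<bar> * (1 / real (Suc n))" using d(2)[of s] that by simp
      also have "\<dots> \<le> \<bar>s-t\<bar> * e" using n by (intro mult_left_mono) auto
      finally show ?thesis by (simp add: mult.commute)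
    qed simp
    then show "\<exists>d>0. \<forall>y\<in>{a..b}. norm (y - t) < d \<longrightarrow> norm (H y - H t - (y - t) *\<^sub>R h t) \<le> e * norm (y - t)"
      using d(1) by blast
  qed
  moreover have "negligible (\<Union>n. E n)" using neg by (intro negligible_countable_Union) auto
  ultimately show ?thesis
    unfolding H_def[symmetric] by (subst AE_lebesgue_on_iff_negligible) auto
qed

section \<open>Integrals over subintervals of a fixed interval\<close>

lemma AE_lebesgue_on_subset:
  assumes "AE t in lebesgue_on T. P t" "S \<subseteq> T" "S \<in> sets lebesgue" "T \<in> sets lebesgue"
  shows "AE t in lebesgue_on S. P t"
  using assms by (auto simp: AE_lebesgue_on_iff_negligible)

lemma integral_lebesgue_on_interval:
  fixes h :: "real \<Rightarrow> 'a::euclidean_space"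
  assumes "integrable (lebesgue_on {a..b}) h" "a \<le> s" "t \<le> b"
  shows "integrable (lebesgue_on {s..t}) h" and "h integrable_on {s..t}"
    and "integral {s..t} h = (LINT \<tau>|lebesgue_on {s..t}. h \<tau>)"
proof -
  show 1: "integrable (lebesgue_on {s..t}) h"
    using assms by (intro integrable_subinterval[OF assms(1)]) auto
  show "h integrable_on {s..t}" by (rule integrable_on_lebesgue_on[OF 1]) simp
  show "integral {s..t} h = (LINT \<tau>|lebesgue_on {s..t}. h \<tau>)"
    by (rule integral_unique[OF has_integral_integral_lebesgue_on[OF 1]]) simp
qed

lemma integral_interval_mono_AE:
  fixes g k :: "real \<Rightarrow> real"
  assumes "integrable (lebesgue_on {a..b}) g" "integrable (lebesgue_on {a..b}) k" "a \<le> s" "t \<le> b"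
    and "AE \<tau> in lebesgue_on {a..b}. g \<tau> \<le> k \<tau>"
  shows "integral {s..t} g \<le> integral {s..t} k"
proof -
  have "AE \<tau> in lebesgue_on {s..t}. g \<tau> \<le> k \<tau>" using assms by (intro AE_lebesgue_on_subset[OF assms(5)]) auto
  then show ?thesis
    using integral_lebesgue_on_interval[OF assms(1,3,4)] integral_lebesgue_on_interval[OF assms(2,3,4)]
    by (simp add: integral_mono_AE)
qed

lemma norm_integral_interval_le_AE:
  fixes h :: "real \<Rightarrow> 'a::euclidean_space"
  assumes "integrable (lebesgue_on {a..b}) h" "integrable (lebesgue_on {a..b}) k" "a \<le> s" "t \<le> b"
    and "AE \<tau> in lebesgue_on {a..b}. norm (h \<tau>) \<le> k \<tau>"
  shows "norm (integral {s..t} h) \<le> integral {s..t} k"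
proof -
  have "norm (integral {s..t} h) \<le> integral {s..t} (\<lambda>\<tau>. norm (h \<tau>))"
    using integral_lebesgue_on_interval[OF assms(1,3,4)]
      integral_lebesgue_on_interval[OF integrable_norm[OF assms(1)] assms(3,4)] by simp
  also have "\<dots> \<le> integral {s..t} k"
    by (rule integral_interval_mono_AE[OF integrable_norm[OF assms(1)] assms(2-5)])
  finally show ?thesis .
qed

lemma integral_interval_combine:
  fixes h :: "real \<Rightarrow> 'a::euclidean_space"
  assumes "integrable (lebesgue_on {a..b}) h" "a \<le> s" "s \<le> t" "t \<le> b"
  shows "integral {a..s} h + integral {s..t} h = integral {a..t} h"
  using Henstock_Kurzweil_Integration.integral_combine[of a s t h] integral_lebesgue_on_interval(2)[OF assms(1), of a t] assms by auto

lemma integrable_bounded_AE: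
  fixes h :: "'t \<Rightarrow> 'a::euclidean_space"
  assumes "h \<in> borel_measurable M" "integrable M k" "AE t in M. norm (h t) \<le> k t"
  shows "integrable M h"
proof (rule Bochner_Integration.integrable_bound[OF assms(2,1)])
  show "AE t in M. norm (h t) \<le> norm (k t)" using assms(3) by eventually_elim auto
qed

lemma continuous_on_integral_interval:
  fixes h :: "real \<Rightarrow> 'a::euclidean_space"
  assumes "integrable (lebesgue_on {a..b}) h"
  shows "continuous_on {a..b} (\<lambda>t. integral {a..t} h)"
  by (rule indefinite_integral_continuous_1) (rule integral_lebesgue_on_interval(2)[OF assms order_refl order_refl])

section \<open>Construction of absolutely continuous functions\<close>

lemma division_real_interval:
  assumes "D division_of S" "K \<in> D"
  obtains u v :: real where "K = {u..v}" "u \<le> v" "Sup K = v" "Inf K = u" "{u..v} \<subseteq> S"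
proof -
  obtain u v where K: "K = cbox u v" using division_ofD(4)[OF assms] by blast
  then have "u \<le> v" using division_ofD(3)[OF assms] by auto
  then show thesis using that[of u v] K division_ofD(2)[OF assms] by simp
qed

text \<open>Comparison criterion behind the closure properties below. Two dominating functions are
  allowed so that sums and pastings are covered; if one is enough, it is listed twice.\<close>

lemma ACI_norm_le:
  fixes x :: "real \<Rightarrow> 'a::euclidean_space" and x1 :: "real \<Rightarrow> 'b::euclidean_space" and x2 :: "real \<Rightarrow> 'c::euclidean_space"
  assumes x1: "x1 \<in> AC a b" and x2: "x2 \<in> AC a b" and C: "C > 0"
    and le: "\<And>u v. a \<le> u \<Longrightarrow> u \<le> v \<Longrightarrow> v \<le> b \<Longrightarrow> norm (x v - x u) \<le> C * (norm (x1 v - x1 u) + norm (x2 v - x2 u))"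
  shows "x \<in> AC a b"
  unfolding AC_def
proof (intro CollectI allI impI)
  fix e :: real assume e: "0 < e"
  then have e2: "0 < e / (2 * C)" using C by simp
  obtain \<delta>1 where \<delta>1: "\<delta>1 > 0" "\<And>D. D division_of \<Union>D \<Longrightarrow> \<Union>D \<subseteq> {a..b} \<Longrightarrow>
        (\<Sum>K\<in>D. Sup K - Inf K) < \<delta>1 \<Longrightarrow> (\<Sum>K\<in>D. norm (x1 (Sup K) - x1 (Inf K))) < e / (2 * C)"
    using x1 e2 unfolding AC_def by blast
  obtain \<delta>2 where \<delta>2: "\<delta>2 > 0" "\<And>D. D division_of \<Union>D \<Longrightarrow> \<Union>D \<subseteq> {a..b} \<Longrightarrow>
        (\<Sum>K\<in>D. Sup K - Inf K) < \<delta>2 \<Longrightarrow> (\<Sum>K\<in>D. norm (x2 (Sup K) - x2 (Inf K))) < e / (2 * C)"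
    using x2 e2 unfolding AC_def by blast
  show "\<exists>\<delta>>0. \<forall>D. D division_of \<Union>D \<and> \<Union>D \<subseteq> {a..b} \<and> (\<Sum>K\<in>D. Sup K - Inf K) < \<delta> \<longrightarrow>
       (\<Sum>K\<in>D. norm (x (Sup K) - x (Inf K))) < e"
  proof (intro exI[of _ "min \<delta>1 \<delta>2"] conjI allI impI)
    fix D assume D: "D division_of \<Union>D \<and> \<Union>D \<subseteq> {a..b} \<and> (\<Sum>K\<in>D. Sup K - Inf K) < min \<delta>1 \<delta>2"
    then have div: "D division_of \<Union>D" by blast
    have "(\<Sum>K\<in>D. norm (x (Sup K) - x (Inf K))) \<le>
       (\<Sum>K\<in>D. C * (norm (x1 (Sup K) - x1 (Inf K)) + norm (x2 (Sup K) - x2 (Inf K))))"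
    proof (rule sum_mono)
      fix K assume "K \<in> D"
      then obtain u v where K: "K = {u..v}" "u \<le> v" "Sup K = v" "Inf K = u" "{u..v} \<subseteq> \<Union>D"
        by (rule division_real_interval[OF div])
      then have "{u..v} \<subseteq> {a..b}" using D by blast
      then show "norm (x (Sup K) - x (Inf K)) \<le> C * (norm (x1 (Sup K) - x1 (Inf K)) + norm (x2 (Sup K) - x2 (Inf K)))"
        using le[of u v] K(2-4) by simp
    qed
    also have "\<dots> = C * ((\<Sum>K\<in>D. norm (x1 (Sup K) - x1 (Inf K))) + (\<Sum>K\<in>D. norm (x2 (Sup K) - x2 (Inf K))))"
      by (simp add: sum_distrib_left sum.distrib distrib_left)
    also have "\<dots> < C * (e / (2 * C) + e / (2 * C))"
      using \<delta>1(2)[of D] \<delta>2(2)[of D] D C by (intro mult_strict_left_mono add_strict_mono) auto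
    also have "\<dots> = e" using C by (simp add: field_simps)
    finally show "(\<Sum>K\<in>D. norm (x (Sup K) - x (Inf K))) < e" .
  qed (use \<delta>1 \<delta>2 in auto)
qed

lemma AC_id: "(\<lambda>t. t) \<in> AC a b"
  unfolding AC_def
proof (intro CollectI allI impI)
  fix e :: real assume e: "0 < e"
  have "(\<Sum>K\<in>D. norm (Sup K - Inf K)) < e" if D: "D division_of \<Union>D \<and> \<Union>D \<subseteq> {a..b} \<and> (\<Sum>K\<in>D. Sup K - Inf K) < e" for D
  proof -
    have "(\<Sum>K\<in>D. norm (Sup K - Inf K)) = (\<Sum>K\<in>D. Sup K - Inf K)"
    proof (rule sum.cong[OF refl])
      fix K assume "K \<in> D"
      then obtain u v where "u \<le> v" "Sup K = v" "Inf K = u"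
        using D division_real_interval by metis
      then show "norm (Sup K - Inf K) = Sup K - Inf K" by simp
    qed
    then show ?thesis using D by simp
  qed
  then show "\<exists>\<delta>>0. \<forall>D. D division_of \<Union>D \<and> \<Union>D \<subseteq> {a..b} \<and> (\<Sum>K\<in>D. Sup K - Inf K) < \<delta> \<longrightarrow>
       (\<Sum>K\<in>D. norm (Sup K - Inf K)) < e" using e by blast
qed

lemma AC_const: "(\<lambda>t. c) \<in> AC a b"
  by (rule ACI_norm_le[OF AC_id AC_id, of 1]) auto

lemma AC_add: "x \<in> AC a b \<Longrightarrow> z \<in> AC a b \<Longrightarrow> (\<lambda>t. x t + z t) \<in> AC a b"
  by (rule ACI_norm_le[of x a b z 1]) (auto simp: norm_triangle_ineq add_diff_add)

lemma AC_scaleR: "x \<in> AC a b \<Longrightarrow> (\<lambda>t. c *\<^sub>R x t) \<in> AC a b"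
proof (rule ACI_norm_le[of x a b x "\<bar>c\<bar> + 1"])
  fix u v
  have "norm (c *\<^sub>R x v - c *\<^sub>R x u) = \<bar>c\<bar> * norm (x v - x u)" by (simp flip: scaleR_diff_right)
  also have "\<dots> \<le> (\<bar>c\<bar> + 1) * (norm (x v - x u) + norm (x v - x u))" by (intro mult_mono) auto
  finally show "norm (c *\<^sub>R x v - c *\<^sub>R x u) \<le> (\<bar>c\<bar> + 1) * (norm (x v - x u) + norm (x v - x u))" .
qed auto

lemma AC_continuous_on:
  assumes "x \<in> AC a b"
  shows "continuous_on {a..b} x"
  unfolding continuous_on_iff
proof (intro ballI allI impI)
  fix t e :: real assume t: "t \<in> {a..b}" and e: "0 < e"
  obtain \<delta> where \<delta>: "\<delta> > 0" "\<And>D. D division_of \<Union>D \<and> \<Union>D \<subseteq> {a..b} \<and>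
        (\<Sum>K\<in>D. Sup K - Inf K) < \<delta> \<Longrightarrow> (\<Sum>K\<in>D. norm (x (Sup K) - x (Inf K))) < e"
    using assms e unfolding AC_def by blast
  have *: "dist (x v) (x u) < e" if "u \<in> {a..b}" "v \<in> {a..b}" "u \<le> v" "v - u < \<delta>" for u v
  proof -
    have "{{u..v}} division_of \<Union>{{u..v}}" using that(3) division_of_self[of u v] by (simp add: box_real)
    then have "(\<Sum>K\<in>{{u..v}}. norm (x (Sup K) - x (Inf K))) < e"
      using that by (intro \<delta>(2)) auto
    then show ?thesis using that by (simp add: dist_norm)
  qed
  have "dist (x s) (x t) < e" if "s \<in> {a..b}" "dist s t < \<delta>" for s
    using *[of s t] *[of t s] that t by (cases "s \<le> t") (auto simp: dist_real_def dist_commute)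
  then show "\<exists>d>0. \<forall>s\<in>{a..b}. dist s t < d \<longrightarrow> dist (x s) (x t) < e" using \<delta>(1) by blast
qed

text \<open>A nondecreasing map that does not increase lengths sends non-overlapping intervals to
  non-overlapping intervals of no larger total length, so the \<delta> of \<open>x\<close> can be
  reused. The maps of interest are \<open>min t s\<close> and \<open>max t s\<close>.\<close>

lemma AC_compose_mono:
  assumes x: "x \<in> AC c d" and m: "\<And>u v. a \<le> u \<Longrightarrow> u \<le> v \<Longrightarrow> v \<le> b \<Longrightarrow> \<phi> u \<le> \<phi> v \<and> \<phi> v - \<phi> u \<le> v - u"
    and r: "\<And>u. u \<in> {a..b} \<Longrightarrow> \<phi> u \<in> {c..d}"
  shows "(\<lambda>t. x (\<phi> t)) \<in> AC a b"
  unfolding AC_def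
proof (intro CollectI allI impI)
  fix e :: real assume e: "0 < e"
  obtain \<delta> where \<delta>: "\<delta> > 0" "\<And>D. D division_of \<Union>D \<Longrightarrow> \<Union>D \<subseteq> {c..d} \<Longrightarrow>
        (\<Sum>K\<in>D. Sup K - Inf K) < \<delta> \<Longrightarrow> (\<Sum>K\<in>D. norm (x (Sup K) - x (Inf K))) < e"
    using x e unfolding AC_def by blast
  show "\<exists>\<delta>>0. \<forall>D. D division_of \<Union>D \<and> \<Union>D \<subseteq> {a..b} \<and> (\<Sum>K\<in>D. Sup K - Inf K) < \<delta> \<longrightarrow>
       (\<Sum>K\<in>D. norm (x (\<phi> (Sup K)) - x (\<phi> (Inf K)))) < e"
  proof (intro exI[of _ \<delta>] conjI allI impI)
    fix D assume D: "D division_of \<Union>D \<and> \<Union>D \<subseteq> {a..b} \<and> (\<Sum>K\<in>D. Sup K - Inf K) < \<delta>"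
    then have div: "D division_of \<Union>D" and fin: "finite D" by blast+
    have int: "\<exists>u v. K = {u..v} \<and> u \<le> v \<and> Sup K = v \<and> Inf K = u \<and> a \<le> u \<and> v \<le> b" if KD: "K \<in> D" for K
    proof -
      obtain u v where K: "K = {u..v}" "u \<le> v" "Sup K = v" "Inf K = u" "{u..v} \<subseteq> \<Union>D"
        using division_real_interval[OF div KD] .
      then have "{u..v} \<subseteq> {a..b}" using D by blast
      then show ?thesis using K by auto
    qed
    \<comment> \<open>Several intervals may collapse to the same point, which would spoil
      injectivity of the image map. They are left out; the increments over them vanish
      anyway.\<close>
    define D1 where "D1 = {K \<in> D. \<phi> (Inf K) < \<phi> (Sup K)}"
    define \<Phi> where "\<Phi> K = {\<phi> (Inf K)..\<phi> (Sup K)}" for K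
    have disj: "interior (\<Phi> K1) \<inter> interior (\<Phi> K2) = {}" if K12: "K1 \<in> D1" "K2 \<in> D1" "K1 \<noteq> K2" for K1 K2
    proof -
      obtain u1 v1 where 1: "K1 = {u1..v1}" "u1 \<le> v1" "Sup K1 = v1" "Inf K1 = u1" "a \<le> u1" "v1 \<le> b"
        using int[of K1] K12(1) by (auto simp: D1_def)
      obtain u2 v2 where 2: "K2 = {u2..v2}" "u2 \<le> v2" "Sup K2 = v2" "Inf K2 = u2" "a \<le> u2" "v2 \<le> b"
        using int[of K2] K12(2) by (auto simp: D1_def)
      have ne: "u1 < v1" "u2 < v2" using that(1,2) 1 2 by (auto simp: D1_def order_less_le)
      have "interior K1 \<inter> interior K2 = {}" using division_ofD(5)[OF div, of K1 K2] that by (auto simp: D1_def)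
      then have "{u1<..<v1} \<inter> {u2<..<v2} = {}" using 1 2 by simp
      then have "v1 \<le> u2 \<or> v2 \<le> u1"
      proof (rule contrapos_pp)
        assume "\<not> (v1 \<le> u2 \<or> v2 \<le> u1)"
        then have "(max u1 u2 + min v1 v2) / 2 \<in> {u1<..<v1} \<inter> {u2<..<v2}" using ne by (auto simp: max_def min_def)
        then show "{u1<..<v1} \<inter> {u2<..<v2} \<noteq> {}" by blast
      qed
      then have "\<phi> v1 \<le> \<phi> u2 \<or> \<phi> v2 \<le> \<phi> u1" using m[of v1 u2] m[of v2 u1] 1 2 by auto
      then show ?thesis using 1 2 by (auto simp: \<Phi>_def)
    qed
    have inj: "inj_on \<Phi> D1"
    proof (rule inj_onI, rule ccontr)
      fix K1 K2 assume A: "K1 \<in> D1" "K2 \<in> D1" "\<Phi> K1 = \<Phi> K2" "K1 \<noteq> K2"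
      then have "interior (\<Phi> K1) = {}" using disj[of K1 K2] by auto
      then show False using A(1) by (auto simp: \<Phi>_def D1_def)
    qed
    have SI: "Sup (\<Phi> K) = \<phi> (Sup K)" "Inf (\<Phi> K) = \<phi> (Inf K)" if "K \<in> D1" for K
      using that by (auto simp: \<Phi>_def D1_def)
    have "\<Phi> ` D1 division_of \<Union>(\<Phi> ` D1)"
    proof (rule division_ofI)
      show "finite (\<Phi> ` D1)" using fin by (auto simp: D1_def)
      fix K assume "K \<in> \<Phi> ` D1"
      then obtain K1 where K1: "K1 \<in> D1" "K = \<Phi> K1" by auto
      show "K \<noteq> {}" using K1 by (auto simp: \<Phi>_def D1_def)
      show "\<exists>a b. K = cbox a b" using K1 unfolding \<Phi>_def by (metis box_real(2))
      fix K' assume "K' \<in> \<Phi> ` D1" "K \<noteq> K'"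
      then obtain K2 where "K2 \<in> D1" "K' = \<Phi> K2" by auto
      then show "interior K \<inter> interior K' = {}" using disj[of K1 K2] K1 \<open>K \<noteq> K'\<close> by auto
    qed auto
    moreover have "\<Union>(\<Phi> ` D1) \<subseteq> {c..d}"
    proof (rule Union_least, clarify)
      fix K t assume K: "K \<in> D1" "t \<in> \<Phi> K"
      then obtain u v where "K = {u..v}" "u \<le> v" "Sup K = v" "Inf K = u" "a \<le> u" "v \<le> b" using int[of K] by (auto simp: D1_def)
      then show "t \<in> {c..d}" using K(2) r[of u] r[of v] by (auto simp: \<Phi>_def)
    qed
    moreover have "(\<Sum>K\<in>\<Phi> ` D1. Sup K - Inf K) < \<delta>"
    proof -
      have "(\<Sum>K\<in>\<Phi> ` D1. Sup K - Inf K) = (\<Sum>K\<in>D1. \<phi> (Sup K) - \<phi> (Inf K))"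
        by (subst sum.reindex[OF inj]) (auto intro!: sum.cong simp: SI)
      also have "\<dots> \<le> (\<Sum>K\<in>D1. Sup K - Inf K)"
      proof (rule sum_mono)
        fix K assume "K \<in> D1"
        then obtain u v where "Sup K = v" "Inf K = u" "a \<le> u" "v \<le> b" "u \<le> v" using int[of K] by (auto simp: D1_def)
        then show "\<phi> (Sup K) - \<phi> (Inf K) \<le> Sup K - Inf K" using m[of u v] by auto
      qed
      also have "\<dots> \<le> (\<Sum>K\<in>D. Sup K - Inf K)"
        using fin by (intro sum_mono2) (auto simp: D1_def dest!: int)
      finally show ?thesis using D by simp
    qed
    ultimately have "(\<Sum>K\<in>\<Phi> ` D1. norm (x (Sup K) - x (Inf K))) < e" by (rule \<delta>(2))
    moreover have "(\<Sum>K\<in>\<Phi> ` D1. norm (x (Sup K) - x (Inf K))) = (\<Sum>K\<in>D1. norm (x (\<phi> (Sup K)) - x (\<phi> (Inf K))))"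
      by (subst sum.reindex[OF inj]) (auto intro!: sum.cong simp: SI)
    moreover have "\<dots> = (\<Sum>K\<in>D. norm (x (\<phi> (Sup K)) - x (\<phi> (Inf K))))"
    proof (rule sum.mono_neutral_left[OF fin])
      show "\<forall>K\<in>D - D1. norm (x (\<phi> (Sup K)) - x (\<phi> (Inf K))) = 0"
      proof
        fix K assume K: "K \<in> D - D1"
        then obtain u v where "Sup K = v" "Inf K = u" "a \<le> u" "v \<le> b" "u \<le> v" using int[of K] by auto
        then have "\<phi> (Sup K) = \<phi> (Inf K)" using m[of u v] K by (auto simp: D1_def)
        then show "norm (x (\<phi> (Sup K)) - x (\<phi> (Inf K))) = 0" by simp
      qed
    qed (auto simp: D1_def)
    ultimately show "(\<Sum>K\<in>D. norm (x (\<phi> (Sup K)) - x (\<phi> (Inf K)))) < e" by simp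
  qed (rule \<delta>(1))
qed

text \<open>Up to the constant \<open>z s\<close>, the pasted function is the sum of
  \<open>x\<close> stopped at \<open>s\<close> and \<open>z\<close> started at \<open>s\<close>, so
  its increments split into one of each.\<close>

lemma AC_paste:
  fixes x z :: "real \<Rightarrow> 'a::euclidean_space"
  assumes x: "x \<in> AC a s" and z: "z \<in> AC s b" and s: "a \<le> s" "s \<le> b" and eq: "x s = z s"
  shows "(\<lambda>t. if t \<le> s then x t else z t) \<in> AC a b"
proof (rule ACI_norm_le[where C = 1])
  show "(\<lambda>t. x (min t s)) \<in> AC a b" by (rule AC_compose_mono[OF x]) (use s in auto)
  show "(\<lambda>t. z (max t s)) \<in> AC a b" by (rule AC_compose_mono[OF z]) (use s in auto)
  fix u v assume uv: "a \<le> u" "u \<le> v" "v \<le> b"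
  have e: "(if t \<le> s then x t else z t) = x (min t s) + z (max t s) - z s" for t
    using eq by (auto simp: min_def max_def)
  have "(if v \<le> s then x v else z v) - (if u \<le> s then x u else z u) =
    (x (min v s) - x (min u s)) + (z (max v s) - z (max u s))" unfolding e by simp
  then show "norm ((if v \<le> s then x v else z v) - (if u \<le> s then x u else z u))
       \<le> 1 * (norm (x (min v s) - x (min u s)) + norm (z (max v s) - z (max u s)))"
    by (simp add: norm_triangle_ineq)
qed simp

text \<open>Truncation at a level \<open>m\<close>: the excess \<rho> of \<open>norm h\<close> over
  \<open>m\<close> has integral below \<open>e / 2\<close>, by dominated convergence, and the
  bounded rest contributes at most \<open>m\<close> times the total length.\<close>

lemma AC_integral:
  fixes h :: "real \<Rightarrow> 'a::euclidean_space"
  assumes h: "integrable (lebesgue_on {a..b}) h"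
  shows "(\<lambda>t. integral {a..t} h) \<in> AC a b"
  unfolding AC_def
proof (intro CollectI allI impI)
  fix e :: real assume e: "0 < e"
  define \<rho> where "\<rho> m t = norm (h t) - min (norm (h t)) (real m)" for m t
  have nh: "integrable (lebesgue_on {a..b}) (\<lambda>t. norm (h t))" using h by simp
  have mh: "h \<in> borel_measurable (lebesgue_on {a..b})" using h by simp
  have \<rho>i: "integrable (lebesgue_on {a..b}) (\<rho> m)" for m
    unfolding \<rho>_def using mh by (intro integrable_bounded_AE[OF _ nh]) auto
  have "(\<lambda>m. LINT t|lebesgue_on {a..b}. \<rho> m t) \<longlonglongrightarrow> (LINT t|lebesgue_on {a..b}. 0)"
  proof (rule integral_dominated_convergence[OF _ _ nh])
    show "AE t in lebesgue_on {a..b}. (\<lambda>m. \<rho> m t) \<longlonglongrightarrow> 0"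
    proof (rule AE_I2)
      fix t
      obtain N :: nat where N: "norm (h t) \<le> real N" using real_arch_simple by blast
      show "(\<lambda>m. \<rho> m t) \<longlonglongrightarrow> 0"
        by (rule tendsto_eventually) (use N in \<open>auto simp: \<rho>_def eventually_sequentially min_def intro!: exI[of _ N]\<close>)
    qed
    show "\<rho> m \<in> borel_measurable (lebesgue_on {a..b})" for m using \<rho>i[of m] by simp
  qed (auto simp: \<rho>_def)
  then obtain m where m: "(LINT t|lebesgue_on {a..b}. \<rho> m t) < e / 2"
    using order_tendstoD(2)[of _ 0 sequentially "e/2"] e by (auto simp: eventually_sequentially)
  then have m': "integral {a..b} (\<rho> m) < e / 2" using integral_lebesgue_on_interval(3)[OF \<rho>i] by simp
  have \<rho>0: "\<rho> m t \<ge> 0" for t by (simp add: \<rho>_def)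
  show "\<exists>\<delta>>0. \<forall>D. D division_of \<Union>D \<and> \<Union>D \<subseteq> {a..b} \<and> (\<Sum>K\<in>D. Sup K - Inf K) < \<delta> \<longrightarrow>
       (\<Sum>K\<in>D. norm (integral {a..Sup K} h - integral {a..Inf K} h)) < e"
  \<comment> \<open>This \<delta> makes the bounded part at most \<open>e / 2\<close>;
    \<open>m + 1\<close> replaces \<open>m\<close> because \<open>m\<close> may be 0.\<close>
  proof (intro exI[of _ "e / (2 * (real m + 1))"] conjI allI impI)
    show "0 < e / (2 * (real m + 1))" using e by (simp add: add_nonneg_pos)
    fix D assume D: "D division_of \<Union>D \<and> \<Union>D \<subseteq> {a..b} \<and> (\<Sum>K\<in>D. Sup K - Inf K) < e / (2 * (real m + 1))"
    then have div: "D division_of \<Union>D" and sub: "\<Union>D \<subseteq> {a..b}" by blast+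
    have \<rho>on: "\<rho> m integrable_on {a..b}" using integral_lebesgue_on_interval(2)[OF \<rho>i] by simp
    have \<rho>onD: "\<rho> m integrable_on \<Union>D" using integrable_on_subdivision[OF div \<rho>on sub] .
    have "(\<Sum>K\<in>D. norm (integral {a..Sup K} h - integral {a..Inf K} h)) \<le> (\<Sum>K\<in>D. real m * (Sup K - Inf K) + integral K (\<rho> m))"
    proof (rule sum_mono)
      fix K assume "K \<in> D"
      then obtain u v where K: "K = {u..v}" "u \<le> v" "Sup K = v" "Inf K = u" "{u..v} \<subseteq> \<Union>D"
        by (rule division_real_interval[OF div])
      then have "{u..v} \<subseteq> {a..b}" using sub by blast
      then have uv: "a \<le> u" "v \<le> b" using K(2) by auto
      have "integral {a..v} h - integral {a..u} h = integral {u..v} h"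
        using integral_interval_combine[OF h uv(1) K(2) uv(2), symmetric] by simp
      moreover have "norm (integral {u..v} h) \<le> integral {u..v} (\<lambda>t. real m + \<rho> m t)"
      proof (rule norm_integral_interval_le_AE[OF h _ uv])
        show "integrable (lebesgue_on {a..b}) (\<lambda>t. real m + \<rho> m t)" using \<rho>i by simp
        show "AE t in lebesgue_on {a..b}. norm (h t) \<le> real m + \<rho> m t" by (simp add: \<rho>_def)
      qed
      moreover have "integral {u..v} (\<lambda>t. real m + \<rho> m t) = real m * (v - u) + integral {u..v} (\<rho> m)"
        using integral_lebesgue_on_interval(2)[OF \<rho>i uv] K(2) by (subst integral_add) (auto simp: mult.commute)
      ultimately show "norm (integral {a..Sup K} h - integral {a..Inf K} h) \<le> real m * (Sup K - Inf K) + integral K (\<rho> m)"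
        using K by simp
    qed
    also have "\<dots> = real m * (\<Sum>K\<in>D. Sup K - Inf K) + integral (\<Union>D) (\<rho> m)"
      using integral_combine_division_topdown[OF \<rho>onD div] by (simp add: sum.distrib sum_distrib_left)
    also have "\<dots> \<le> real m * (e / (2 * (real m + 1))) + integral {a..b} (\<rho> m)"
      using D \<rho>on \<rho>onD \<rho>0 sub by (intro add_mono mult_left_mono integral_subset_le) auto
    also have "\<dots> < e"
    proof -
      have "real m * (e / (2 * (real m + 1))) \<le> e / 2" using e by (simp add: field_simps)
      then show ?thesis using m' by linarith
    qed
    finally show "(\<Sum>K\<in>D. norm (integral {a..Sup K} h - integral {a..Inf K} h)) < e" .
  qed
qed

section \<open>Gronwall's lemma and Caratheodory equations\<close>

text \<open>In the norm weighted by this exponential, the Volterra operator with kernel \<open>l\<close> has norm at most 1/2.\<close>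

lemma integral_exp_weight:
  fixes l :: "real \<Rightarrow> real"
  assumes l: "integrable (lebesgue_on {a..b}) l" and nn: "\<And>t. 0 \<le> l t" and t: "t \<in> {a..b}"
  shows "((\<lambda>s. l s * exp (2 * integral {a..s} l)) has_integral (exp (2 * integral {a..t} l) - 1) / 2) {a..t}"
proof -
  define L where "L t = integral {a..t} l" for t
  define y where "y t = exp (2 * L t) / 2" for t
  have mono: "L u \<le> L v" if "a \<le> u" "u \<le> v" "v \<le> b" for u v
    using integral_interval_combine[OF l that] integral_nonneg[OF integral_lebesgue_on_interval(2)[OF l, of u v]] nn that
    by (simp add: L_def)
  \<comment> \<open>The chain rule holds only almost everywhere, so the integral formula needs
    absolute continuity of \<open>y\<close>. It is inherited from \<open>L\<close> through e^B - e^A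
    \<le> e^B (B - A) and the monotonicity of \<open>L\<close>.\<close>
  have "y \<in> AC a b"
  proof (rule ACI_norm_le[of L a b L "exp (2 * L b)"])
    show "L \<in> AC a b" "L \<in> AC a b" unfolding L_def by (rule AC_integral[OF l])+
    fix u v assume uv: "a \<le> u" "u \<le> v" "v \<le> b"
    have "exp (2 * L v) - exp (2 * L u) \<le> 2 * exp (2 * L v) * (L v - L u)"
    proof -
      have "1 + (2 * L u - 2 * L v) \<le> exp (2 * L u - 2 * L v)" by (rule exp_ge_add_one_self)
      then have "exp (2 * L v) * (1 + (2 * L u - 2 * L v)) \<le> exp (2 * L v) * exp (2 * L u - 2 * L v)" by simp
      also have "\<dots> = exp (2 * L u)" by (simp flip: exp_add)
      finally show ?thesis by (simp add: algebra_simps)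
    qed
    also have "\<dots> \<le> 2 * exp (2 * L b) * (L v - L u)"
      using mono[OF uv] mono[of v b] uv by (intro mult_right_mono) auto
    finally have "y v - y u \<le> exp (2 * L b) * (L v - L u)" by (simp add: y_def)
    moreover have "y u \<le> y v" using mono[OF uv] by (simp add: y_def)
    moreover have "0 \<le> exp (2 * L b) * (L v - L u)" using mono[OF uv] by simp
    ultimately show "norm (y v - y u) \<le> exp (2 * L b) * (norm (L v - L u) + norm (L v - L u))"
      using mono[OF uv] by (simp add: algebra_simps)
  qed simp
  moreover have "AE s in lebesgue_on {a..b}. (y has_vector_derivative l s * exp (2 * L s)) (at s within {a..b})"
    using has_vector_derivative_integral_AE[OF integral_lebesgue_on_interval(2)[OF l order_refl order_refl]]
  proof eventually_elim
    case (elim s)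
    then have "(L has_real_derivative l s) (at s within {a..b})"
      unfolding L_def has_real_derivative_iff_has_vector_derivative .
    then have "(y has_real_derivative l s * exp (2 * L s)) (at s within {a..b})"
      unfolding y_def by (auto intro!: derivative_eq_intros)
    then show ?case by (simp add: has_real_derivative_iff_has_vector_derivative)
  qed
  ultimately have "((\<lambda>s. l s * exp (2 * L s)) has_integral (y t - y a)) {a..t}"
    using t by (intro AC_has_integral[of y a b]) auto
  moreover have "y t - y a = (exp (2 * L t) - 1) / 2" by (simp add: y_def L_def diff_divide_distrib)
  ultimately show ?thesis by (simp add: L_def)
qed

lemma integrable_mult_continuous:
  fixes l k :: "real \<Rightarrow> real"
  assumes l: "integrable (lebesgue_on {a..b}) l" and k: "continuous_on {a..b} k"
  shows "integrable (lebesgue_on {a..b}) (\<lambda>s. l s * k s)"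
proof -
  obtain B where B: "\<forall>t\<in>{a..b}. norm (k t) \<le> B"
    using compact_imp_bounded[OF compact_continuous_image[OF k]] by (auto simp: bounded_iff)
  have km: "k \<in> borel_measurable (lebesgue_on {a..b})" using k by (intro continuous_imp_measurable_on_sets_lebesgue) auto
  show ?thesis
  proof (rule integrable_bounded_AE[where k = "\<lambda>t. \<bar>l t\<bar> * B"])
    show "AE t in lebesgue_on {a..b}. norm (l t * k t) \<le> \<bar>l t\<bar> * B"
    proof (rule AE_I2)
      fix t assume "t \<in> space (lebesgue_on {a..b})"
      then have "\<bar>l t\<bar> * \<bar>k t\<bar> \<le> \<bar>l t\<bar> * B" using B by (intro mult_left_mono) auto
      then show "norm (l t * k t) \<le> \<bar>l t\<bar> * B" by (simp add: abs_mult)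
    qed
    show "integrable (lebesgue_on {a..b}) (\<lambda>t. \<bar>l t\<bar> * B)" using l by simp
    show "(\<lambda>t. l t * k t) \<in> borel_measurable (lebesgue_on {a..b})" using l km by simp
  qed
qed

text \<open>Let \<open>N\<close> be the maximum of \<phi>/w for the weight w = exp(2L). Inserting
  \<phi> \<le> N w under the integral reproduces at most N (w - 1)/2, and reading the inequality at
  a maximizing point absorbs this half and bounds \<open>N\<close> by \<open>2 * C\<close>. The
  constant is not sharp, but \<phi> need not be differentiated.\<close>

lemma Gronwall_integral:
  fixes \<phi> l :: "real \<Rightarrow> real"
  assumes l: "integrable (lebesgue_on {a..b}) l" and nn: "\<And>t. 0 \<le> l t"
    and c: "continuous_on {a..b} \<phi>" and C: "0 \<le> C"
    and le: "\<And>t. t \<in> {a..b} \<Longrightarrow> \<phi> t \<le> C + integral {a..t} (\<lambda>s. l s * \<phi> s)"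
    and t: "t \<in> {a..b}"
  shows "\<phi> t \<le> 2 * C * exp (2 * integral {a..b} l)"
proof -
  define L where "L t = integral {a..t} l" for t
  define w where "w t = exp (2 * L t)" for t
  have mono: "L u \<le> L v" if "a \<le> u" "u \<le> v" "v \<le> b" for u v
    using integral_interval_combine[OF l that] integral_nonneg[OF integral_lebesgue_on_interval(2)[OF l, of u v]] nn that
    by (simp add: L_def)
  have wpos: "w t > 0" for t by (simp add: w_def)
  have cont: "continuous_on {a..b} w" unfolding w_def L_def
    by (intro continuous_intros continuous_on_integral_interval l)
  obtain s where s: "s \<in> {a..b}" "\<And>t. t \<in> {a..b} \<Longrightarrow> \<phi> t / w t \<le> \<phi> s / w s"
    using continuous_attains_sup[of "{a..b}" "\<lambda>t. \<phi> t / w t"] t c cont wpos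
    by (force intro!: continuous_intros simp: less_imp_neq[symmetric])
  \<comment> \<open>The maximum with 0 gives \<open>N\<close> a sign, so that inequalities can be
    multiplied by it even if \<phi> is negative throughout.\<close>
  define N where "N = max 0 (\<phi> s / w s)"
  have N: "\<phi> t \<le> N * w t" if "t \<in> {a..b}" for t
  proof -
    have "\<phi> t / w t \<le> N" using s(2)[OF that] by (simp add: N_def)
    then show ?thesis using wpos[of t] by (simp add: field_simps)
  qed
  note il = integrable_mult_continuous[OF l]
  have bd: "\<phi> r \<le> C + N * (w r - 1) / 2" if r: "r \<in> {a..b}" for r
  proof -
    have "integral {a..r} (\<lambda>s. l s * \<phi> s) \<le> integral {a..r} (\<lambda>s. N * (l s * w s))"
    proof (rule integral_interval_mono_AE[OF il[OF c] _ order_refl])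
      show "integrable (lebesgue_on {a..b}) (\<lambda>s. N * (l s * w s))" using il[OF cont] by simp
      show "AE s in lebesgue_on {a..b}. l s * \<phi> s \<le> N * (l s * w s)"
      proof (rule AE_I2)
        fix s assume "s \<in> space (lebesgue_on {a..b})"
        then have "l s * \<phi> s \<le> l s * (N * w s)" using N nn by (intro mult_left_mono) auto
        then show "l s * \<phi> s \<le> N * (l s * w s)" by (simp add: mult.left_commute)
      qed
    qed (use r in auto)
    also have "\<dots> = N * ((w r - 1) / 2)"
      using integral_exp_weight[OF l nn r] by (intro integral_unique has_integral_mult_right) (simp add: w_def L_def)
    finally show ?thesis using le[OF r] by simp
  qed
  have "N \<le> 2 * C"
  proof (cases "N = 0")
    case False
    then have "\<phi> s = N * w s" using wpos[of s] by (auto simp: N_def max_def split: if_splits)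
    then have "N * w s \<le> C + N * (w s - 1) / 2" using bd[OF s(1)] by simp
    then have "N * w s \<le> 2 * C - N" by (simp add: field_simps)
    moreover have "1 \<le> w s" using mono[of a s] s(1) by (simp add: w_def L_def)
    moreover have "0 \<le> N" by (simp add: N_def)
    ultimately show ?thesis by (smt (verit) mult_left_mono mult_cancel_left1)
  qed (use C in simp)
  then have "N * w t \<le> 2 * C * exp (2 * L b)"
    using mono[of t b] t C wpos[of t] by (intro mult_mono) (auto simp: w_def)
  then show ?thesis using N[OF t] by (simp add: L_def)
qed

text \<open>Picard iteration in the weighted norm: successive differences shrink by 1/2, so the
  iterates converge uniformly on the whole interval by the Weierstrass test, without any subdivision
  in time. The integrable bound \<open>m\<close> controls the first difference and makes every
  superposition integrable.\<close>

theorem Caratheodory_Picard: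
  fixes G :: "real \<Rightarrow> 'a::euclidean_space \<Rightarrow> 'a"
  assumes ab: "a \<le> b" and l: "integrable (lebesgue_on {a..b}) l" and nn: "\<And>t. 0 \<le> l t"
    and m: "integrable (lebesgue_on {a..b}) m"
    and Lip: "AE t in lebesgue_on {a..b}. \<forall>z w. norm (G t z - G t w) \<le> l t * norm (z - w)"
    and bd: "AE t in lebesgue_on {a..b}. \<forall>z. norm (G t z) \<le> m t"
    and meas: "\<And>z. continuous_on {a..b} z \<Longrightarrow> (\<lambda>t. G t (z t)) \<in> borel_measurable (lebesgue_on {a..b})"
  obtains z where "continuous_on {a..b} z" "integrable (lebesgue_on {a..b}) (\<lambda>t. G t (z t))"
    "\<And>t. t \<in> {a..b} \<Longrightarrow> z t = \<xi> + integral {a..t} (\<lambda>s. G s (z s))"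
proof -
  define T where "T z t = \<xi> + integral {a..t} (\<lambda>s. G s (z s))" for z t
  define w where "w t = exp (2 * integral {a..t} l)" for t
  have Gi: "integrable (lebesgue_on {a..b}) (\<lambda>t. G t (z t))" if "continuous_on {a..b} z" for z
    by (rule integrable_bounded_AE[OF meas[OF that] m]) (use bd in eventually_elim, auto)
  have Tc: "continuous_on {a..b} (T z)" if "continuous_on {a..b} z" for z
    unfolding T_def by (intro continuous_intros continuous_on_integral_interval Gi that)
  note il = integrable_mult_continuous[OF l]
  have wc: "continuous_on {a..b} w" unfolding w_def by (intro continuous_intros continuous_on_integral_interval l)
  have Tdiff: "norm (T z t - T y t) \<le> integral {a..t} (\<lambda>s. l s * k s)"
    if z: "continuous_on {a..b} z" and y: "continuous_on {a..b} y" and k: "continuous_on {a..b} k" and t: "t \<in> {a..b}"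
      and zk: "\<And>s. s \<in> {a..b} \<Longrightarrow> norm (z s - y s) \<le> k s" for z y t and k :: "real \<Rightarrow> real"
  proof -
    have "T z t - T y t = integral {a..t} (\<lambda>s. G s (z s) - G s (y s))"
      unfolding T_def using integral_lebesgue_on_interval(2)[OF Gi[OF z], of a t] integral_lebesgue_on_interval(2)[OF Gi[OF y], of a t] t
      by (simp add: Henstock_Kurzweil_Integration.integral_diff)
    also have "norm \<dots> \<le> integral {a..t} (\<lambda>s. l s * k s)"
    proof (rule norm_integral_interval_le_AE)
      show "AE s in lebesgue_on {a..b}. norm (G s (z s) - G s (y s)) \<le> l s * k s"
        using Lip AE_space
      proof eventually_elim
        case (elim s)
        then have "norm (G s (z s) - G s (y s)) \<le> l s * norm (z s - y s)" by blast
        also have "\<dots> \<le> l s * k s" using zk[of s] elim(2) nn[of s] by (intro mult_left_mono) auto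
        finally show ?case .
      qed
    qed (use Gi z y il k t in auto)
    finally show ?thesis .
  qed
  define B where "B = integral {a..b} m"
  define zs where "zs n = (T ^^ n) (\<lambda>_. \<xi>)" for n
  have zs_Suc: "zs (Suc n) = T (zs n)" for n by (simp add: zs_def)
  have zc: "continuous_on {a..b} (zs n)" for n
  proof (induction n)
    case 0
    show ?case by (simp add: zs_def)
  next
    case (Suc n)
    then show ?case by (simp add: zs_Suc Tc)
  qed
  have m0: "AE t in lebesgue_on {a..b}. 0 \<le> m t" using bd by eventually_elim (meson norm_ge_zero order_trans)
  have B0: "0 \<le> B"
    using integral_lebesgue_on_interval(3)[OF m order_refl order_refl] integral_nonneg_AE[OF m0] by (simp add: B_def)
  have step: "norm (zs (Suc n) t - zs n t) \<le> B * (1/2)^n * w t" if "t \<in> {a..b}" for n t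
    using that
  proof (induction n arbitrary: t)
    case 0
    have w1: "1 \<le> w t"
      using integral_nonneg[OF integral_lebesgue_on_interval(2)[OF l, of a t]] nn 0 by (simp add: w_def)
    have "norm (zs 1 t - zs 0 t) \<le> integral {a..t} m"
    proof -
      have "AE s in lebesgue_on {a..b}. norm (G s (zs 0 s)) \<le> m s" using bd by eventually_elim blast
      then show ?thesis
        using norm_integral_interval_le_AE[OF Gi[OF zc[of 0]] m order_refl, of t] 0
        by (simp add: zs_def T_def)
    qed
    also have "\<dots> \<le> B"
    proof -
      have "0 \<le> integral {t..b} m"
        using integral_lebesgue_on_interval(3)[OF m, of t b] integral_nonneg_AE[OF AE_lebesgue_on_subset[OF m0, of "{t..b}"]] 0 by auto
      then show ?thesis using integral_interval_combine[OF m, of t b] 0 by (simp add: B_def)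
    qed
    also have "\<dots> \<le> B * w t" using w1 B0 by (simp add: mult_le_cancel_left1)
    finally show ?case by simp
  next
    case (Suc n)
    have "norm (T (zs (Suc n)) t - T (zs n) t) \<le> integral {a..t} (\<lambda>s. l s * (B * (1/2)^n * w s))"
      by (rule Tdiff[OF zc zc _ Suc.prems Suc.IH]) (auto intro!: continuous_intros wc)
    also have "\<dots> = B * (1/2)^n * ((w t - 1) / 2)"
    proof (rule integral_unique)
      have "((\<lambda>s. (B * (1/2)^n) * (l s * w s)) has_integral B * (1/2)^n * ((w t - 1) / 2)) {a..t}"
        unfolding w_def by (intro has_integral_mult_right integral_exp_weight[OF l nn Suc.prems])
      then show "((\<lambda>s. l s * (B * (1/2)^n * w s)) has_integral B * (1/2)^n * ((w t - 1) / 2)) {a..t}"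
        by (simp add: mult_ac)
    qed
    also have "\<dots> \<le> B * (1/2)^n * (w t / 2)" using B0 by (intro mult_left_mono) auto
    finally show ?case by (simp add: zs_Suc)
  qed
  have wle: "w t \<le> w b" if "t \<in> {a..b}" for t
    using integral_interval_combine[OF l, of t b] integral_nonneg[OF integral_lebesgue_on_interval(2)[OF l, of t b]] nn that
    by (auto simp: w_def)
  have tele: "(\<Sum>i<n. zs (Suc i) t - zs i t) = zs n t - zs 0 t" for n t
    using sum_lessThan_telescope[of "\<lambda>n. zs n t" n] .
  have "uniform_limit {a..b} (\<lambda>n t. \<Sum>i<n. zs (Suc i) t - zs i t) (\<lambda>t. \<Sum>i. zs (Suc i) t - zs i t) sequentially"
  proof (rule Weierstrass_m_test)
    show "norm (zs (Suc n) t - zs n t) \<le> B * w b * (1/2)^n" if "t \<in> {a..b}" for n t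
    proof -
      have "B * (1/2)^n * w t \<le> B * (1/2)^n * w b" using wle[OF that] B0 by (intro mult_left_mono) auto
      then show ?thesis using step[OF that, of n] by (simp add: mult_ac)
    qed
    show "summable (\<lambda>n. B * w b * (1/2::real)^n)" by (intro summable_mult) simp
  qed
  then have "uniform_limit {a..b} (\<lambda>n t. zs n t - zs 0 t) (\<lambda>t. \<Sum>i. zs (Suc i) t - zs i t) sequentially"
    unfolding tele .
  then have "uniform_limit {a..b} (\<lambda>n t. (zs n t - zs 0 t) + zs 0 t) (\<lambda>t. (\<Sum>i. zs (Suc i) t - zs i t) + zs 0 t) sequentially"
    by (rule uniform_limit_add[OF _ uniform_limit_const])
  then obtain z where ul: "uniform_limit {a..b} zs z sequentially" by simp
  have z: "continuous_on {a..b} z"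
    by (rule uniform_limit_theorem[OF _ ul]) (use zc in auto)
  have "z t = T z t" if t: "t \<in> {a..b}" for t
  proof -
    have "(\<lambda>n. T (zs n) t) \<longlonglongrightarrow> T z t"
    proof (rule LIMSEQ_I)
      fix e :: real assume e: "0 < e"
      \<comment> \<open>One more than the integral of \<open>l\<close>: this avoids division by 0
        and makes the final inequality strict.\<close>
      define c where "c = integral {a..t} l + 1"
      have c: "c > 0" using integral_nonneg[OF integral_lebesgue_on_interval(2)[OF l, of a t]] nn t by (auto simp: c_def)
      obtain N where N: "\<And>n s. n \<ge> N \<Longrightarrow> s \<in> {a..b} \<Longrightarrow> dist (zs n s) (z s) < e / c"
        using ul e c unfolding uniform_limit_sequentially_iff by (meson divide_pos_pos)
      have "norm (T (zs n) t - T z t) < e" if n: "n \<ge> N" for n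
      proof -
        have "norm (T (zs n) t - T z t) \<le> integral {a..t} (\<lambda>s. l s * (e / c))"
          by (rule Tdiff[OF zc z _ t]) (use N[OF n] in \<open>auto simp: dist_norm less_imp_le\<close>)
        also have "\<dots> = (c - 1) * (e / c)" by (simp add: c_def)
        also have "\<dots> < e" using c e by (simp add: field_simps)
        finally show ?thesis .
      qed
      then show "\<exists>N. \<forall>n\<ge>N. norm (T (zs n) t - T z t) < e" by blast
    qed
    moreover have "(\<lambda>n. T (zs n) t) \<longlonglongrightarrow> z t"
      using LIMSEQ_Suc[OF tendsto_uniform_limitI[OF ul t]] by (simp add: zs_Suc)
    ultimately show ?thesis by (rule LIMSEQ_unique[rotated])
  qed
  then show thesis using that[OF z Gi[OF z]] by (simp add: T_def)
qed

section \<open>Measurability of superpositions\<close>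

lemma borel_measurable_lebesgue_on_AE:
  fixes f g :: "'a::euclidean_space \<Rightarrow> 'b::euclidean_space"
  assumes "f \<in> borel_measurable (lebesgue_on S)" "AE t in lebesgue_on S. f t = g t" "S \<in> sets lebesgue"
  shows "g \<in> borel_measurable (lebesgue_on S)"
proof -
  obtain N where N: "negligible N" "\<forall>t\<in>S - N. f t = g t"
    using assms(2) AE_lebesgue_on_iff_negligible[OF assms(3)] by blast
  have "(\<lambda>t. if t \<in> S then f t else 0) \<in> borel_measurable lebesgue"
    using assms(1,3) by (simp add: borel_measurable_if)
  moreover have "AE t in lebesgue. (if t \<in> S then f t else 0) = (if t \<in> S then g t else 0)"
    using N by (intro AE_I'[of N]) (auto simp: negligible_iff_null_sets)
  ultimately have "(\<lambda>t. if t \<in> S then g t else 0) \<in> borel_measurable lebesgue"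
    by (rule borel_measurable_AE)
  then show ?thesis using assms(3) by (simp add: borel_measurable_if)
qed

text \<open>Time is discretized inside \<open>x\<close> only. Then \<open>x\<close> takes countably
  many values, for each of which \<open>F\<close> is measurable in \<open>t\<close> by assumption,
  and continuity of \<open>F t\<close> passes to the limit.\<close>

lemma superposition_measurable:
  fixes F :: "real \<Rightarrow> 'a::euclidean_space \<Rightarrow> 'b::euclidean_space"
  assumes ab: "a \<le> b" and x: "continuous_on {a..b} x" "x ` {a..b} \<subseteq> S"
    and F: "\<And>s. s \<in> S \<Longrightarrow> (\<lambda>t. F t s) \<in> borel_measurable (lebesgue_on {a..b})"
    and cont: "AE t in lebesgue_on {a..b}. continuous_on S (F t)"
  shows "(\<lambda>t. F t (x t)) \<in> borel_measurable (lebesgue_on {a..b})"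
proof -
  obtain N where N: "negligible N" "\<And>t. t \<in> {a..b} - N \<Longrightarrow> continuous_on S (F t)"
    using cont AE_lebesgue_on_iff_negligible[of "{a..b}"] by auto
  \<comment> \<open>Rounding down to the grid of mesh 1/(k+1), clamped to the interval so that
    \<open>x\<close> is evaluated only where its values lie in \<open>S\<close>.\<close>
  define q where "q k t = max a (min b (real_of_int \<lfloor>real (Suc k) * t\<rfloor> / real (Suc k)))" for k t
  have Nm: "N \<inter> {a..b} \<in> sets (lebesgue_on {a..b})"
    using N(1) negligible_imp_sets by (auto simp: sets_restrict_space Int_commute)
  have qm: "(\<lambda>t. F t (x (q k t))) \<in> borel_measurable (lebesgue_on {a..b})" for k
    unfolding q_def
  proof (rule measurable_compose_countable[of "\<lambda>i t. F t (x (max a (min b (real_of_int i / real (Suc k)))))"])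
    show "(\<lambda>t. F t (x (max a (min b (real_of_int i / real (Suc k)))))) \<in> borel_measurable (lebesgue_on {a..b})" for i :: int
      using ab by (intro F subsetD[OF x(2)]) (auto simp: max_def min_def)
    have "(\<lambda>t. \<lfloor>real (Suc k) * t\<rfloor>) \<in> borel \<rightarrow>\<^sub>M count_space UNIV" by measurable
    then have "(\<lambda>t. \<lfloor>real (Suc k) * t\<rfloor>) \<in> lebesgue \<rightarrow>\<^sub>M count_space UNIV"
      by (metis measurable_completion measurable_lborel2 measurable_lborel1)
    then show "(\<lambda>t. \<lfloor>real (Suc k) * t\<rfloor>) \<in> lebesgue_on {a..b} \<rightarrow>\<^sub>M count_space UNIV" by (rule measurable_restrict_space1)
  qed
  \<comment> \<open>On the exceptional set all approximations and the limit are set to 0, so that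
    convergence holds at every point and not only almost everywhere.\<close>
  define g where "g t = (if t \<in> N \<inter> {a..b} then 0 else F t (x t))" for t
  have "g \<in> borel_measurable (lebesgue_on {a..b})"
  proof (rule borel_measurable_LIMSEQ_metric)
    show "(\<lambda>t. if t \<in> N \<inter> {a..b} then 0 else F t (x (q k t))) \<in> borel_measurable (lebesgue_on {a..b})" for k
      using Nm qm by (intro measurable_If_set) auto
    fix t assume "t \<in> space (lebesgue_on {a..b})"
    then have t: "t \<in> {a..b}" by simp
    show "(\<lambda>k. if t \<in> N \<inter> {a..b} then 0 else F t (x (q k t))) \<longlonglongrightarrow> g t"
    proof (cases "t \<in> N")
      case False
      have "(\<lambda>k. q k t) \<longlonglongrightarrow> max a (min b t)"
        unfolding q_def
      proof (intro tendsto_intros)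
        have "(\<lambda>n. real_of_int \<lfloor>real n * t\<rfloor> / real n) \<longlonglongrightarrow> t"
        proof (rule tendsto_sandwich[of "\<lambda>n. t - 1 / real n" _ _ "\<lambda>n. t"])
          show "\<forall>\<^sub>F n in sequentially. t - 1 / real n \<le> real_of_int \<lfloor>real n * t\<rfloor> / real n"
            using eventually_gt_at_top[of 0]
          proof eventually_elim
            case (elim n)
            have "real n * t - 1 \<le> real_of_int \<lfloor>real n * t\<rfloor>" by linarith
            then have "(real n * t - 1) / real n \<le> real_of_int \<lfloor>real n * t\<rfloor> / real n" by (rule divide_right_mono) simp
            then show ?case using elim by (simp add: diff_divide_distrib)
          qed
          show "\<forall>\<^sub>F n in sequentially. real_of_int \<lfloor>real n * t\<rfloor> / real n \<le> t"
            using eventually_gt_at_top[of 0]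
          proof eventually_elim
            case (elim n)
            have "real_of_int \<lfloor>real n * t\<rfloor> / real n \<le> (real n * t) / real n" by (rule divide_right_mono) auto
            then show ?case using elim by simp
          qed
          show "(\<lambda>n. t - 1 / real n) \<longlonglongrightarrow> t" using tendsto_diff[OF tendsto_const[of t] lim_1_over_n] by simp
        qed simp
        then show "(\<lambda>k. real_of_int \<lfloor>real (Suc k) * t\<rfloor> / real (Suc k)) \<longlonglongrightarrow> t" by (rule LIMSEQ_Suc)
      qed
      then have "(\<lambda>k. q k t) \<longlonglongrightarrow> t" using t by simp
      moreover have qin: "q k t \<in> {a..b}" for k using ab by (auto simp: q_def max_def min_def)
      ultimately have "(\<lambda>k. x (q k t)) \<longlonglongrightarrow> x t"
        by (intro continuous_on_tendsto_compose[OF x(1) _ t]) auto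
      from N(2) this have "(\<lambda>k. F t (x (q k t))) \<longlonglongrightarrow> F t (x t)"
      proof (rule continuous_on_tendsto_compose)
        show "t \<in> {a..b} - N" "x t \<in> S" using t False x(2) by auto
        show "\<forall>\<^sub>F k in sequentially. x (q k t) \<in> S"
          using x(2) qin by (intro always_eventually allI) (auto simp: image_subset_iff)
      qed
      then show ?thesis using False by (simp add: g_def)
    qed (use t in \<open>simp add: g_def\<close>)
  qed
  moreover have "AE t in lebesgue_on {a..b}. g t = F t (x t)"
    by (subst AE_lebesgue_on_iff_negligible) (use N in \<open>auto simp: g_def\<close>)
  ultimately show ?thesis by (rule borel_measurable_lebesgue_on_AE) simp
qed

section \<open>Square integrable functions\<close>

text \<open>The elements are functions and the inner product is only semi-definite, so limits are
  determined merely up to null sets. The Hilbert space arguments below use the quadratic form and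
  never the implication from norm 0 to zero.\<close>

definition L2 :: "'t measure \<Rightarrow> ('t \<Rightarrow> 'a::euclidean_space) set" where
  "L2 M = {h \<in> borel_measurable M. integrable M (\<lambda>t. (norm (h t))\<^sup>2)}"

definition L2_inner :: "'t measure \<Rightarrow> ('t \<Rightarrow> 'a::euclidean_space) \<Rightarrow> ('t \<Rightarrow> 'a) \<Rightarrow> real" where
  "L2_inner M v w = (LINT t|M. v t \<bullet> w t)"

definition L2_sqnorm :: "'t measure \<Rightarrow> ('t \<Rightarrow> 'a::euclidean_space) \<Rightarrow> real" where
  "L2_sqnorm M v = (LINT t|M. (norm (v t))\<^sup>2)"

lemma L2I: "h \<in> borel_measurable M \<Longrightarrow> integrable M (\<lambda>t. (norm (h t))\<^sup>2) \<Longrightarrow> h \<in> L2 M"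
  and L2_measurable [measurable_dest]: "h \<in> L2 M \<Longrightarrow> h \<in> borel_measurable M"
  and L2_integrable_norm2: "h \<in> L2 M \<Longrightarrow> integrable M (\<lambda>t. (norm (h t))\<^sup>2)"
  by (auto simp: L2_def)

lemma L2_inner_integrable:
  fixes v w :: "'t \<Rightarrow> 'a::euclidean_space"
  assumes "v \<in> L2 M" "w \<in> L2 M"
  shows "integrable M (\<lambda>t. v t \<bullet> w t)"
proof (rule Bochner_Integration.integrable_bound)
  show "integrable M (\<lambda>t. (norm (v t))\<^sup>2 + (norm (w t))\<^sup>2)"
    using assms by (intro Bochner_Integration.integrable_add L2_integrable_norm2)
  show "(\<lambda>t. v t \<bullet> w t) \<in> borel_measurable M" using assms by measurable
  have "\<bar>a \<bullet> b\<bar> \<le> (norm a)\<^sup>2 + (norm b)\<^sup>2" for a b :: 'a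
  proof -
    have "\<bar>a \<bullet> b\<bar> \<le> norm a * norm b" by (rule Cauchy_Schwarz_ineq2)
    also have "\<dots> \<le> (norm a)\<^sup>2 + (norm b)\<^sup>2"
      using sum_squares_bound[of "norm a" "norm b"] mult_nonneg_nonneg[OF norm_ge_zero norm_ge_zero, of a b]
      unfolding mult.assoc by linarith
    finally show ?thesis .
  qed
  then show "AE t in M. norm (v t \<bullet> w t) \<le> norm ((norm (v t))\<^sup>2 + (norm (w t))\<^sup>2)" by simp
qed

lemma norm_add_scale2: "(norm (v + s *\<^sub>R w))\<^sup>2 = (norm v)\<^sup>2 + 2 * s * (v \<bullet> w) + s\<^sup>2 * (norm w)\<^sup>2"
  for v w :: "'a::real_inner"
proof -
  have "(v + s *\<^sub>R w) \<bullet> (v + s *\<^sub>R w) = v \<bullet> v + 2 * s * (v \<bullet> w) + s\<^sup>2 * (w \<bullet> w)"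
    by (simp only: inner_add_left inner_add_right inner_scaleR_left inner_scaleR_right inner_commute[of w v] power2_eq_square)
       (simp add: algebra_simps)
  then show ?thesis by (simp only: power2_norm_eq_inner)
qed

lemma L2_lincomb:
  assumes "v \<in> L2 M" "w \<in> L2 M"
  shows "(\<lambda>t. v t + s *\<^sub>R w t) \<in> L2 M"
    and L2_sqnorm_lincomb: "L2_sqnorm M (\<lambda>t. v t + s *\<^sub>R w t) = L2_sqnorm M v + 2 * s * L2_inner M v w + s\<^sup>2 * L2_sqnorm M w"
proof -
  note [simp] = L2_integrable_norm2[OF assms(1)] L2_integrable_norm2[OF assms(2)] L2_inner_integrable[OF assms]
  show "(\<lambda>t. v t + s *\<^sub>R w t) \<in> L2 M"
    using assms by (intro L2I) (auto simp: norm_add_scale2)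
  show "L2_sqnorm M (\<lambda>t. v t + s *\<^sub>R w t) = L2_sqnorm M v + 2 * s * L2_inner M v w + s\<^sup>2 * L2_sqnorm M w"
    by (simp add: L2_sqnorm_def L2_inner_def norm_add_scale2)
qed

lemma L2_zero: "(\<lambda>_. 0) \<in> L2 M" by (simp add: L2_def)

lemma L2_diff: "v \<in> L2 M \<Longrightarrow> w \<in> L2 M \<Longrightarrow> (\<lambda>t. v t - w t) \<in> L2 M"
  using L2_lincomb[of v M w "-1"] by simp

lemma L2_scaleR: "v \<in> L2 M \<Longrightarrow> (\<lambda>t. c *\<^sub>R v t) \<in> L2 M"
  using L2_lincomb[OF L2_zero, of v M c] by simp

lemma L2_sqnorm_nonneg: "0 \<le> L2_sqnorm M v" by (simp add: L2_sqnorm_def)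

lemma L2_inner_commute: "L2_inner M v w = L2_inner M w v" by (simp add: L2_inner_def inner_commute)

lemma L2_inner_lincomb:
  assumes "v \<in> L2 M" "w \<in> L2 M" "z \<in> L2 M"
  shows "L2_inner M z (\<lambda>t. v t + s *\<^sub>R w t) = L2_inner M z v + s * L2_inner M z w"
  using L2_inner_integrable[OF assms(3,1)] L2_inner_integrable[OF assms(3,2)]
  by (simp add: L2_inner_def inner_add_right)

lemma L2_inner_diff: "v \<in> L2 M \<Longrightarrow> w \<in> L2 M \<Longrightarrow> z \<in> L2 M \<Longrightarrow> L2_inner M z (\<lambda>t. v t - w t) = L2_inner M z v - L2_inner M z w"
  using L2_inner_lincomb[of v M w z "-1"] by simp

text \<open>Discriminant criterion. It yields the Cauchy-Schwarz inequality, and with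
  \<open>A = 0\<close> it turns nonnegativity of a quadratic into the vanishing of its linear
  coefficient, which is how the first variation is exploited in the Riesz representation.\<close>

lemma nonneg_quadratic:
  fixes A B C :: real
  assumes "\<And>s. 0 \<le> A + 2 * s * B + s\<^sup>2 * C"
  shows "B\<^sup>2 \<le> A * C"
proof (cases "C = 0")
  case True
  \<comment> \<open>If \<open>B\<close> were not 0, the linear polynomial would take the value -1 at
    this point.\<close>
  then have "B = 0" using assms[of "- (A + 1) / (2 * B)"] by (cases "B = 0") (auto simp: field_simps)
  then show ?thesis using True by simp
next
  case False
  have "C \<ge> 0"
  proof (rule ccontr)
    assume "\<not> 0 \<le> C"
    then have C: "C < 0" by simp
    \<comment> \<open>For this \<open>s\<close> the negative quadratic term outweighs the other two
      and the value is at most \<open>- s\<close>; the last summand guarantees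
      \<open>s \<ge> 1\<close>.\<close>
    define s where "s = (\<bar>A\<bar> + 2 * \<bar>B\<bar> + 1) / - C + 1"
    have s: "s \<ge> 1" "- C * s \<ge> \<bar>A\<bar> + 2 * \<bar>B\<bar> + 1" using C by (auto simp: s_def field_simps)
    have "A \<le> s * \<bar>A\<bar>" using s(1) by (smt (verit) mult_right_mono mult_cancel_right1 abs_ge_zero)
    moreover have "2 * s * B \<le> s * (2 * \<bar>B\<bar>)" using s(1) by (simp add: mult_left_mono)
    moreover have "s\<^sup>2 * C \<le> - (s * (\<bar>A\<bar> + 2 * \<bar>B\<bar> + 1))"
      using mult_left_mono[OF s(2), of s] s(1) by (simp add: power2_eq_square algebra_simps)
    ultimately have "A + 2 * s * B + s\<^sup>2 * C \<le> s * \<bar>A\<bar> + s * (2 * \<bar>B\<bar>) + - (s * (\<bar>A\<bar> + 2 * \<bar>B\<bar> + 1))"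
      by (intro add_mono)
    also have "\<dots> = - s" by (simp add: algebra_simps)
    finally show False using assms[of s] s(1) by linarith
  qed
  then have "C > 0" using False by simp
  then show ?thesis using assms[of "- B / C"] by (simp add: field_simps power2_eq_square)
qed

lemma L2_inner_Cauchy_Schwarz:
  assumes "v \<in> L2 M" "w \<in> L2 M"
  shows "\<bar>L2_inner M v w\<bar> \<le> sqrt (L2_sqnorm M v) * sqrt (L2_sqnorm M w)"
proof -
  have "0 \<le> L2_sqnorm M v + 2 * s * L2_inner M v w + s\<^sup>2 * L2_sqnorm M w" for s
    using L2_sqnorm_lincomb[OF assms, of s] L2_sqnorm_nonneg by metis
  then have "(L2_inner M v w)\<^sup>2 \<le> L2_sqnorm M v * L2_sqnorm M w" by (rule nonneg_quadratic)
  then have "sqrt ((L2_inner M v w)\<^sup>2) \<le> sqrt (L2_sqnorm M v * L2_sqnorm M w)" by (rule real_sqrt_le_mono)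
  then show ?thesis by (simp add: real_sqrt_mult)
qed

lemma L2_imp_integrable_norm:
  assumes "finite_measure M" "v \<in> L2 M"
  shows "integrable M (\<lambda>t. norm (v t))"
    and "(LINT t|M. norm (v t)) \<le> sqrt (L2_sqnorm M v) * sqrt (measure M (space M))"
proof -
  interpret finite_measure M by fact
  have 1: "(\<lambda>t. norm (v t)) \<in> L2 M" using assms(2) by (auto simp: L2_def)
  have 2: "(\<lambda>_. 1::real) \<in> L2 M" by (auto simp: L2_def)
  show "integrable M (\<lambda>t. norm (v t))" using L2_inner_integrable[OF 1 2] by simp
  show "(LINT t|M. norm (v t)) \<le> sqrt (L2_sqnorm M v) * sqrt (measure M (space M))"
    using L2_inner_Cauchy_Schwarz[OF 1 2] by (simp add: L2_inner_def L2_sqnorm_def)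
qed

lemma L2_imp_integrable: "finite_measure M \<Longrightarrow> v \<in> L2 M \<Longrightarrow> integrable M v"
  using L2_imp_integrable_norm(1) integrable_norm_iff L2_measurable by blast

text \<open>On a finite measure space a Cauchy sequence in L^2 is one in L^1, so a subsequence
  converges almost everywhere. Fatou's lemma, applied to the differences with a fixed member,
  carries the L^2 bounds over to the limit.\<close>

lemma L2_complete:
  fixes vs :: "nat \<Rightarrow> 't \<Rightarrow> 'a::euclidean_space"
  assumes fin: "finite_measure M" and vs: "\<And>n. vs n \<in> L2 M"
    and C: "\<And>e. 0 < e \<Longrightarrow> \<exists>N. \<forall>i\<ge>N. \<forall>j\<ge>N. L2_sqnorm M (\<lambda>t. vs i t - vs j t) < e"
  obtains w where "w \<in> L2 M" "(\<lambda>n. L2_sqnorm M (\<lambda>t. vs n t - w t)) \<longlonglongrightarrow> 0"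
proof -
  have [measurable]: "vs n \<in> borel_measurable M" for n using vs by measurable
  define c where "c = sqrt (measure M (space M)) + 1"
  have c: "c > 0" by (simp add: c_def add_nonneg_pos)
  have "\<exists>N. \<forall>i\<ge>N. \<forall>j\<ge>N. LINT x|M. norm (vs i x - vs j x) < e" if e: "e > 0" for e
  proof -
    obtain N where N: "\<And>i j. i \<ge> N \<Longrightarrow> j \<ge> N \<Longrightarrow> L2_sqnorm M (\<lambda>t. vs i t - vs j t) < (e / c)\<^sup>2"
      using C[of "(e/c)\<^sup>2"] e c by auto
    have "(LINT x|M. norm (vs i x - vs j x)) < e" if ij: "i \<ge> N" "j \<ge> N" for i j
    proof -
      have "(LINT x|M. norm (vs i x - vs j x)) \<le> sqrt (L2_sqnorm M (\<lambda>t. vs i t - vs j t)) * sqrt (measure M (space M))"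
        by (rule L2_imp_integrable_norm(2)[OF fin L2_diff[OF vs vs]])
      also have "\<dots> \<le> sqrt (L2_sqnorm M (\<lambda>t. vs i t - vs j t)) * c"
        by (intro mult_left_mono) (auto simp: c_def L2_sqnorm_nonneg)
      also have "\<dots> < (e / c) * c"
        using N[OF ij] e c real_sqrt_less_mono[OF N[OF ij]] by (intro mult_strict_right_mono) (auto simp: )
      finally show ?thesis using c by simp
    qed
    then show ?thesis by blast
  qed
  then obtain r where r: "strict_mono r" and aeC: "AE x in M. Cauchy (\<lambda>i. vs (r i) x)"
    using cauchy_L1_AE_cauchy_subseq[of M vs, OF L2_imp_integrable[OF fin vs]] by blast
  define w where "w x = lim (\<lambda>i. vs (r i) x)" for x
  have [measurable]: "w \<in> borel_measurable M" unfolding w_def by measurable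
  have lim: "AE x in M. (\<lambda>i. vs (r i) x) \<longlonglongrightarrow> w x"
    using aeC by (auto simp: w_def Cauchy_convergent_iff convergent_LIMSEQ_iff)
  \<comment> \<open>The bound is stated with the nonnegative integral because integrability of the
    difference is not known yet and will follow from it.\<close>
  have fatou: "(\<integral>\<^sup>+ x. ennreal ((norm (vs n x - w x))\<^sup>2) \<partial>M) \<le> ennreal e"
    if n: "n \<ge> N" and N: "\<And>i j. i \<ge> N \<Longrightarrow> j \<ge> N \<Longrightarrow> L2_sqnorm M (\<lambda>t. vs i t - vs j t) < e" for n N e
  proof -
    have "(\<integral>\<^sup>+ x. ennreal ((norm (vs n x - w x))\<^sup>2) \<partial>M) = (\<integral>\<^sup>+ x. liminf (\<lambda>i. ennreal ((norm (vs n x - vs (r i) x))\<^sup>2)) \<partial>M)"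
    proof (rule nn_integral_cong_AE)
      show "AE x in M. ennreal ((norm (vs n x - w x))\<^sup>2) = liminf (\<lambda>i. ennreal ((norm (vs n x - vs (r i) x))\<^sup>2))"
        using lim
      proof eventually_elim
        case (elim x)
        then have "(\<lambda>i. ennreal ((norm (vs n x - vs (r i) x))\<^sup>2)) \<longlonglongrightarrow> ennreal ((norm (vs n x - w x))\<^sup>2)"
          by (intro tendsto_intros tendsto_ennrealI)
        then show ?case by (metis lim_imp_Liminf trivial_limit_sequentially)
      qed
    qed
    also have "\<dots> \<le> liminf (\<lambda>i. \<integral>\<^sup>+ x. ennreal ((norm (vs n x - vs (r i) x))\<^sup>2) \<partial>M)"
      by (rule nn_integral_liminf) measurable
    also have "\<dots> \<le> ennreal e"
    proof (rule Liminf_le)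
      show "\<forall>\<^sub>F i in sequentially. (\<integral>\<^sup>+ x. ennreal ((norm (vs n x - vs (r i) x))\<^sup>2) \<partial>M) \<le> ennreal e"
        using eventually_ge_at_top[of N]
      proof eventually_elim
        case (elim i)
        have "(\<integral>\<^sup>+ x. ennreal ((norm (vs n x - vs (r i) x))\<^sup>2) \<partial>M) = ennreal (L2_sqnorm M (\<lambda>t. vs n t - vs (r i) t))"
          unfolding L2_sqnorm_def by (rule nn_integral_eq_integral) (auto intro!: L2_integrable_norm2 L2_diff vs)
        also have "\<dots> \<le> ennreal e"
          using N[OF n, of "r i"] seq_suble[OF r, of i] elim by (intro ennreal_leI) auto
        finally show ?case .
      qed
    qed simp
    finally show ?thesis .
  qed
  have dL2: "(\<lambda>x. vs n x - w x) \<in> L2 M \<and> L2_sqnorm M (\<lambda>t. vs n t - w t) \<le> e"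
    if n: "n \<ge> N" and N: "\<And>i j. i \<ge> N \<Longrightarrow> j \<ge> N \<Longrightarrow> L2_sqnorm M (\<lambda>t. vs i t - vs j t) < e" for n N e
  proof
    have e: "0 \<le> e" using N[of N N] L2_sqnorm_nonneg[of M "\<lambda>t. vs N t - vs N t"] by auto
    have int: "integrable M (\<lambda>x. (norm (vs n x - w x))\<^sup>2)"
      using fatou[OF n N] by (intro integrableI_bounded) (auto intro: le_less_trans)
    then show "(\<lambda>x. vs n x - w x) \<in> L2 M" by (auto simp: L2_def)
    have "ennreal (L2_sqnorm M (\<lambda>t. vs n t - w t)) \<le> ennreal e"
      unfolding L2_sqnorm_def using fatou[OF n N] nn_integral_eq_integral[OF int] by auto
    then show "L2_sqnorm M (\<lambda>t. vs n t - w t) \<le> e" using e by simp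
  qed
  show thesis
  proof
    obtain N where N: "\<And>i j. i \<ge> N \<Longrightarrow> j \<ge> N \<Longrightarrow> L2_sqnorm M (\<lambda>t. vs i t - vs j t) < 1" using C[of 1] by auto
    have "(\<lambda>x. vs N x - (vs N x - w x)) \<in> L2 M"
      using L2_diff[OF vs[of N], of "\<lambda>x. vs N x - w x"] dL2[of N N 1, OF _ N] by blast
    then show "w \<in> L2 M" by simp
    show "(\<lambda>n. L2_sqnorm M (\<lambda>t. vs n t - w t)) \<longlonglongrightarrow> 0"
    proof (rule LIMSEQ_I)
      fix e :: real assume "0 < e"
      then obtain N where N: "\<And>i j. i \<ge> N \<Longrightarrow> j \<ge> N \<Longrightarrow> L2_sqnorm M (\<lambda>t. vs i t - vs j t) < e / 2" using C[of "e/2"] by auto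
      show "\<exists>N. \<forall>n\<ge>N. norm (L2_sqnorm M (\<lambda>t. vs n t - w t) - 0) < e"
      proof (intro exI[of _ N] allI impI)
        fix n assume "N \<le> n"
        then have "L2_sqnorm M (\<lambda>t. vs n t - w t) \<le> e / 2" using dL2[of N n "e/2"] N by blast
        then show "norm (L2_sqnorm M (\<lambda>t. vs n t - w t) - 0) < e"
          using \<open>0 < e\<close> L2_sqnorm_nonneg[of M "\<lambda>t. vs n t - w t"] by simp
      qed
    qed
  qed
qed

lemma L2_inner_tendsto:
  assumes "\<And>n. vs n \<in> L2 M" "w \<in> L2 M" "z \<in> L2 M" "(\<lambda>n. L2_sqnorm M (\<lambda>t. vs n t - w t)) \<longlonglongrightarrow> 0"
  shows "(\<lambda>n. L2_inner M z (vs n)) \<longlonglongrightarrow> L2_inner M z w"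
proof (rule Lim_transform2[OF tendsto_const], rule Lim_null_comparison)
  show "\<forall>\<^sub>F n in sequentially. norm (L2_inner M z w - L2_inner M z (vs n)) \<le> sqrt (L2_sqnorm M z) * sqrt (L2_sqnorm M (\<lambda>t. vs n t - w t))"
    using L2_inner_Cauchy_Schwarz[OF assms(3) L2_diff[OF assms(1,2)]] L2_inner_diff[OF assms(1,2,3)]
    by (auto simp: abs_minus_commute)
  show "(\<lambda>n. sqrt (L2_sqnorm M z) * sqrt (L2_sqnorm M (\<lambda>t. vs n t - w t))) \<longlonglongrightarrow> 0"
    using tendsto_mult[OF tendsto_const tendsto_real_sqrt[OF assms(4)]] by simp
qed

section \<open>Riesz representation\<close>

text \<open>The representing element minimizes \<open>L2_sqnorm v - 2 \<psi> v\<close>; minimizing sequences are Cauchy sequences by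
  the parallelogram identity.\<close>

lemma L2_Riesz_subspace:
  fixes V :: "('t \<Rightarrow> 'a::euclidean_space) set"
  assumes fin: "finite_measure M" and V: "V \<subseteq> L2 M" "(\<lambda>_. 0) \<in> V"
    and lin: "\<And>v w s. v \<in> V \<Longrightarrow> w \<in> V \<Longrightarrow> (\<lambda>t. v t + s *\<^sub>R w t) \<in> V"
    and \<psi>lin: "\<And>v w s. v \<in> V \<Longrightarrow> w \<in> V \<Longrightarrow> \<psi> (\<lambda>t. v t + s *\<^sub>R w t) = \<psi> v + s * \<psi> w"
    and \<psi>bd: "\<And>v. v \<in> V \<Longrightarrow> \<bar>\<psi> v\<bar> \<le> C * sqrt (L2_sqnorm M v)"
  obtains w vs where "w \<in> L2 M" "\<And>n::nat. vs n \<in> V" "(\<lambda>n. L2_sqnorm M (\<lambda>t. vs n t - w t)) \<longlonglongrightarrow> 0"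
    "\<And>v. v \<in> V \<Longrightarrow> \<psi> v = L2_inner M w v"
proof -
  define q where "q v = L2_sqnorm M v - 2 * \<psi> v" for v
  have V': "v \<in> L2 M" if "v \<in> V" for v using V(1) that by auto
  have qlin: "q (\<lambda>t. v t + s *\<^sub>R w t) = q v + 2 * s * (L2_inner M v w - \<psi> w) + s\<^sup>2 * L2_sqnorm M w" if "v \<in> V" "w \<in> V" for v w s
    using L2_sqnorm_lincomb[OF V'[OF that(1)] V'[OF that(2)], of s] \<psi>lin[OF that, of s] by (simp add: q_def algebra_simps)
  have qlb: "- C\<^sup>2 \<le> q v" if "v \<in> V" for v
  proof -
    have "0 \<le> (sqrt (L2_sqnorm M v) - C)\<^sup>2" by simp
    also have "\<dots> = L2_sqnorm M v - 2 * (C * sqrt (L2_sqnorm M v)) + C\<^sup>2"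
      using L2_sqnorm_nonneg[of M v] by (simp add: power2_diff algebra_simps)
    finally show ?thesis using \<psi>bd[OF that] by (simp add: q_def)
  qed
  define I where "I = Inf (q ` V)"
  have bdd: "bdd_below (q ` V)" using qlb by (auto intro!: bdd_belowI2)
  have I: "I \<le> q v" if "v \<in> V" for v unfolding I_def using that bdd by (intro cINF_lower) auto
  have "\<exists>v\<in>V. q v < I + 1 / real (Suc n)" for n
    using cInf_lessD[of "q ` V" "I + 1 / real (Suc n)"] V(2) by (auto simp: I_def)
  then obtain vs where vs: "\<And>n. vs n \<in> V" "\<And>n. q (vs n) < I + 1 / real (Suc n)" by metis
  have par: "L2_sqnorm M (\<lambda>t. vs i t - vs j t) \<le> 2 / real (Suc i) + 2 / real (Suc j)" for i j
  proof -
    \<comment> \<open>Along the segment from \<open>vs i\<close> to \<open>vs j\<close> the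
      functional \<open>q\<close> is a quadratic polynomial. Its value at the midpoint is at least
      \<open>I\<close> and its values at both ends are nearly \<open>I\<close>, which leaves no room
      for a large second-order coefficient.\<close>
    define d where "d = (\<lambda>t. vs j t + (-1) *\<^sub>R vs i t)"
    have d: "d \<in> V" unfolding d_def by (intro lin vs)
    have m: "(\<lambda>t. vs i t + (1/2) *\<^sub>R d t) \<in> V" by (intro lin vs d)
    have e: "(\<lambda>t. vs i t + 1 *\<^sub>R d t) = vs j" by (auto simp: d_def)
    have "I \<le> q (vs i) + (L2_inner M (vs i) d - \<psi> d) + L2_sqnorm M d / 4"
      using I[OF m] qlin[OF vs(1)[of i] d, of "1/2"] by (simp add: power2_eq_square)
    moreover have "q (vs j) = q (vs i) + 2 * (L2_inner M (vs i) d - \<psi> d) + L2_sqnorm M d"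
      using qlin[OF vs(1)[of i] d, of 1] e by simp
    ultimately have "L2_sqnorm M d / 2 \<le> q (vs j) + q (vs i) - 2 * I" by simp
    also have "\<dots> \<le> 1 / real (Suc i) + 1 / real (Suc j)" using vs(2)[of i] vs(2)[of j] by simp
    finally have "L2_sqnorm M d \<le> 2 / real (Suc i) + 2 / real (Suc j)" by simp
    moreover have "L2_sqnorm M d = L2_sqnorm M (\<lambda>t. vs i t - vs j t)" by (simp add: d_def L2_sqnorm_def norm_minus_commute)
    ultimately show ?thesis by simp
  qed
  have cauchy: "\<exists>N. \<forall>i\<ge>N. \<forall>j\<ge>N. L2_sqnorm M (\<lambda>t. vs i t - vs j t) < e" if "0 < e" for e :: real
  proof -
    have "0 < e / 4" using that by simp
    then obtain N where N: "1 / real (Suc N) < e / 4" by (rule nat_approx_posE)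
    have "L2_sqnorm M (\<lambda>t. vs i t - vs j t) < e" if "i \<ge> N" "j \<ge> N" for i j
    proof -
      have "2 / real (Suc i) \<le> 2 / real (Suc N)" "2 / real (Suc j) \<le> 2 / real (Suc N)"
        using that by (auto intro!: divide_left_mono)
      then show ?thesis using par[of i j] N by linarith
    qed
    then show ?thesis by blast
  qed
  obtain w where w: "w \<in> L2 M" "(\<lambda>n. L2_sqnorm M (\<lambda>t. vs n t - w t)) \<longlonglongrightarrow> 0"
    by (rule L2_complete[OF fin V'[OF vs(1)] cauchy])
  have "\<psi> v = L2_inner M w v" if v: "v \<in> V" for v
  proof -
    \<comment> \<open>First variation in the limit: \<open>q\<close> is at least \<open>I\<close> at
      \<open>vs n + s v\<close> and less than \<open>I + 1 / Suc n\<close> at \<open>vs n\<close>.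
      The resulting quadratic in \<open>s\<close> has constant term 0, so its linear coefficient
      must vanish.\<close>
    have "0 \<le> 0 + 2 * s * (L2_inner M w v - \<psi> v) + s\<^sup>2 * L2_sqnorm M v" for s
    proof (rule LIMSEQ_le_const)
      show "(\<lambda>n. 1 / real (Suc n) + 2 * s * (L2_inner M v (vs n) - \<psi> v) + s\<^sup>2 * L2_sqnorm M v) \<longlonglongrightarrow> 0 + 2 * s * (L2_inner M w v - \<psi> v) + s\<^sup>2 * L2_sqnorm M v"
        using L2_inner_tendsto[OF V'[OF vs(1)] w(1) V'[OF v] w(2)] lim_inverse_n'
        unfolding L2_inner_commute[of M w v]
        by (intro tendsto_intros LIMSEQ_Suc[of "\<lambda>n. 1 / real n"])
      have "0 \<le> 1 / real (Suc n) + 2 * s * (L2_inner M v (vs n) - \<psi> v) + s\<^sup>2 * L2_sqnorm M v" for n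
        using I[OF lin[OF vs(1)[of n] v, of s]] qlin[OF vs(1)[of n] v, of s] vs(2)[of n]
        by (simp add: L2_inner_commute)
      then show "\<exists>N. \<forall>n\<ge>N. 0 \<le> 1 / real (Suc n) + 2 * s * (L2_inner M v (vs n) - \<psi> v) + s\<^sup>2 * L2_sqnorm M v" by blast
    qed
    then have "(L2_inner M w v - \<psi> v)\<^sup>2 \<le> 0 * L2_sqnorm M v" by (rule nonneg_quadratic)
    then show ?thesis by simp
  qed
  \<comment> \<open>As \<open>V\<close> need not be closed, \<open>w\<close> itself may lie outside;
    the sequence \<open>vs\<close> records that it belongs to the closure.\<close>
  then show ?thesis using that[OF w(1) vs(1) w(2)] by blast
qed

lemma L2_Riesz:
  fixes \<psi> :: "('t \<Rightarrow> 'a::euclidean_space) \<Rightarrow> real"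
  assumes "finite_measure M"
    and "\<And>v w s. v \<in> L2 M \<Longrightarrow> w \<in> L2 M \<Longrightarrow> \<psi> (\<lambda>t. v t + s *\<^sub>R w t) = \<psi> v + s * \<psi> w"
    and "\<And>v. v \<in> L2 M \<Longrightarrow> \<bar>\<psi> v\<bar> \<le> C * sqrt (L2_sqnorm M v)"
  obtains w where "w \<in> L2 M" "\<And>v. v \<in> L2 M \<Longrightarrow> \<psi> v = L2_inner M w v"
proof (rule L2_Riesz_subspace[OF assms(1) subset_refl L2_zero L2_lincomb(1) assms(2,3)])
  fix w assume "w \<in> L2 M" "\<And>v. v \<in> L2 M \<Longrightarrow> \<psi> v = L2_inner M w v"
  then show thesis by (rule that)
qed

section \<open>Weak sequential compactness\<close>

text \<open>A diagonal argument makes the products with the members of the sequence converge; all other test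
  functions can be replaced by their projections to the closed subspace where the limit exists.\<close>

lemma L2_bounded_weak_subseq:
  fixes u :: "nat \<Rightarrow> 't \<Rightarrow> 'a::euclidean_space"
  assumes fin: "finite_measure M" and u: "\<And>n. u n \<in> L2 M" and B: "\<And>n. L2_sqnorm M (u n) \<le> B"
  obtains r z where "strict_mono (r::nat\<Rightarrow>nat)" "z \<in> L2 M" "\<And>w. w \<in> L2 M \<Longrightarrow> (\<lambda>n. L2_inner M w (u (r n))) \<longlonglongrightarrow> L2_inner M w z"
proof -
  have B0: "0 \<le> B" using B[of 0] L2_sqnorm_nonneg[of M "u 0"] by linarith
  have ub: "\<bar>L2_inner M w (u n)\<bar> \<le> sqrt (L2_sqnorm M w) * sqrt B" if "w \<in> L2 M" for w n
    using L2_inner_Cauchy_Schwarz[OF that u[of n]] mult_left_mono[OF real_sqrt_le_mono[OF B[of n]], of "sqrt (L2_sqnorm M w)"] L2_sqnorm_nonneg[of M w]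
    by (meson order_trans real_sqrt_ge_zero)
  have ipB: "norm (L2_inner M (u m) (u n)) \<le> B" for m n
  proof -
    have "\<bar>L2_inner M (u m) (u n)\<bar> \<le> sqrt (L2_sqnorm M (u m)) * sqrt B" by (rule ub[OF u])
    also have "\<dots> \<le> sqrt B * sqrt B" using B B0 by (intro mult_right_mono) auto
    finally show ?thesis using B0 by simp
  qed
  obtain r where r: "strict_mono (r::nat\<Rightarrow>nat)" "\<And>m. \<exists>l. (\<lambda>n. L2_inner M (u m) (u (r n))) \<longlonglongrightarrow> l"
    by (rule function_convergent_subsequence[of UNIV "\<lambda>n m. L2_inner M (u m) (u n)" B])
       (use ipB in \<open>auto intro: that\<close>)
  \<comment> \<open>The test functions for which the limit exists. They form a linear space
    containing every \<open>u m\<close>, and on it the limit is a bounded functional.\<close>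
  define V where "V = {v \<in> L2 M. convergent (\<lambda>n. L2_inner M v (u (r n)))}"
  define \<psi> where "\<psi> v = lim (\<lambda>n. L2_inner M v (u (r n)))" for v
  have \<psi>: "(\<lambda>n. L2_inner M v (u (r n))) \<longlonglongrightarrow> \<psi> v" if "v \<in> V" for v
    using that unfolding V_def \<psi>_def by (simp add: convergent_LIMSEQ_iff)
  have VL: "v \<in> L2 M" if "v \<in> V" for v using that by (simp add: V_def)
  have uV: "u m \<in> V" for m using r(2) u by (auto simp: V_def convergent_def)
  have lim_lin: "(\<lambda>n. L2_inner M (\<lambda>t. v t + s *\<^sub>R w t) (u (r n))) \<longlonglongrightarrow> \<psi> v + s * \<psi> w" if "v \<in> V" "w \<in> V" for v w s
  proof -
    have "L2_inner M (\<lambda>t. v t + s *\<^sub>R w t) (u (r n)) = L2_inner M v (u (r n)) + s * L2_inner M w (u (r n))" for n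
      using L2_inner_lincomb[OF VL[OF that(1)] VL[OF that(2)] u[of "r n"], where s = s] by (simp add: L2_inner_commute)
    then show ?thesis using \<psi>[OF that(1)] \<psi>[OF that(2)] by (auto intro!: tendsto_intros)
  qed
  have lin: "(\<lambda>t. v t + s *\<^sub>R w t) \<in> V" if "v \<in> V" "w \<in> V" for v w s
    using lim_lin[OF that, of s] L2_lincomb(1)[OF VL[OF that(1)] VL[OF that(2)], of s] by (auto simp: V_def convergent_def)
  have \<psi>lin: "\<psi> (\<lambda>t. v t + s *\<^sub>R w t) = \<psi> v + s * \<psi> w" if "v \<in> V" "w \<in> V" for v w s
    using LIMSEQ_unique[OF \<psi>[OF lin[OF that, of s]] lim_lin[OF that, of s]] .
  have V0: "(\<lambda>_. 0) \<in> V" using L2_zero by (auto simp: V_def L2_inner_def convergent_const)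
  have \<psi>bd: "\<bar>\<psi> v\<bar> \<le> sqrt B * sqrt (L2_sqnorm M v)" if "v \<in> V" for v
    using LIMSEQ_le_const2[OF tendsto_rabs[OF \<psi>[OF that]]] ub[OF VL[OF that]] by (auto simp: mult.commute)
  obtain z zs where z: "z \<in> L2 M" "\<And>n::nat. zs n \<in> V" "(\<lambda>n. L2_sqnorm M (\<lambda>t. zs n t - z t)) \<longlonglongrightarrow> 0"
    "\<And>v. v \<in> V \<Longrightarrow> \<psi> v = L2_inner M z v"
    by (rule L2_Riesz_subspace[OF fin _ V0 lin \<psi>lin \<psi>bd]) (use VL in blast)+
  have "(\<lambda>n. L2_inner M w (u (r n))) \<longlonglongrightarrow> L2_inner M w z" if w: "w \<in> L2 M" for w
  proof -
    \<comment> \<open>\<open>p\<close> is the projection of \<open>w\<close> to the closure of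
      \<open>V\<close>. All \<open>u n\<close> lie in \<open>V\<close>, so \<open>w\<close> and
      \<open>p\<close> have the same products with them.\<close>
    obtain p ps where p: "p \<in> L2 M" "\<And>n::nat. ps n \<in> V" "(\<lambda>n. L2_sqnorm M (\<lambda>t. ps n t - p t)) \<longlonglongrightarrow> 0"
      "\<And>v. v \<in> V \<Longrightarrow> L2_inner M w v = L2_inner M p v"
    proof (rule L2_Riesz_subspace[OF fin _ V0 lin, of "L2_inner M w" "sqrt (L2_sqnorm M w)"])
      show "V \<subseteq> L2 M" using VL by blast
      show "L2_inner M w (\<lambda>t. v t + s *\<^sub>R va t) = L2_inner M w v + s * L2_inner M w va" if "v \<in> V" "va \<in> V" for v va s
        using that VL w by (intro L2_inner_lincomb) auto
      show "\<bar>L2_inner M w v\<bar> \<le> sqrt (L2_sqnorm M w) * sqrt (L2_sqnorm M v)" if "v \<in> V" for v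
        using L2_inner_Cauchy_Schwarz[OF w VL[OF that]] .
    qed (use that in blast)+
    \<comment> \<open>\<open>V\<close> is in fact closed: since the \<open>u n\<close> are bounded,
      a member \<open>ps j\<close> close to \<open>p\<close> gives products close to those of
      \<open>p\<close>, uniformly in the index.\<close>
    have "Cauchy (\<lambda>n. L2_inner M p (u (r n)))"
    proof (rule metric_CauchyI)
      fix e :: real assume e: "0 < e"
      have "(\<lambda>j. sqrt (L2_sqnorm M (\<lambda>t. ps j t - p t)) * sqrt B) \<longlonglongrightarrow> 0"
        using tendsto_mult_right[OF tendsto_real_sqrt[OF p(3)], of "sqrt B"] by simp
      then obtain j where j: "sqrt (L2_sqnorm M (\<lambda>t. ps j t - p t)) * sqrt B < e / 4"
        using order_tendstoD(2)[of _ 0 sequentially "e/4"] e by (auto simp: eventually_sequentially)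
      have close: "\<bar>L2_inner M p (u n) - L2_inner M (ps j) (u n)\<bar> < e / 4" for n
      proof -
        have "\<bar>L2_inner M (\<lambda>t. ps j t - p t) (u n)\<bar> < e / 4"
          using ub[OF L2_diff[OF VL[OF p(2)] p(1)], of j n] j by linarith
        moreover have "L2_inner M (\<lambda>t. ps j t - p t) (u n) = L2_inner M (ps j) (u n) - L2_inner M p (u n)"
          using L2_inner_diff[OF VL[OF p(2)[of j]] p(1) u[of n]] by (simp add: L2_inner_commute)
        ultimately show ?thesis by linarith
      qed
      have "Cauchy (\<lambda>n. L2_inner M (ps j) (u (r n)))" using \<psi>[OF p(2)] by (rule LIMSEQ_imp_Cauchy)
      then have "\<exists>N. \<forall>m\<ge>N. \<forall>n\<ge>N. dist (L2_inner M (ps j) (u (r m))) (L2_inner M (ps j) (u (r n))) < e / 4"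
        by (rule metric_CauchyD) (use e in simp)
      then obtain N where N: "\<And>m n. m \<ge> N \<Longrightarrow> n \<ge> N \<Longrightarrow> \<bar>L2_inner M (ps j) (u (r m)) - L2_inner M (ps j) (u (r n))\<bar> < e / 4"
        unfolding dist_real_def by blast
      have "dist (L2_inner M p (u (r m))) (L2_inner M p (u (r n))) < e" if "m \<ge> N" "n \<ge> N" for m n
        using close[of "r m"] close[of "r n"] N[OF that] e unfolding dist_real_def by linarith
      then show "\<exists>N. \<forall>m\<ge>N. \<forall>n\<ge>N. dist (L2_inner M p (u (r m))) (L2_inner M p (u (r n))) < e" by blast
    qed
    then have "p \<in> V" using p(1) by (simp add: V_def Cauchy_convergent_iff)
    then have "(\<lambda>n. L2_inner M p (u (r n))) \<longlonglongrightarrow> L2_inner M p z" using \<psi> z(4) by (metis L2_inner_commute)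
    moreover have "L2_inner M p (u (r n)) = L2_inner M w (u (r n))" for n using p(4)[OF uV] by simp
    \<comment> \<open>The limit \<open>z\<close> is itself approximated by members of
      \<open>V\<close>, and on these \<open>p\<close> and \<open>w\<close> agree as
      functionals.\<close>
    moreover have "L2_inner M p z = L2_inner M w z"
    proof (rule LIMSEQ_unique)
      show "(\<lambda>n. L2_inner M p (zs n)) \<longlonglongrightarrow> L2_inner M p z" by (rule L2_inner_tendsto[OF VL[OF z(2)] z(1) p(1) z(3)])
      show "(\<lambda>n. L2_inner M p (zs n)) \<longlonglongrightarrow> L2_inner M w z" using L2_inner_tendsto[OF VL[OF z(2)] z(1) w z(3)] p(4)[OF z(2)] by simp
    qed
    ultimately show ?thesis by simp
  qed
  then show ?thesis using that[OF r(1) z(1)] by blast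
qed

text \<open>The box constraints are linear inequalities, so they survive weak limits when tested on
  the set where the limit violates them. The common bound \<open>R\<close> then extends convergence
  from square integrable to all integrable test functions by truncation.\<close>

theorem weak_star_compact_cbox:
  fixes u :: "nat \<Rightarrow> 't \<Rightarrow> 'a::euclidean_space"
  assumes fin: "finite_measure M" and um: "\<And>n. u n \<in> borel_measurable M"
    and ub: "\<And>n. AE t in M. u n t \<in> cbox lo hi"
  obtains r z where "strict_mono (r::nat\<Rightarrow>nat)" "z \<in> borel_measurable M" "AE t in M. z t \<in> cbox lo hi"
    "\<And>w. integrable M w \<Longrightarrow> (\<lambda>n. LINT t|M. w t \<bullet> u (r n) t) \<longlonglongrightarrow> (LINT t|M. w t \<bullet> z t)"
proof -
  interpret finite_measure M by fact
  note [measurable] = um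
  obtain R where R: "\<And>x. x \<in> cbox lo hi \<Longrightarrow> norm x \<le> R" "R \<ge> 0"
    using bounded_cbox[of lo hi] unfolding bounded_pos by (meson less_imp_le)
  have uR: "AE t in M. norm (u n t) \<le> R" for n using ub[of n] by eventually_elim (rule R(1))
  have uL: "u n \<in> L2 M" for n
  proof (rule L2I[OF um integrable_const_bound[of _ "R\<^sup>2"]])
    show "AE t in M. norm ((norm (u n t))\<^sup>2) \<le> R\<^sup>2" using uR[of n] by eventually_elim (simp add: power_mono)
  qed measurable
  have "L2_sqnorm M (u n) \<le> R\<^sup>2 * measure M (space M)" for n
  proof -
    have "L2_sqnorm M (u n) \<le> (LINT t|M. R\<^sup>2)" unfolding L2_sqnorm_def
    proof (rule integral_mono_AE)
      show "AE t in M. (norm (u n t))\<^sup>2 \<le> R\<^sup>2" using uR[of n] by eventually_elim (simp add: power_mono)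
    qed (use L2_integrable_norm2[OF uL] in auto)
    then show ?thesis by (simp add: mult.commute)
  qed
  then obtain r z where r: "strict_mono (r::nat\<Rightarrow>nat)" and z: "z \<in> L2 M" and conv: "\<And>w. w \<in> L2 M \<Longrightarrow> (\<lambda>n. L2_inner M w (u (r n))) \<longlonglongrightarrow> L2_inner M w z"
    by (rule L2_bounded_weak_subseq[where u = u, OF fin uL]) (rule that)
  have [measurable]: "z \<in> borel_measurable M" using z by measurable
  \<comment> \<open>One inequality with a free factor \<open>c\<close> serves both sides of the box:
    \<open>c = 1\<close> for lower and \<open>c = -1\<close> for upper bounds.\<close>
  have zs: "AE t in M. 0 \<le> c * (z t \<bullet> i) - d"
    if i: "i \<in> Basis" and cd: "\<And>x. x \<in> cbox lo hi \<Longrightarrow> 0 \<le> c * (x \<bullet> i) - d" for i :: 'a and c d :: real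
  proof -
    \<comment> \<open>The integral over \<open>E\<close> is a limit of nonnegative numbers, while
      the integrand is negative there by definition; so \<open>E\<close> has measure 0.\<close>
    define E where "E = {t \<in> space M. c * (z t \<bullet> i) - d < 0}"
    have [measurable]: "E \<in> sets M" unfolding E_def by measurable
    define w where "w t = (c * indicator E t) *\<^sub>R i" for t
    have w: "w \<in> L2 M" unfolding w_def
      by (intro L2I integrable_const_bound[of _ "(norm (c *\<^sub>R i))\<^sup>2"]) (auto simp: indicator_def power_mult_distrib)
    have iE: "integrable M (\<lambda>t. d * indicat_real E t)"
      by (intro integrable_mult_right integrable_real_indicator) (auto simp: less_top[symmetric])
    have eq: "L2_inner M w v - d * measure M E = (LINT t|M. indicator E t * (c * (v t \<bullet> i) - d))" if v: "v \<in> L2 M" for v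
    proof -
      have "(\<lambda>t. indicator E t * (c * (v t \<bullet> i) - d)) = (\<lambda>t. w t \<bullet> v t - d * indicator E t)"
        by (auto simp: w_def indicator_def inner_commute)
      then show ?thesis using L2_inner_integrable[OF w v] iE by (simp add: L2_inner_def Int_absorb2 sets.sets_into_space)
    qed
    have "0 \<le> L2_inner M w z - d * measure M E"
    proof (rule LIMSEQ_le_const)
      show "(\<lambda>n. L2_inner M w (u (r n)) - d * measure M E) \<longlonglongrightarrow> L2_inner M w z - d * measure M E" by (intro tendsto_intros conv w)
      have "0 \<le> L2_inner M w (u (r n)) - d * measure M E" for n
        unfolding eq[OF uL]
      proof (rule integral_nonneg_AE)
        show "AE t in M. 0 \<le> indicator E t * (c * (u (r n) t \<bullet> i) - d)"
          using ub[of "r n"] by eventually_elim (use cd in \<open>auto simp: indicator_def\<close>)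
      qed
      then show "\<exists>N. \<forall>n\<ge>N. 0 \<le> L2_inner M w (u (r n)) - d * measure M E" by blast
    qed
    then have "(LINT t|M. - (indicator E t * (c * (z t \<bullet> i) - d))) \<le> 0" unfolding eq[OF z] by simp
    moreover have int: "integrable M (\<lambda>t. - (indicator E t * (c * (z t \<bullet> i) - d)))"
    proof -
      have "(\<lambda>t. - (indicator E t * (c * (z t \<bullet> i) - d))) = (\<lambda>t. d * indicator E t - w t \<bullet> z t)"
        by (auto simp: w_def indicator_def inner_commute)
      then show ?thesis using L2_inner_integrable[OF w z] iE by simp
    qed
    moreover have nn: "AE t in M. 0 \<le> - (indicator E t * (c * (z t \<bullet> i) - d))"
      by (auto simp: E_def indicator_def)
    ultimately have "AE t in M. - (indicator E t * (c * (z t \<bullet> i) - d)) = 0"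
      using integral_nonneg_eq_0_iff_AE[OF int nn] integral_nonneg_AE[OF nn] by linarith
    then show ?thesis using AE_space by eventually_elim (auto simp: E_def indicator_def split: if_splits)
  qed
  have "AE t in M. \<forall>i\<in>Basis. lo \<bullet> i \<le> z t \<bullet> i \<and> z t \<bullet> i \<le> hi \<bullet> i"
  proof (rule AE_finite_allI[OF finite_Basis])
    fix i :: 'a assume i: "i \<in> Basis"
    have "AE t in M. 0 \<le> 1 * (z t \<bullet> i) - lo \<bullet> i" using i by (intro zs) (auto simp: mem_box)
    moreover have "AE t in M. 0 \<le> (-1) * (z t \<bullet> i) - (- (hi \<bullet> i))" using i by (intro zs) (auto simp: mem_box)
    ultimately show "AE t in M. lo \<bullet> i \<le> z t \<bullet> i \<and> z t \<bullet> i \<le> hi \<bullet> i" by eventually_elim auto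
  qed
  then have zb: "AE t in M. z t \<in> cbox lo hi" by (simp add: mem_box)
  then have zR: "AE t in M. norm (z t) \<le> R" by eventually_elim (rule R(1))
  have "(\<lambda>n. LINT t|M. w t \<bullet> u (r n) t) \<longlonglongrightarrow> (LINT t|M. w t \<bullet> z t)" if w: "integrable M w" for w
  proof (rule LIMSEQ_I)
    fix e :: real assume e: "0 < e"
    have [measurable]: "w \<in> borel_measurable M" using w by measurable
    \<comment> \<open>Cutting off large values puts the test function into L^2, at the price of a
      small L^1 error that is multiplied by at most \<open>R\<close>.\<close>
    define wm where "wm m t = (if norm (w t) \<le> real m then w t else 0)" for m t
    have [measurable]: "wm m \<in> borel_measurable M" for m unfolding wm_def by measurable
    have wm: "wm m \<in> L2 M" for m
      by (intro L2I integrable_const_bound[of _ "(real m)\<^sup>2"]) (auto simp: wm_def power_mono)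
    have iw: "integrable M (\<lambda>t. norm (w t - wm m t))" for m
      by (rule Bochner_Integration.integrable_bound[OF integrable_norm[OF w]]) (auto simp: wm_def)
    have "(\<lambda>m. LINT t|M. norm (w t - wm m t)) \<longlonglongrightarrow> (LINT t|M. 0)"
    proof (rule integral_dominated_convergence)
      show "integrable M (\<lambda>t. norm (w t))" using w by simp
      show "AE t in M. (\<lambda>m. norm (w t - wm m t)) \<longlonglongrightarrow> 0"
      proof (rule AE_I2)
        fix t
        obtain N :: nat where N: "norm (w t) \<le> real N" using real_arch_simple by blast
        show "(\<lambda>m. norm (w t - wm m t)) \<longlonglongrightarrow> 0"
          by (rule tendsto_eventually) (use N in \<open>auto simp: wm_def eventually_sequentially intro!: exI[of _ N]\<close>)
      qed
    qed (auto simp: wm_def)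
    then have "(\<lambda>m. R * (LINT t|M. norm (w t - wm m t))) \<longlonglongrightarrow> 0" using tendsto_mult_left by force
    then obtain m where m: "R * (LINT t|M. norm (w t - wm m t)) < e / 4"
      using order_tendstoD(2)[of _ 0 sequentially "e/4"] e by (auto simp: eventually_sequentially)
    \<comment> \<open>The estimate is uniform over all functions bounded by \<open>R\<close>, so one
      truncation level serves every \<open>u (r n)\<close> and also \<open>z\<close>.\<close>
    have close: "\<bar>(LINT t|M. w t \<bullet> v t) - L2_inner M (wm m) v\<bar> < e / 4"
      if [measurable]: "v \<in> borel_measurable M" and vR: "AE t in M. norm (v t) \<le> R" for v
    proof -
      have i1: "integrable M (\<lambda>t. w t \<bullet> v t)"
      proof (rule Bochner_Integration.integrable_bound[of M "\<lambda>t. R * norm (w t)"])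
        show "AE t in M. norm (w t \<bullet> v t) \<le> norm (R * norm (w t))" using vR
        proof eventually_elim
          case (elim t)
          have "\<bar>w t \<bullet> v t\<bar> \<le> norm (w t) * norm (v t)" by (rule Cauchy_Schwarz_ineq2)
          also have "\<dots> \<le> norm (w t) * R" using elim by (intro mult_left_mono) auto
          finally show ?case using R(2) by (simp add: mult.commute)
        qed
      qed (use w in auto)
      have vL: "v \<in> L2 M"
      proof (rule L2I[OF _ integrable_const_bound[of _ "R\<^sup>2"]])
        show "AE t in M. norm ((norm (v t))\<^sup>2) \<le> R\<^sup>2" using vR by eventually_elim (simp add: power_mono)
      qed measurable
      have i2: "integrable M (\<lambda>t. wm m t \<bullet> v t)" by (rule L2_inner_integrable[OF wm vL])
      have "\<bar>(LINT t|M. w t \<bullet> v t) - L2_inner M (wm m) v\<bar> = \<bar>LINT t|M. (w t - wm m t) \<bullet> v t\<bar>"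
        using i1 i2 by (simp add: L2_inner_def inner_diff_left)
      also have "\<dots> \<le> (LINT t|M. \<bar>(w t - wm m t) \<bullet> v t\<bar>)" by (rule integral_abs_bound)
      also have "\<dots> \<le> (LINT t|M. R * norm (w t - wm m t))"
      proof (rule integral_mono_AE)
        show "integrable M (\<lambda>t. \<bar>(w t - wm m t) \<bullet> v t\<bar>)" using i1 i2 by (simp add: inner_diff_left)
        show "AE t in M. \<bar>(w t - wm m t) \<bullet> v t\<bar> \<le> R * norm (w t - wm m t)" using vR
        proof eventually_elim
          case (elim t)
          have "\<bar>(w t - wm m t) \<bullet> v t\<bar> \<le> norm (w t - wm m t) * norm (v t)" by (rule Cauchy_Schwarz_ineq2)
          also have "\<dots> \<le> norm (w t - wm m t) * R" using elim by (intro mult_left_mono) auto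
          finally show ?case by (simp add: mult.commute)
        qed
      qed (use iw in auto)
      also have "\<dots> < e / 4" using m by simp
      finally show ?thesis .
    qed
    obtain N where N: "\<And>n. n \<ge> N \<Longrightarrow> \<bar>L2_inner M (wm m) (u (r n)) - L2_inner M (wm m) z\<bar> < e / 4"
      using LIMSEQ_D[OF conv[OF wm[of m]], of "e/4"] e by auto
    have "norm ((LINT t|M. w t \<bullet> u (r n) t) - (LINT t|M. w t \<bullet> z t)) < e" if "n \<ge> N" for n
      using N[OF that] close[OF um uR, of "r n"] close[OF _ zR] e by (simp add: abs_if split: if_splits)
    then show "\<exists>N. \<forall>n\<ge>N. norm ((LINT t|M. w t \<bullet> u (r n) t) - (LINT t|M. w t \<bullet> z t)) < e" by blast
  qed
  then show ?thesis using that[OF r _ zb] by simp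
qed

section \<open>The reduced state equation\<close>

lemma norm_matrix_vector_le:
  fixes A :: "real^'n^'m" and x :: "real^'n"
  shows "norm (A *v x) \<le> norm A * norm x"
proof -
  have "norm (A *v x) = L2_set (\<lambda>i. \<bar>A $ i \<bullet> x\<bar>) UNIV"
    by (simp add: norm_vec_def matrix_mult_dot)
  also have "\<dots> \<le> L2_set (\<lambda>i. norm (A $ i) * norm x) UNIV"
    by (intro L2_set_mono) (auto intro: Cauchy_Schwarz_ineq2)
  also have "\<dots> = norm A * norm x"
    by (simp add: norm_vec_def[of A] L2_set_left_distrib)
  finally show ?thesis .
qed

lemma bounded_bilinear_matrix_vector: "bounded_bilinear (\<lambda>(A :: real^'n^'m) x. A *v x)"
proof
  show "\<exists>K. \<forall>(A :: real^'n^'m) x. norm (A *v x) \<le> norm A * norm x * K"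
    by (intro exI[of _ 1]) (simp add: norm_matrix_vector_le)
qed (simp_all add: matrix_vector_right_distrib matrix_vector_mult_add_rdistrib scaleR_matrix_vector_assoc matrix_vector_mult_scaleR)

text \<open>Pairing \<open>p v* A\<close> with itself reduces this to the bound for \<open>A\<close>
  applied to a vector. The transposed product is what moves coefficient matrices from the control to
  the test function.\<close>

lemma norm_vector_matrix_le:
  fixes A :: "real^'n^'m" and p :: "real^'m"
  shows "norm (p v* A) \<le> norm A * norm p"
proof (cases "p v* A = 0")
  case False
  have "norm (p v* A) * norm (p v* A) = (p v* A) \<bullet> (p v* A)" by (simp add: dot_square_norm power2_eq_square)
  also have "\<dots> = p \<bullet> (A *v (p v* A))" by (rule dot_lmul_matrix)
  also have "\<dots> \<le> norm p * norm (A *v (p v* A))" by (rule norm_cauchy_schwarz)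
  also have "\<dots> \<le> norm p * (norm A * norm (p v* A))" by (intro mult_left_mono norm_matrix_vector_le) simp
  finally have "norm (p v* A) * norm (p v* A) \<le> (norm A * norm p) * norm (p v* A)" by (simp add: mult_ac)
  then show ?thesis using False by (simp add: mult_le_cancel_right)
qed simp

lemma bounded_bilinear_vector_matrix: "bounded_bilinear (\<lambda>p (A :: real^'n^'m). p v* A)"
proof
  show "\<exists>K. \<forall>p (A :: real^'n^'m). norm (p v* A) \<le> norm p * norm A * K"
    by (intro exI[of _ 1] allI) (metis norm_vector_matrix_le mult.commute mult_1_right)
qed (simp_all add: vec_eq_iff vector_matrix_mult_def sum.distrib sum_distrib_left algebra_simps)

lemma borel_measurable_matrix_vector [measurable (raw)]:
  assumes "A \<in> borel_measurable M" "x \<in> borel_measurable M"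
  shows "(\<lambda>t. (A t :: real^'n^'m) *v x t) \<in> borel_measurable M"
  by (rule borel_measurable_continuous_Pair[OF assms])
     (intro bounded_bilinear.continuous_on[OF bounded_bilinear_matrix_vector] continuous_intros)

lemma borel_measurable_vector_matrix [measurable (raw)]:
  assumes "A \<in> borel_measurable M" "x \<in> borel_measurable M"
  shows "(\<lambda>t. x t v* (A t :: real^'n^'m)) \<in> borel_measurable M"
  by (rule borel_measurable_continuous_Pair[OF assms(2,1)])
     (intro bounded_bilinear.continuous_on[OF bounded_bilinear_vector_matrix] continuous_intros)

text \<open>Convexity of the square, used twice. Absolute values are summed so that the result
  dominates each summand, which allows several bounds to be merged into one.\<close>

lemma Lp4_abs_add:
  fixes \<alpha> \<beta> :: "real \<Rightarrow> real"
  assumes "\<alpha> \<in> Lp 4 a b" "\<beta> \<in> Lp 4 a b"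
  shows "(\<lambda>t. \<bar>\<alpha> t\<bar> + \<bar>\<beta> t\<bar>) \<in> Lp 4 a b"
proof -
  have m: "\<alpha> \<in> borel_measurable (lebesgue_on {a..b})" "\<beta> \<in> borel_measurable (lebesgue_on {a..b})"
    using assms by (auto simp: Lp_def)
  have sq: "(p + q)^4 \<le> 8 * (p^4 + q^4)" for p q :: real
  proof -
    have s: "(p + q)\<^sup>2 \<le> 2 * (p\<^sup>2 + q\<^sup>2)" for p q :: real
      using sum_squares_bound[of p q] by (simp add: power2_eq_square algebra_simps)
    have "(p + q)^4 = ((p + q)\<^sup>2)\<^sup>2" by simp
    also have "\<dots> \<le> (2 * (p\<^sup>2 + q\<^sup>2))\<^sup>2" by (rule power_mono[OF s]) simp
    also have "\<dots> = 4 * (p\<^sup>2 + q\<^sup>2)\<^sup>2" by (simp only: power_mult_distrib) simp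
    also have "\<dots> \<le> 4 * (2 * ((p\<^sup>2)\<^sup>2 + (q\<^sup>2)\<^sup>2))" by (intro mult_left_mono s) simp
    finally show ?thesis by simp
  qed
  have "integrable (lebesgue_on {a..b}) (\<lambda>t. norm (\<bar>\<alpha> t\<bar> + \<bar>\<beta> t\<bar>) ^ 4)"
  proof (rule integrable_bounded_AE[where k = "\<lambda>t. 8 * (norm (\<alpha> t) ^ 4 + norm (\<beta> t) ^ 4)"])
    show "AE t in lebesgue_on {a..b}. norm (norm (\<bar>\<alpha> t\<bar> + \<bar>\<beta> t\<bar>) ^ 4) \<le> 8 * (norm (\<alpha> t) ^ 4 + norm (\<beta> t) ^ 4)"
    proof (rule AE_I2)
      show "norm (norm (\<bar>\<alpha> t\<bar> + \<bar>\<beta> t\<bar>) ^ 4) \<le> 8 * (norm (\<alpha> t) ^ 4 + norm (\<beta> t) ^ 4)" for t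
        using sq[of "\<bar>\<alpha> t\<bar>" "\<bar>\<beta> t\<bar>"] by simp
    qed
  qed (use assms m in \<open>auto simp: Lp_def\<close>)
  then show ?thesis using m by (auto simp: Lp_def)
qed

lemma Lp_const: "(\<lambda>t. c) \<in> Lp p a b"
  by (simp add: Lp_def)

lemma abs_le_sum_list:
  fixes hs :: "('t \<Rightarrow> real) list"
  assumes "h \<in> set hs"
  shows "\<bar>h t\<bar> \<le> (\<Sum>h\<leftarrow>hs. \<bar>h t\<bar>)"
  using assms
proof (induction hs)
  case (Cons h' hs)
  have "0 \<le> (\<Sum>h\<leftarrow>hs. \<bar>h t\<bar>)" by (rule sum_list_nonneg) auto
  then show ?case using Cons by fastforce
qed simp

lemma Lp4_abs_sum_list:
  fixes hs :: "(real \<Rightarrow> real) list"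
  assumes "\<And>h. h \<in> set hs \<Longrightarrow> h \<in> Lp 4 a b"
  shows "(\<lambda>t. \<Sum>h\<leftarrow>hs. \<bar>h t\<bar>) \<in> Lp 4 a b"
  using assms
proof (induction hs)
  case Nil
  then show ?case by (simp add: Lp_const)
next
  case (Cons h hs)
  have nn: "0 \<le> (\<Sum>h\<leftarrow>hs. \<bar>h t\<bar>)" for t by (rule sum_list_nonneg) auto
  have "(\<lambda>t. \<bar>h t\<bar> + \<bar>\<Sum>h\<leftarrow>hs. \<bar>h t\<bar>\<bar>) \<in> Lp 4 a b" using Cons by (intro Lp4_abs_add) auto
  then show ?case using nn by simp
qed

lemma Lp4_integrable_powers:
  fixes \<kappa> :: "real \<Rightarrow> real"
  assumes "\<kappa> \<in> Lp 4 a b"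
  shows "integrable (lebesgue_on {a..b}) (\<lambda>t. \<kappa> t ^ 4)" "integrable (lebesgue_on {a..b}) (\<lambda>t. (\<kappa> t)\<^sup>2)"
    "integrable (lebesgue_on {a..b}) \<kappa>" "\<kappa> \<in> borel_measurable (lebesgue_on {a..b})"
proof -
  show m: "\<kappa> \<in> borel_measurable (lebesgue_on {a..b})" using assms by (auto simp: Lp_def)
  show i4: "integrable (lebesgue_on {a..b}) (\<lambda>t. \<kappa> t ^ 4)" using assms by (simp add: Lp_def)
  have le: "p\<^sup>2 \<le> 1 + p ^ 4" for p :: real
  proof -
    have "2 * p\<^sup>2 \<le> p ^ 4 + 1" using sum_squares_bound[of "p\<^sup>2" 1] by simp
    moreover have "0 \<le> p ^ 4" by simp
    ultimately show ?thesis by linarith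
  qed
  show i2: "integrable (lebesgue_on {a..b}) (\<lambda>t. (\<kappa> t)\<^sup>2)"
    by (rule integrable_bounded_AE[where k = "\<lambda>t. 1 + \<kappa> t ^ 4"]) (use m i4 le in auto)
  have le': "\<bar>p\<bar> \<le> 1 + p\<^sup>2" for p :: real
    using sum_squares_bound[of "\<bar>p\<bar>" 1] by simp
  show "integrable (lebesgue_on {a..b}) \<kappa>"
    by (rule integrable_bounded_AE[where k = "\<lambda>t. 1 + (\<kappa> t)\<^sup>2"]) (use m i2 le' in auto)
qed

section \<open>Setting and local bounds of the reduced right-hand side\<close>

locale dae =
  fixes a b :: real and lo hi :: "real^'nu"
    and f :: "real \<Rightarrow> real^'nx \<Rightarrow> real^'ny \<Rightarrow> real^'nu \<Rightarrow> real^'nx"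
    and g :: "real \<Rightarrow> real^'nx \<Rightarrow> real^'ny \<Rightarrow> real^'nu \<Rightarrow> real^'ny"
    and Dx :: "(real^'nx) set" and Dy :: "(real^'ny) set" and x0 :: "real^'nx"
    and f1 :: "real \<Rightarrow> real^'nx \<Rightarrow> real^'ny^'nx" and f2 :: "real \<Rightarrow> real^'nx \<Rightarrow> real^'nu^'nx"
    and f3 :: "real \<Rightarrow> real^'nx \<Rightarrow> real^'nx"
    and y1 :: "real \<Rightarrow> real^'nx \<Rightarrow> real^'nu^'ny" and y2 :: "real \<Rightarrow> real^'nx \<Rightarrow> real^'ny"
  assumes ab: "a < b" and Dy: "Dy \<noteq> {}"
    and f_affine: "\<And>t x y u. t \<in> {a..b} \<Longrightarrow> x \<in> Dx \<Longrightarrow> y \<in> Dy \<Longrightarrow> u \<in> {lo..hi} \<Longrightarrow>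
        f t x y u = f1 t x *v y + f2 t x *v u + f3 t x"
    and f_measurable: "\<And>x. x \<in> Dx \<Longrightarrow> (\<lambda>t. f1 t x) \<in> borel_measurable (lebesgue_on {a..b})"
      "\<And>x. x \<in> Dx \<Longrightarrow> (\<lambda>t. f2 t x) \<in> borel_measurable (lebesgue_on {a..b})"
      "\<And>x. x \<in> Dx \<Longrightarrow> (\<lambda>t. f3 t x) \<in> borel_measurable (lebesgue_on {a..b})"
    and f_continuous: "AE t in lebesgue_on {a..b}. continuous_on Dx (f1 t) \<and> continuous_on Dx (f2 t) \<and> continuous_on Dx (f3 t)"
    and f_Lipschitz: "\<And>z0. z0 \<in> Dx \<times> Dy \<Longrightarrow> \<exists>\<rho>>0. \<exists>\<alpha>1\<in>Lp 4 a b. \<exists>\<alpha>2\<in>Lp 4 a b. ball z0 \<rho> \<subseteq> Dx \<times> Dy \<and>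
           (AE t in lebesgue_on {a..b}. \<forall>z\<in>ball z0 \<rho>. \<forall>w\<in>ball z0 \<rho>. \<forall>u\<in>{lo..hi}.
              norm (f t (fst z) (snd z) u - f t (fst w) (snd w) u)
                \<le> (\<alpha>1 t * norm u + \<alpha>2 t) * norm (z - w))"
    and f_bounded: "\<And>xc. xc \<in> Dx \<Longrightarrow> \<exists>\<rho>>0. \<exists>\<iota>1\<in>Lp 4 a b. \<exists>\<iota>2\<in>Lp 4 a b. \<exists>\<iota>3\<in>Lp 4 a b. ball xc \<rho> \<subseteq> Dx \<and>
           (AE t in lebesgue_on {a..b}. \<forall>x\<in>ball xc \<rho>.
              norm (f1 t x) \<le> \<iota>1 t \<and> norm (f2 t x) \<le> \<iota>2 t \<and> norm (f3 t x) \<le> \<iota>3 t)"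
    and y_root: "AE t in lebesgue_on {a..b}. \<forall>x\<in>Dx. \<forall>u\<in>{lo..hi}. g t x (y1 t x *v u + y2 t x) u = 0 \<and> y1 t x *v u + y2 t x \<in> Dy"
    and y_measurable: "\<And>x. x \<in> Dx \<Longrightarrow> (\<lambda>t. y1 t x) \<in> borel_measurable (lebesgue_on {a..b})"
      "\<And>x. x \<in> Dx \<Longrightarrow> (\<lambda>t. y2 t x) \<in> borel_measurable (lebesgue_on {a..b})"
    and y_continuous: "AE t in lebesgue_on {a..b}. continuous_on Dx (y1 t) \<and> continuous_on Dx (y2 t)"
    and y_Lipschitz: "\<And>xc. xc \<in> Dx \<Longrightarrow> \<exists>\<rho>>0. \<exists>\<gamma>1\<in>Lp 4 a b. \<exists>\<gamma>2\<in>Lp 4 a b. ball xc \<rho> \<subseteq> Dx \<and>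
           (AE t in lebesgue_on {a..b}. \<forall>x\<in>ball xc \<rho>. \<forall>w\<in>ball xc \<rho>.
              norm (y1 t x - y1 t w) \<le> \<gamma>1 t * norm (x - w) \<and>
              norm (y2 t x - y2 t w) \<le> \<gamma>2 t * norm (x - w))"
    and y_bounded: "\<And>xc. xc \<in> Dx \<Longrightarrow> \<exists>\<rho>>0. \<exists>\<kappa>1\<in>Lp 4 a b. \<exists>\<kappa>2\<in>Lp 4 a b. ball xc \<rho> \<subseteq> Dx \<and>
           (AE t in lebesgue_on {a..b}. \<forall>x\<in>ball xc \<rho>. norm (y1 t x) \<le> \<kappa>1 t \<and> norm (y2 t x) \<le> \<kappa>2 t)"
    and solution_exists: "\<And>u. u \<in> admissible_controls a b lo hi \<Longrightarrow> \<exists>x y. state_solution f g a b x0 u x y"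
    and solution_unique: "\<And>u x y x' y'. u \<in> admissible_controls a b lo hi \<Longrightarrow> state_solution f g a b x0 u x y \<Longrightarrow>
       state_solution f g a b x0 u x' y' \<Longrightarrow> (\<forall>t\<in>{a..b}. x t = x' t) \<and> (AE t in lebesgue_on {a..b}. y t = y' t)"
    and solution_in_Dx: "\<And>u x y t. u \<in> admissible_controls a b lo hi \<Longrightarrow> state_solution f g a b x0 u x y \<Longrightarrow> t \<in> {a..b} \<Longrightarrow> x t \<in> Dx"
begin

definition Y :: "real \<Rightarrow> real^'nx \<Rightarrow> real^'nu \<Rightarrow> real^'ny" where
  "Y t x u = y1 t x *v u + y2 t x"

definition F :: "real \<Rightarrow> real^'nx \<Rightarrow> real^'nu \<Rightarrow> real^'nx" where
  "F t x u = f1 t x *v Y t x u + f2 t x *v u + f3 t x"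

text \<open>Everything at a single time \<open>t\<close>, so that one almost-everywhere quantifier
  can be put in front. The number \<open>k\<close> dominates coefficient matrices; the root is of
  order \<open>k\<close> and \<open>F\<close>, containing the product of \<open>f1\<close> and
  \<open>y1\<close>, of order \<open>k\<^sup>2\<close>. The constant \<open>C\<close> collects what
  depends on the control bound and on the local geometry.\<close>

definition well_bounded :: "real \<Rightarrow> real \<Rightarrow> real \<Rightarrow> (real^'nx) set \<Rightarrow> bool" where
  "well_bounded C k t S \<longleftrightarrow> (\<forall>x\<in>S. norm (f1 t x) \<le> k \<and> norm (f2 t x) \<le> k \<and> norm (y1 t x) \<le> k \<and>
     (\<forall>u\<in>{lo..hi}. norm (Y t x u) \<le> C * k \<and> norm (F t x u) \<le> C * k\<^sup>2 \<and>
       (\<forall>w\<in>S. norm (F t x u - F t w u) \<le> C * k\<^sup>2 * norm (x - w) \<and> norm (Y t x u - Y t w u) \<le> C * k * norm (x - w))))"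

lemma well_bounded_mono:
  assumes "well_bounded C k t S" "T \<subseteq> S" "C \<le> C'" "0 \<le> C" "k \<le> k'" "0 \<le> k"
  shows "well_bounded C' k' t T"
proof -
  have c: "C * k \<le> C' * k'" "C * k\<^sup>2 \<le> C' * k'\<^sup>2" using assms by (auto intro!: mult_mono power_mono)
  have "C * k\<^sup>2 * norm (x - w) \<le> C' * k'\<^sup>2 * norm (x - w)" "C * k * norm (x - w) \<le> C' * k' * norm (x - w)" for x w :: "real^'nx"
    using c by (auto intro: mult_right_mono)
  then show ?thesis
    using assms(1,2,5) c unfolding well_bounded_def by (meson order_trans subsetD)
qed

lemma F_root:
  "AE t in lebesgue_on {a..b}. \<forall>x\<in>Dx. \<forall>u\<in>{lo..hi}. g t x (Y t x u) u = 0 \<and> f t x (Y t x u) u = F t x u"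
  using y_root AE_space
proof eventually_elim
  case (elim t)
  show ?case
  proof (intro ballI)
    fix x u assume "x \<in> Dx" "u \<in> {lo..hi}"
    then show "g t x (Y t x u) u = 0 \<and> f t x (Y t x u) u = F t x u"
      using elim f_affine[of t x "Y t x u" u] by (auto simp: Y_def F_def)
  qed
qed

lemma superposition:
  assumes "continuous_on {a..b} z" "z ` {a..b} \<subseteq> Dx"
  shows "(\<lambda>t. f1 t (z t)) \<in> borel_measurable (lebesgue_on {a..b})"
    "(\<lambda>t. f2 t (z t)) \<in> borel_measurable (lebesgue_on {a..b})"
    "(\<lambda>t. f3 t (z t)) \<in> borel_measurable (lebesgue_on {a..b})"
    "(\<lambda>t. y1 t (z t)) \<in> borel_measurable (lebesgue_on {a..b})"
    "(\<lambda>t. y2 t (z t)) \<in> borel_measurable (lebesgue_on {a..b})"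
  using ab f_continuous y_continuous
  by (auto intro!: superposition_measurable[OF _ assms] f_measurable y_measurable elim: eventually_mono)

lemma YF_measurable:
  assumes z: "continuous_on {a..b} z" "z ` {a..b} \<subseteq> Dx" and u[measurable]: "u \<in> borel_measurable (lebesgue_on {a..b})"
  shows "(\<lambda>t. Y t (z t) (u t)) \<in> borel_measurable (lebesgue_on {a..b})"
    "(\<lambda>t. F t (z t) (u t)) \<in> borel_measurable (lebesgue_on {a..b})"
proof -
  note [measurable] = superposition[OF z]
  show "(\<lambda>t. Y t (z t) (u t)) \<in> borel_measurable (lebesgue_on {a..b})"
    "(\<lambda>t. F t (z t) (u t)) \<in> borel_measurable (lebesgue_on {a..b})" unfolding Y_def F_def by measurable
qed

text \<open>As \<open>f\<close> is affine in \<open>y\<close> and \<open>Dy\<close> is open, mixed second differences of \<open>f\<close> recover the matrix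
  \<open>f1\<close>; so the local Lipschitz condition on \<open>f\<close> passes to \<open>f1\<close>, and hence to the reduced right-hand
  side, whose algebraic argument \<open>Y\<close> is not bounded uniformly in time.\<close>

lemma f_coefficients_Lipschitz:
  assumes sub: "ball (xc, yc) \<rho> \<subseteq> Dx \<times> Dy" and \<rho>: "\<rho> > 0" and t: "t \<in> {a..b}"
    and L: "\<And>z w. z \<in> ball (xc, yc) \<rho> \<Longrightarrow> w \<in> ball (xc, yc) \<rho> \<Longrightarrow>
              norm (f t (fst z) (snd z) u - f t (fst w) (snd w) u) \<le> \<beta> * norm (z - w)"
    and u: "u \<in> {lo..hi}" and x: "x \<in> ball xc (\<rho> / 2)" "x' \<in> ball xc (\<rho> / 2)"
  shows "norm ((f1 t x - f1 t x') *v v) \<le> 8 / \<rho> * \<beta> * norm (x - x') * norm v"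
    and "norm ((f2 t x *v u + f3 t x) - (f2 t x' *v u + f3 t x')) \<le> (1 + 8 / \<rho> * norm yc) * \<beta> * norm (x - x')"
proof -
  \<comment> \<open>The distance in the product space is at most the sum of the two distances, which
    is why the radius is halved.\<close>
  have inb: "(p, q) \<in> ball (xc, yc) \<rho>" if "p \<in> ball xc (\<rho> / 2)" "q \<in> ball yc (\<rho> / 2)" for p q
  proof -
    have "dist (xc, yc) (p, q) \<le> dist xc p + dist yc q" unfolding dist_Pair_Pair by (rule sqrt_sum_squares_le_sum) auto
    then show ?thesis using that by simp
  qed
  have yc: "yc \<in> ball yc (\<rho> / 2)" using \<rho> by simp
  have diff: "norm (f t x q u - f t x' q u) \<le> \<beta> * norm (x - x')" if "q \<in> ball yc (\<rho> / 2)" for q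
    using L[OF inb[OF x(1) that] inb[OF x(2) that]] by (simp add: norm_Pair)
  have f: "f t p q u = f1 t p *v q + f2 t p *v u + f3 t p" if "p \<in> ball xc (\<rho> / 2)" "q \<in> ball yc (\<rho> / 2)" for p q
    using f_affine[OF t _ _ u] inb[OF that] sub by blast
  show 1: "norm ((f1 t x - f1 t x') *v v) \<le> 8 / \<rho> * \<beta> * norm (x - x') * norm v" for v
  proof (cases "v = 0")
    case False
    \<comment> \<open>\<open>yc\<close> is moved by \<rho>/4 in the direction of \<open>v\<close>,
      which stays within the ball of radius \<rho>/2. Dividing two Lipschitz bounds by this
      displacement gives the factor 8/\<rho>.\<close>
    define q where "q = yc + (\<rho> / (4 * norm v)) *\<^sub>R v"
    have q: "q \<in> ball yc (\<rho> / 2)" using \<rho> False by (simp add: q_def dist_norm)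
    have "(\<rho> / (4 * norm v)) *\<^sub>R ((f1 t x - f1 t x') *v v) = (f1 t x - f1 t x') *v (q - yc)"
      by (simp add: q_def matrix_vector_mult_scaleR)
    also have "\<dots> = (f t x q u - f t x' q u) - (f t x yc u - f t x' yc u)"
      using f[OF x(1) q] f[OF x(2) q] f[OF x(1) yc] f[OF x(2) yc]
      by (simp add: matrix_vector_mult_diff_distrib matrix_vector_mult_diff_rdistrib)
    finally have "norm ((\<rho> / (4 * norm v)) *\<^sub>R ((f1 t x - f1 t x') *v v)) \<le> \<beta> * norm (x - x') + \<beta> * norm (x - x')"
      using diff[OF q] diff[OF yc] norm_triangle_ineq4[of "f t x q u - f t x' q u" "f t x yc u - f t x' yc u"] by simp
    then have "\<rho> / (4 * norm v) * norm ((f1 t x - f1 t x') *v v) \<le> 2 * \<beta> * norm (x - x')" using \<rho> by simp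
    then show ?thesis using \<rho> False by (simp add: field_simps)
  qed simp
  have "(f2 t x *v u + f3 t x) - (f2 t x' *v u + f3 t x') = (f t x yc u - f t x' yc u) - (f1 t x - f1 t x') *v yc"
    using f[OF x(1) yc] f[OF x(2) yc] by (simp add: matrix_vector_mult_diff_rdistrib)
  then have "norm ((f2 t x *v u + f3 t x) - (f2 t x' *v u + f3 t x')) \<le> norm (f t x yc u - f t x' yc u) + norm ((f1 t x - f1 t x') *v yc)"
    by (metis norm_triangle_ineq4)
  also have "\<dots> \<le> \<beta> * norm (x - x') + 8 / \<rho> * \<beta> * norm (x - x') * norm yc" using diff[OF yc] 1[of yc] by simp
  also have "\<dots> = (1 + 8 / \<rho> * norm yc) * \<beta> * norm (x - x')" by (simp add: algebra_simps)
  finally show "norm ((f2 t x *v u + f3 t x) - (f2 t x' *v u + f3 t x')) \<le> (1 + 8 / \<rho> * norm yc) * \<beta> * norm (x - x')" .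
qed

text \<open>The Lipschitz condition is used near \<open>(xc, yc)\<close> for one fixed
  \<open>yc\<close> only. It controls the coefficients of \<open>f\<close>, after which the root may
  be inserted however far it is from \<open>yc\<close>; the size of the root, of order
  \<open>k\<close>, is paid for by the second factor \<open>k\<close> in the Lipschitz constant of
  \<open>F\<close>.\<close>

lemma local_bounds:
  assumes xc: "xc \<in> Dx"
  shows "\<exists>\<rho> \<kappa> C. \<rho> > 0 \<and> \<kappa> \<in> Lp 4 a b \<and> 0 \<le> C \<and> (\<forall>t. 0 \<le> \<kappa> t) \<and> ball xc \<rho> \<subseteq> Dx \<and>
     (AE t in lebesgue_on {a..b}. well_bounded C (\<kappa> t) t (ball xc \<rho>))"
proof -
  obtain yc where yc: "yc \<in> Dy" using Dy by blast
  obtain R where R: "\<And>u. u \<in> {lo..hi} \<Longrightarrow> norm u \<le> R" "R \<ge> 0"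
    using bounded_cbox[of lo hi] unfolding bounded_pos interval_cbox_cart by (meson less_imp_le)
  obtain \<rho>1 \<alpha>1 \<alpha>2 where \<alpha>: "\<rho>1 > 0" "\<alpha>1 \<in> Lp 4 a b" "\<alpha>2 \<in> Lp 4 a b" "ball (xc, yc) \<rho>1 \<subseteq> Dx \<times> Dy"
    "AE t in lebesgue_on {a..b}. \<forall>z\<in>ball (xc, yc) \<rho>1. \<forall>w\<in>ball (xc, yc) \<rho>1. \<forall>u\<in>{lo..hi}.
              norm (f t (fst z) (snd z) u - f t (fst w) (snd w) u) \<le> (\<alpha>1 t * norm u + \<alpha>2 t) * norm (z - w)"
    using f_Lipschitz[of "(xc, yc)"] xc yc by blast
  obtain \<rho>2 \<iota>1 \<iota>2 \<iota>3 where \<iota>: "\<rho>2 > 0" "\<iota>1 \<in> Lp 4 a b" "\<iota>2 \<in> Lp 4 a b" "\<iota>3 \<in> Lp 4 a b" "ball xc \<rho>2 \<subseteq> Dx"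
    "AE t in lebesgue_on {a..b}. \<forall>x\<in>ball xc \<rho>2. norm (f1 t x) \<le> \<iota>1 t \<and> norm (f2 t x) \<le> \<iota>2 t \<and> norm (f3 t x) \<le> \<iota>3 t"
    using f_bounded[OF xc] by blast
  obtain \<rho>3 \<gamma>1 \<gamma>2 where \<gamma>: "\<rho>3 > 0" "\<gamma>1 \<in> Lp 4 a b" "\<gamma>2 \<in> Lp 4 a b"
    "AE t in lebesgue_on {a..b}. \<forall>x\<in>ball xc \<rho>3. \<forall>w\<in>ball xc \<rho>3.
       norm (y1 t x - y1 t w) \<le> \<gamma>1 t * norm (x - w) \<and> norm (y2 t x - y2 t w) \<le> \<gamma>2 t * norm (x - w)"
    using y_Lipschitz[OF xc] by blast
  obtain \<rho>4 \<kappa>1 \<kappa>2 where \<kappa>: "\<rho>4 > 0" "\<kappa>1 \<in> Lp 4 a b" "\<kappa>2 \<in> Lp 4 a b"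
    "AE t in lebesgue_on {a..b}. \<forall>x\<in>ball xc \<rho>4. norm (y1 t x) \<le> \<kappa>1 t \<and> norm (y2 t x) \<le> \<kappa>2 t"
    using y_bounded[OF xc] by blast
  define \<rho> where "\<rho> = Min {\<rho>1 / 2, \<rho>2, \<rho>3, \<rho>4}"
  have \<rho>: "\<rho> > 0" "\<rho> \<le> \<rho>1 / 2" "\<rho> \<le> \<rho>2" "\<rho> \<le> \<rho>3" "\<rho> \<le> \<rho>4" using \<alpha>(1) \<iota>(1) \<gamma>(1) \<kappa>(1) by (auto simp: \<rho>_def)
  \<comment> \<open>The constant 1 in the list makes \<open>k \<ge> 1\<close>, so that terms linear
    in \<open>k\<close> can be absorbed into \<open>k\<^sup>2\<close>.\<close>
  define hs where "hs = [(\<lambda>_. 1), \<alpha>1, \<alpha>2, \<iota>1, \<iota>2, \<iota>3, \<gamma>1, \<gamma>2, \<kappa>1, \<kappa>2]"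
  define k where "k t = (\<Sum>h\<leftarrow>hs. \<bar>h t\<bar>)" for t
  have "h \<in> Lp 4 a b" if "h \<in> set hs" for h
    using that \<alpha>(2,3) \<iota>(2-4) \<gamma>(2,3) \<kappa>(2,3) Lp_const[of 1 4 a b] by (auto simp: hs_def)
  then have kL: "k \<in> Lp 4 a b" unfolding k_def by (rule Lp4_abs_sum_list)
  have k: "1 \<le> k t" "\<bar>\<alpha>1 t\<bar> \<le> k t" "\<bar>\<alpha>2 t\<bar> \<le> k t" "\<iota>1 t \<le> k t" "\<iota>2 t \<le> k t" "\<iota>3 t \<le> k t" "\<gamma>1 t \<le> k t" "\<gamma>2 t \<le> k t" "\<kappa>1 t \<le> k t" "\<kappa>2 t \<le> k t" for t
  proof -
    have le: "\<bar>h t\<bar> \<le> k t" if "h \<in> set hs" for h unfolding k_def using that by (rule abs_le_sum_list)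
    show "1 \<le> k t" using le[of "\<lambda>_. 1"] by (simp add: hs_def)
    have le': "h t \<le> k t" if "h \<in> set hs" for h using le[OF that] by linarith
    show "\<bar>\<alpha>1 t\<bar> \<le> k t" "\<bar>\<alpha>2 t\<bar> \<le> k t" by (rule le; simp add: hs_def)+
    show "\<iota>1 t \<le> k t" "\<iota>2 t \<le> k t" "\<iota>3 t \<le> k t" "\<gamma>1 t \<le> k t" "\<gamma>2 t \<le> k t" "\<kappa>1 t \<le> k t" "\<kappa>2 t \<le> k t"
      by (rule le'; simp add: hs_def)+
  qed
  \<comment> \<open>\<open>D\<close> and \<open>E\<close> are the constants of
    \<open>f_coefficients_Lipschitz\<close> for radius \<rho>1. In \<open>C\<close>, the terms with
    \<open>D\<close> and \<open>E\<close> and one \<open>R + 1\<close> come from the difference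
    \<open>Fd\<close>; the other \<open>R + 1\<close> makes \<open>C\<close> large enough for the
    bound \<open>Fb\<close>.\<close>
  define D where "D = 8 / \<rho>1"
  define E where "E = 1 + D * norm yc"
  have DE: "0 \<le> D" "0 \<le> E" using \<alpha>(1) by (auto simp: D_def E_def)
  define C where "C = D * (R + 1) * (R + 1) + (R + 1) + (R + 1) + E * (R + 1)"
  have C1: "R + 1 \<le> C" "2 * (R + 1) \<le> C" "0 \<le> C" using R(2) DE by (auto simp: C_def)
  have "AE t in lebesgue_on {a..b}. well_bounded C (k t) t (ball xc \<rho>)"
    using \<alpha>(5) \<iota>(6) \<gamma>(4) \<kappa>(4) AE_space
  proof eventually_elim
    case (elim t)
    have t: "t \<in> {a..b}" using elim(5) by simp
    have kk: "k t \<le> (k t)\<^sup>2" using k(1)[of t] by (simp add: power2_eq_square)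
    have b2: "x \<in> ball xc (\<rho>1 / 2)" "x \<in> ball xc \<rho>2" "x \<in> ball xc \<rho>3" "x \<in> ball xc \<rho>4" if "x \<in> ball xc \<rho>" for x
      using that \<rho> by auto
    have nb: "norm (f1 t x) \<le> k t" "norm (f2 t x) \<le> k t" "norm (f3 t x) \<le> k t" "norm (y1 t x) \<le> k t" "norm (y2 t x) \<le> k t"
      if "x \<in> ball xc \<rho>" for x
      using elim(2)[rule_format, OF b2(2)[OF that]] elim(4)[rule_format, OF b2(4)[OF that]] k[of t] by linarith+
    have Yb: "norm (Y t x u) \<le> k t * (R + 1)" if x: "x \<in> ball xc \<rho>" and u: "u \<in> {lo..hi}" for x u
    proof -
      have "norm (Y t x u) \<le> norm (y1 t x) * norm u + norm (y2 t x)"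
        unfolding Y_def by (rule norm_triangle_le[OF add_mono[OF norm_matrix_vector_le order_refl]])
      also have "\<dots> \<le> k t * R + k t" using nb[OF x] R(1)[OF u] k(1)[of t] by (intro add_mono mult_mono) auto
      finally show ?thesis by (simp add: algebra_simps)
    qed
    have Yd: "norm (Y t x u - Y t w u) \<le> k t * (R + 1) * norm (x - w)" if x: "x \<in> ball xc \<rho>" "w \<in> ball xc \<rho>" and u: "u \<in> {lo..hi}" for x w u
    proof -
      have g: "norm (y1 t x - y1 t w) \<le> k t * norm (x - w)" "norm (y2 t x - y2 t w) \<le> k t * norm (x - w)"
        using elim(3)[rule_format, OF b2(3)[OF x(1)] b2(3)[OF x(2)]]
          mult_right_mono[OF k(7)[of t] norm_ge_zero[of "x - w"]] mult_right_mono[OF k(8)[of t] norm_ge_zero[of "x - w"]]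
        by (blast intro: order_trans)+
      have "Y t x u - Y t w u = (y1 t x - y1 t w) *v u + (y2 t x - y2 t w)"
        by (simp add: Y_def matrix_vector_mult_diff_rdistrib)
      then have "norm (Y t x u - Y t w u) \<le> norm (y1 t x - y1 t w) * norm u + norm (y2 t x - y2 t w)"
        by (simp only:) (rule norm_triangle_le[OF add_mono[OF norm_matrix_vector_le order_refl]])
      also have "\<dots> \<le> (k t * norm (x - w)) * R + k t * norm (x - w)"
        using g R(1)[OF u] k(1)[of t] by (intro add_mono mult_mono) auto
      finally show ?thesis by (simp add: algebra_simps)
    qed
    have Fb: "norm (F t x u) \<le> 2 * (R + 1) * (k t)\<^sup>2" if x: "x \<in> ball xc \<rho>" and u: "u \<in> {lo..hi}" for x u
    proof -
      have "norm (F t x u) \<le> norm (f1 t x) * norm (Y t x u) + norm (f2 t x) * norm u + norm (f3 t x)"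
        unfolding F_def
        by (intro norm_triangle_le add_mono norm_matrix_vector_le order_refl)
      also have "\<dots> \<le> k t * (k t * (R + 1)) + k t * R + k t"
        using nb[OF x] Yb[OF x u] R(1)[OF u] R(2) k(1)[of t] by (intro add_mono mult_mono) auto
      also have "\<dots> = (R + 1) * (k t)\<^sup>2 + (R + 1) * k t" by (simp add: algebra_simps power2_eq_square)
      also have "\<dots> \<le> (R + 1) * (k t)\<^sup>2 + (R + 1) * (k t)\<^sup>2" using kk R(2) by (intro add_left_mono mult_left_mono) auto
      finally show ?thesis by (simp add: algebra_simps)
    qed
    have Fd: "norm (F t x u - F t w u) \<le> C * (k t)\<^sup>2 * norm (x - w)" if x: "x \<in> ball xc \<rho>" "w \<in> ball xc \<rho>" and u: "u \<in> {lo..hi}" for x w u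
    proof -
      define \<beta> where "\<beta> = \<alpha>1 t * norm u + \<alpha>2 t"
      have "\<alpha>1 t * norm u \<le> k t * R" using k(2)[of t] R(1)[OF u] k(1)[of t] by (intro mult_mono) auto
      then have \<beta>: "\<beta> \<le> k t * (R + 1)" using k(3)[of t] by (simp add: \<beta>_def algebra_simps)
      have L: "norm (f t (fst z) (snd z) u - f t (fst w) (snd w) u) \<le> k t * (R + 1) * norm (z - w)"
        if "z \<in> ball (xc, yc) \<rho>1" "w \<in> ball (xc, yc) \<rho>1" for z w
        using elim(1)[rule_format, OF that u] mult_right_mono[OF \<beta>, of "norm (z - w)"] by (simp add: \<beta>_def)
      note fl = f_coefficients_Lipschitz[OF \<alpha>(4,1) t L u b2(1)[OF x(1)] b2(1)[OF x(2)], folded D_def, folded E_def]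
      \<comment> \<open>The terms with \<open>f2\<close> and \<open>f3\<close> are kept together: a
        Lipschitz bound is known for their combination at a fixed control, not for each of
        them.\<close>
      have "F t x u - F t w u = (f1 t x - f1 t w) *v Y t x u + f1 t w *v (Y t x u - Y t w u) + ((f2 t x *v u + f3 t x) - (f2 t w *v u + f3 t w))"
        by (simp add: F_def matrix_vector_mult_diff_rdistrib matrix_vector_mult_diff_distrib)
      then have "norm (F t x u - F t w u) \<le> norm ((f1 t x - f1 t w) *v Y t x u) + norm (f1 t w *v (Y t x u - Y t w u)) + norm ((f2 t x *v u + f3 t x) - (f2 t w *v u + f3 t w))"
        by (simp only:) (intro norm_triangle_le add_mono order_refl)
      also have "\<dots> \<le> D * (k t * (R + 1)) * norm (x - w) * (k t * (R + 1)) + k t * (k t * (R + 1) * norm (x - w)) + E * (k t * (R + 1)) * norm (x - w)"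
      proof (intro add_mono)
        show "norm ((f1 t x - f1 t w) *v Y t x u) \<le> D * (k t * (R + 1)) * norm (x - w) * (k t * (R + 1))"
          using Yb[OF x(1) u] DE k(1)[of t] R(2) by (intro order_trans[OF fl(1)] mult_left_mono) auto
        show "norm (f1 t w *v (Y t x u - Y t w u)) \<le> k t * (k t * (R + 1) * norm (x - w))"
          using nb(1)[OF x(2)] Yd[OF x u] k(1)[of t] by (intro order_trans[OF norm_matrix_vector_le] mult_mono) auto
        show "norm ((f2 t x *v u + f3 t x) - (f2 t w *v u + f3 t w)) \<le> E * (k t * (R + 1)) * norm (x - w)" by (rule fl(2))
      qed
      also have "\<dots> = (D * (R + 1) * (R + 1) * (k t)\<^sup>2 + (R + 1) * (k t)\<^sup>2 + E * (R + 1) * k t) * norm (x - w)"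
        by (simp add: algebra_simps power2_eq_square)
      also have "\<dots> \<le> (D * (R + 1) * (R + 1) * (k t)\<^sup>2 + (R + 1) * (k t)\<^sup>2 + E * (R + 1) * (k t)\<^sup>2) * norm (x - w)"
        using kk DE R(2) by (intro mult_right_mono add_left_mono mult_left_mono) auto
      also have "\<dots> = (C - (R + 1)) * (k t)\<^sup>2 * norm (x - w)" by (simp add: C_def algebra_simps)
      also have "\<dots> \<le> C * (k t)\<^sup>2 * norm (x - w)" using R(2) by (intro mult_right_mono) auto
      finally show ?thesis .
    qed
    show ?case unfolding well_bounded_def
    proof (intro ballI conjI)
      fix x assume x: "x \<in> ball xc \<rho>"
      show "norm (f1 t x) \<le> k t" "norm (f2 t x) \<le> k t" "norm (y1 t x) \<le> k t" using nb[OF x] by auto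
      fix u assume u: "u \<in> {lo..hi}"
      have "k t * (R + 1) \<le> k t * C" using C1(1) k(1)[of t] by (intro mult_left_mono) auto
      then have kC: "k t * (R + 1) \<le> C * k t" by (simp only: mult.commute)
      show "norm (Y t x u) \<le> C * k t" using Yb[OF x u] kC by (rule order_trans)
      show "norm (F t x u) \<le> C * (k t)\<^sup>2"
        using Fb[OF x u] mult_right_mono[OF C1(2) zero_le_power2] by (rule order_trans)
      fix w assume w: "w \<in> ball xc \<rho>"
      show "norm (F t x u - F t w u) \<le> C * (k t)\<^sup>2 * norm (x - w)" by (rule Fd[OF x w u])
      have "k t * (R + 1) * norm (x - w) \<le> C * k t * norm (x - w)"
        by (rule mult_right_mono[OF kC norm_ge_zero])
      with Yd[OF x w u] show "norm (Y t x u - Y t w u) \<le> C * k t * norm (x - w)" by (rule order_trans)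
    qed
  qed
  moreover have "ball xc \<rho> \<subseteq> Dx" using \<iota>(5) \<rho>(3) by (meson subset_ball subset_trans)
  ultimately show ?thesis using \<rho>(1) kL C1(3) k(1) by (meson order_trans zero_le_one)
qed

text \<open>Finitely many of the local balls cover \<open>K\<close>, and a Lebesgue number of this
  cover gives one radius for all points. The bounds of finitely many balls can be summed within L^4,
  and finitely many exceptional null sets can be united. Closed balls are produced because the
  cut-off projects onto them.\<close>

lemma compact_tube:
  assumes K: "compact K" "K \<subseteq> Dx"
  obtains r \<kappa> C where "r > 0" "\<kappa> \<in> Lp 4 a b" "0 \<le> C" "\<And>t. 0 \<le> \<kappa> t" "\<And>p. p \<in> K \<Longrightarrow> cball p r \<subseteq> Dx"
    "AE t in lebesgue_on {a..b}. \<forall>p\<in>K. well_bounded C (\<kappa> t) t (cball p r)"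
proof -
  define P where "P xc \<rho> \<kappa> C \<longleftrightarrow> \<rho> > 0 \<and> \<kappa> \<in> Lp 4 a b \<and> 0 \<le> C \<and> (\<forall>t. 0 \<le> \<kappa> t) \<and> ball xc \<rho> \<subseteq> Dx \<and>
     (AE t in lebesgue_on {a..b}. well_bounded C (\<kappa> t) t (ball xc \<rho>))" for xc \<rho> \<kappa> C
  have "\<forall>xc\<in>Dx. \<exists>\<rho> \<kappa> C. P xc \<rho> \<kappa> C" using local_bounds by (simp add: P_def)
  from bchoice[OF this] obtain \<rho> where "\<forall>xc\<in>Dx. \<exists>\<kappa> C. P xc (\<rho> xc) \<kappa> C" ..
  from bchoice[OF this] obtain \<kappa> where "\<forall>xc\<in>Dx. \<exists>C. P xc (\<rho> xc) (\<kappa> xc) C" ..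
  from bchoice[OF this] obtain C where "\<forall>xc\<in>Dx. P xc (\<rho> xc) (\<kappa> xc) (C xc)" ..
  then have P: "P xc (\<rho> xc) (\<kappa> xc) (C xc)" if "xc \<in> Dx" for xc using that by blast
  have L: "\<And>xc. xc \<in> Dx \<Longrightarrow> \<rho> xc > 0" "\<And>xc. xc \<in> Dx \<Longrightarrow> \<kappa> xc \<in> Lp 4 a b" "\<And>xc. xc \<in> Dx \<Longrightarrow> 0 \<le> C xc"
    "\<And>xc t. xc \<in> Dx \<Longrightarrow> 0 \<le> \<kappa> xc t" "\<And>xc. xc \<in> Dx \<Longrightarrow> ball xc (\<rho> xc) \<subseteq> Dx"
    "\<And>xc. xc \<in> Dx \<Longrightarrow> AE t in lebesgue_on {a..b}. well_bounded (C xc) (\<kappa> xc t) t (ball xc (\<rho> xc))"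
    using P by (simp_all add: P_def)
  obtain T where T: "T \<subseteq> K" "finite T" "K \<subseteq> (\<Union>p\<in>T. ball p (\<rho> p))"
  proof (rule compactE_image[OF K(1), of K "\<lambda>p. ball p (\<rho> p)"])
    show "K \<subseteq> (\<Union>p\<in>K. ball p (\<rho> p))" using L(1) K(2) by force
  qed auto
  \<comment> \<open>\<open>e\<close> is a Lebesgue number of the finite cover; half of it leaves
    room for a closed ball.\<close>
  obtain e where e: "e > 0" "\<And>x. x \<in> K \<Longrightarrow> \<exists>G\<in>(\<lambda>p. ball p (\<rho> p)) ` T. ball x e \<subseteq> G"
    by (rule Heine_Borel_lemma[OF K(1) T(3)]) auto
  have TD: "p \<in> Dx" if "p \<in> T" for p using T(1) K(2) that by blast
  define k where "k t = (\<Sum>p\<in>T. \<bar>\<kappa> p t\<bar>)" for t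
  have kL: "k \<in> Lp 4 a b"
    unfolding k_def using T(2) TD
  proof (induction T)
    case empty
    then show ?case by (simp add: Lp_const)
  next
    case (insert p T)
    have "(\<lambda>t. \<bar>\<kappa> p t\<bar> + \<bar>\<Sum>p\<in>T. \<bar>\<kappa> p t\<bar>\<bar>) \<in> Lp 4 a b" using insert L(2) by (intro Lp4_abs_add) auto
    then show ?case using insert by (simp add: abs_of_nonneg sum_nonneg)
  qed
  define c where "c = sum C T"
  have c: "C p \<le> c" if "p \<in> T" for p unfolding c_def using T(2) L(3) TD that by (intro member_le_sum) auto
  have kp: "\<kappa> p t \<le> k t" if "p \<in> T" for p t
    using member_le_sum[OF that, of "\<lambda>p. \<bar>\<kappa> p t\<bar>"] T(2) by (simp add: k_def)
  have cb: "cball x (e / 2) \<subseteq> ball x e" for x using e(1) by auto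
  show thesis
  proof
    show "e / 2 > 0" using e by simp
    show "k \<in> Lp 4 a b" by fact
    show "0 \<le> c" unfolding c_def using L(3) TD by (intro sum_nonneg) auto
    show "0 \<le> k t" for t unfolding k_def by (intro sum_nonneg) auto
    show "cball x (e / 2) \<subseteq> Dx" if "x \<in> K" for x using e(2)[OF that] cb[of x] L(5) TD by blast
    have "AE t in lebesgue_on {a..b}. \<forall>p\<in>T. well_bounded (C p) (\<kappa> p t) t (ball p (\<rho> p))"
      using L(6) TD by (intro AE_finite_allI T(2)) auto
    then show "AE t in lebesgue_on {a..b}. \<forall>x\<in>K. well_bounded c (k t) t (cball x (e / 2))"
    proof eventually_elim
      case (elim t)
      show ?case
      proof
        fix x assume "x \<in> K"
        then obtain p where p: "p \<in> T" "ball x e \<subseteq> ball p (\<rho> p)" using e(2) by blast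
        show "well_bounded c (k t) t (cball x (e / 2))"
        proof (rule well_bounded_mono)
          show "well_bounded (C p) (\<kappa> p t) t (ball p (\<rho> p))" using elim p(1) by blast
          show "cball x (e / 2) \<subseteq> ball p (\<rho> p)" using p(2) cb[of x] by (rule subset_trans[rotated])
        qed (rule c[OF p(1)] kp[OF p(1)] L(3,4)[OF TD[OF p(1)]])+
      qed
    qed
  qed
qed

end

section \<open>Pasting of solutions\<close>

lemma AC_cong:
  fixes x z :: "real \<Rightarrow> 'a::euclidean_space"
  assumes "x \<in> AC a b" "\<And>t. t \<in> {a..b} \<Longrightarrow> z t = x t"
  shows "z \<in> AC a b"
  by (rule ACI_norm_le[OF assms(1,1), of 1]) (use assms(2) in auto)

lemma Lp2_L2: "Lp 2 a b = L2 (lebesgue_on {a..b})"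
  by (simp add: Lp_def L2_def)

lemma admissible_controlsD:
  assumes "u \<in> admissible_controls a b lo hi"
  shows "u \<in> borel_measurable (lebesgue_on {a..b})" "AE t in lebesgue_on {a..b}. u t \<in> {lo..hi}"
  using assms by (auto simp: admissible_controls_def Lp_def)

lemma admissible_controlsI:
  fixes lo hi :: "real^'nu"
  assumes "u \<in> borel_measurable (lebesgue_on {a..b})" "AE t in lebesgue_on {a..b}. u t \<in> {lo..hi}"
  shows "u \<in> admissible_controls a b lo hi"
proof -
  obtain R where R: "\<And>u. u \<in> {lo..hi} \<Longrightarrow> norm u \<le> R" "R > 0"
    using bounded_cbox[of lo hi] unfolding bounded_pos interval_cbox_cart by blast
  have "integrable (lebesgue_on {a..b}) (\<lambda>t. norm (u t) ^ 2)"
  proof (rule integrable_bounded_AE[where k = "\<lambda>_. R\<^sup>2"])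
    show "AE t in lebesgue_on {a..b}. norm (norm (u t) ^ 2) \<le> R\<^sup>2"
      using assms(2) by eventually_elim (use R in \<open>auto intro!: power_mono\<close>)
  qed (use assms(1) in auto)
  then show ?thesis using assms by (auto simp: admissible_controls_def Lp_def)
qed

text \<open>The common integrable majorant makes the primitives equicontinuous, so convergence at
  the finitely many points of a \<delta>-net is already uniform.\<close>

lemma uniform_integral_convergence:
  fixes d :: "nat \<Rightarrow> real \<Rightarrow> 'a::euclidean_space"
  assumes d: "\<And>n. integrable (lebesgue_on {a..b}) (d n)" and k: "integrable (lebesgue_on {a..b}) k"
    and le: "\<And>n. AE t in lebesgue_on {a..b}. norm (d n t) \<le> k t"
    and lim: "\<And>t. t \<in> {a..b} \<Longrightarrow> (\<lambda>n. integral {a..t} (d n)) \<longlonglongrightarrow> 0"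
    and e: "0 < e"
  shows "\<forall>\<^sub>F n in sequentially. \<forall>t\<in>{a..b}. norm (integral {a..t} (d n)) < e"
proof -
  have "uniformly_continuous_on {a..b} (\<lambda>t. integral {a..t} k)"
    by (intro compact_uniformly_continuous continuous_on_integral_interval k) simp
  then obtain \<delta> where \<delta>: "\<delta> > 0" "\<And>s t. s \<in> {a..b} \<Longrightarrow> t \<in> {a..b} \<Longrightarrow> dist t s < \<delta> \<Longrightarrow> dist (integral {a..t} k) (integral {a..s} k) < e / 2"
    unfolding uniformly_continuous_on_def using e by (meson half_gt_zero)
  obtain T where T: "T \<subseteq> {a..b}" "finite T" "{a..b} \<subseteq> (\<Union>t\<in>T. ball t \<delta>)"
  proof (rule compactE_image[of "{a..b}" "{a..b}" "\<lambda>t. ball t \<delta>"])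
    show "{a..b} \<subseteq> (\<Union>t\<in>{a..b}. ball t \<delta>)" using \<delta>(1) by force
  qed auto
  have close: "norm (integral {a..t} (d n) - integral {a..s} (d n)) < e / 2" if st: "s \<in> {a..b}" "t \<in> {a..b}" "dist t s < \<delta>" for s t n
  proof -
    have *: "norm (integral {a..v} (d n) - integral {a..u} (d n)) < e / 2"
      if uv: "a \<le> u" "u \<le> v" "v \<le> b" and dist: "dist v u < \<delta>" for u v
    proof -
      have "norm (integral {a..v} (d n) - integral {a..u} (d n)) = norm (integral {u..v} (d n))"
        using integral_interval_combine[OF d uv, of n, symmetric] by simp
      also have "\<dots> \<le> integral {u..v} k" by (rule norm_integral_interval_le_AE[OF d k uv(1,3) le])
      also have "\<dots> = integral {a..v} k - integral {a..u} k" using integral_interval_combine[OF k uv, symmetric] by simp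
      also have "\<dots> \<le> dist (integral {a..v} k) (integral {a..u} k)" unfolding dist_real_def by (rule abs_ge_self)
      also have "\<dots> < e / 2" using uv dist by (intro \<delta>(2)) auto
      finally show ?thesis .
    qed
    show ?thesis
      using *[of s t] *[of t s] st by (cases "s \<le> t") (auto simp: dist_commute norm_minus_commute)
  qed
  have "\<forall>\<^sub>F n in sequentially. \<forall>s\<in>T. norm (integral {a..s} (d n)) < e / 2"
  proof (rule eventually_ball_finite[OF T(2)], rule ballI)
    fix s assume "s \<in> T"
    then have "(\<lambda>n. norm (integral {a..s} (d n))) \<longlonglongrightarrow> 0" using lim T(1) by (intro tendsto_norm_zero) auto
    then show "\<forall>\<^sub>F n in sequentially. norm (integral {a..s} (d n)) < e / 2" using e by (intro order_tendstoD) auto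
  qed
  then show ?thesis
  proof eventually_elim
    case (elim n)
    show ?case
    proof
      fix t assume t: "t \<in> {a..b}"
      then obtain s where s: "s \<in> T" "dist t s < \<delta>" using T(3) by (auto simp: dist_commute)
      have "norm (integral {a..t} (d n)) \<le> norm (integral {a..t} (d n) - integral {a..s} (d n)) + norm (integral {a..s} (d n))"
        using norm_triangle_ineq[of "integral {a..t} (d n) - integral {a..s} (d n)" "integral {a..s} (d n)"] by simp
      also have "\<dots> < e / 2 + e / 2" using close[of s t n] elim s t T(1) by (intro add_strict_mono) auto
      finally show "norm (integral {a..t} (d n)) < e" by simp
    qed
  qed
qed

context dae
begin

text \<open>Following the given solution up to \<open>s\<close> and then \<open>z\<close> together
  with the root \<open>Y\<close> yields another solution of the full system, and uniqueness forces
  both to coincide. With \<open>s = a\<close> this identifies a constructed trajectory with the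
  given state; with later \<open>s\<close> it determines the algebraic component. The bound
  \<open>k\<close> makes the pasted algebraic component square integrable.\<close>

lemma solution_pasting:
  assumes u: "u \<in> admissible_controls a b lo hi" and sol: "state_solution f g a b x0 u x y"
    and s: "s \<in> {a..b}" and h: "integrable (lebesgue_on {a..b}) h"
    and z: "\<And>t. t \<in> {a..b} \<Longrightarrow> z t = x s + integral {a..t} h" and zD: "z ` {a..b} \<subseteq> Dx"
    and h0: "\<And>t. t < s \<Longrightarrow> h t = 0"
    and hF: "AE t in lebesgue_on {a..b}. s \<le> t \<longrightarrow> h t = F t (z t) (u t)"
    and k: "k \<in> Lp 2 a b" "AE t in lebesgue_on {a..b}. s \<le> t \<longrightarrow> norm (Y t (z t) (u t)) \<le> k t"
  shows "\<And>t. t \<in> {s..b} \<Longrightarrow> x t = z t" and "AE t in lebesgue_on {a..b}. s < t \<longrightarrow> y t = Y t (x t) (u t)"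
proof -
  define p where "p t = (if t \<le> s then x t else z t)" for t
  define q where "q t = (if t \<le> s then y t else Y t (z t) (u t))" for t
  have x: "x \<in> AC a b" "y \<in> Lp 2 a b" "x a = x0"
    "AE t in lebesgue_on {a..b}. (x has_vector_derivative f t (x t) (y t) (u t)) (at t within {a..b})"
    "AE t in lebesgue_on {a..b}. g t (x t) (y t) (u t) = 0"
    using sol by (auto simp: state_solution_def)
  have zAC: "z \<in> AC a b" by (rule AC_cong[OF AC_add[OF AC_const AC_integral[OF h]] z])
  have zc: "continuous_on {a..b} z" by (rule AC_continuous_on[OF zAC])
  \<comment> \<open>\<open>h\<close> vanishes strictly before \<open>s\<close>; its value at
    \<open>s\<close> itself sits on a null set.\<close>
  have "integral {a..s} h = integral {a..s} (\<lambda>_. 0)"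
    using h0 by (intro integral_spike[of "{s}"]) auto
  then have "integral {a..s} h = 0" by simp
  then have zs: "z s = x s" using z[OF s] by simp
  have pAC: "p \<in> AC a b" unfolding p_def
    using s zs by (intro AC_paste AC_subinterval[OF x(1)] AC_subinterval[OF zAC]) auto
  note um = admissible_controlsD[OF u]
  have ym: "y \<in> borel_measurable (lebesgue_on {a..b})" using x(2) by (simp add: Lp_def)
  have sm: "{t. t \<le> s} \<inter> space (lebesgue_on {a..b}) \<in> sets (lebesgue_on {a..b})"
  proof -
    have "{t. t \<le> s} \<inter> {a..b} = {a..min s b}" by auto
    then show ?thesis by (simp add: sets_restrict_space_iff)
  qed
  have qm: "q \<in> borel_measurable (lebesgue_on {a..b})"
    unfolding q_def using measurable_If_set[OF ym YF_measurable(1)[OF zc zD um(1)] sm] by simp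
  have "integrable (lebesgue_on {a..b}) (\<lambda>t. norm (q t) ^ 2)"
  proof (rule integrable_bounded_AE[where k = "\<lambda>t. norm (y t) ^ 2 + norm (k t) ^ 2"])
    show "AE t in lebesgue_on {a..b}. norm (norm (q t) ^ 2) \<le> norm (y t) ^ 2 + norm (k t) ^ 2"
      using k(2)
    proof eventually_elim
      case (elim t)
      have "norm (q t) ^ 2 \<le> norm (k t) ^ 2" if "\<not> t \<le> s"
        using elim that by (intro power_mono) (auto simp: q_def)
      then show ?case by (cases "t \<le> s") (auto simp: q_def intro: add_increasing)
    qed
  qed (use qm k(1) x(2) in \<open>auto simp: Lp_def\<close>)
  then have qL: "q \<in> Lp 2 a b" using qm by (simp add: Lp_def)
  have zder: "AE t in lebesgue_on {a..b}. (z has_vector_derivative h t) (at t within {a..b})"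
    using has_vector_derivative_integral_AE[OF integral_lebesgue_on_interval(2)[OF h order_refl order_refl]] AE_space
  proof eventually_elim
    case (elim t)
    have "((\<lambda>t. x s + integral {a..t} h) has_vector_derivative h t) (at t within {a..b})"
      using has_vector_derivative_add[OF has_vector_derivative_const elim(1), of "x s"] by simp
    then show ?case
      by (rule has_vector_derivative_transform_within[OF _ zero_less_one]) (use elim(2) z in auto)
  qed
  \<comment> \<open>At the junction the one-sided derivatives may differ, so this single time is
    discarded.\<close>
  have ns: "AE t in lebesgue_on {a..b}. t \<noteq> s"
    by (subst AE_lebesgue_on_iff_negligible) (auto intro!: exI[of _ "{s}"])
  have "state_solution f g a b x0 u p q"
    unfolding state_solution_def
  proof (intro conjI)
    show "p \<in> AC a b" "q \<in> Lp 2 a b" by fact+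
    show "p a = x0" using s x(3) by (simp add: p_def)
    show "AE t in lebesgue_on {a..b}. (p has_vector_derivative f t (p t) (q t) (u t)) (at t within {a..b})"
      using x(4) zder hF ns F_root um(2) AE_space
    proof eventually_elim
      case (elim t)
      have t: "t \<in> {a..b}" using elim(7) by simp
      show ?case
      proof (cases "t < s")
        case True
        have "(p has_vector_derivative f t (x t) (y t) (u t)) (at t within {a..b})"
          by (rule has_vector_derivative_transform_within[OF elim(1), of "s - t"])
             (use True t in \<open>auto simp: p_def dist_real_def\<close>)
        then show ?thesis using True by (simp add: p_def q_def)
      next
        case False
        then have ts: "s < t" using elim(4) by simp
        have "z t \<in> Dx" using zD t by auto
        then have "h t = f t (p t) (q t) (u t)" using elim(3,5,6) ts by (simp add: p_def q_def)
        moreover have "(p has_vector_derivative h t) (at t within {a..b})"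
          by (rule has_vector_derivative_transform_within[OF elim(2), of "t - s"])
             (use ts t in \<open>auto simp: p_def dist_real_def\<close>)
        ultimately show ?thesis by simp
      qed
    qed
    show "AE t in lebesgue_on {a..b}. g t (p t) (q t) (u t) = 0"
      using x(5) F_root um(2) AE_space
    proof eventually_elim
      case (elim t)
      then have "z t \<in> Dx" using zD by auto
      then show ?case using elim by (auto simp: p_def q_def)
    qed
  qed
  then have eq: "\<And>t. t \<in> {a..b} \<Longrightarrow> x t = p t" and eqy: "AE t in lebesgue_on {a..b}. y t = q t"
    using solution_unique[OF u sol] by blast+
  show xz: "x t = z t" if "t \<in> {s..b}" for t
    using eq[of t] that s zs by (cases "t = s") (auto simp: p_def)
  show "AE t in lebesgue_on {a..b}. s < t \<longrightarrow> y t = Y t (x t) (u t)"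
    using eqy AE_space
  proof eventually_elim
    case (elim t)
    then show ?case using xz[of t] by (auto simp: q_def)
  qed
qed

text \<open>Nearest-point projection to the ball around a moving centre \<open>c\<close>, written
  through the projection to a fixed ball so that joint continuity in \<open>c\<close> and
  \<open>z\<close> follows from continuity of one map.\<close>

definition proj :: "real \<Rightarrow> real^'nx \<Rightarrow> real^'nx \<Rightarrow> real^'nx" where
  "proj r c z = c + closest_point (cball 0 r) (z - c)"

lemma proj_props:
  assumes "0 < r"
  shows "proj r c z \<in> cball c r" "norm (proj r c z - proj r c w) \<le> norm (z - w)"
    "norm (z - c) \<le> r \<Longrightarrow> proj r c z = z"
proof -
  have ne: "cball (0::real^'nx) r \<noteq> {}" using assms by simp
  show "proj r c z \<in> cball c r"
    using closest_point_in_set[OF closed_cball ne, of "z - c"] by (simp add: proj_def dist_norm)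
  show "norm (proj r c z - proj r c w) \<le> norm (z - w)"
    using closest_point_lipschitz[OF convex_cball closed_cball ne, of "z - c" "w - c"] by (simp add: proj_def dist_norm)
  show "norm (z - c) \<le> r \<Longrightarrow> proj r c z = z"
    by (simp add: proj_def closest_point_self)
qed

lemma proj_continuous:
  assumes "0 < r" "continuous_on S c" "continuous_on S z"
  shows "continuous_on S (\<lambda>t. proj r (c t) (z t))"
proof -
  have ne: "cball (0::real^'nx) r \<noteq> {}" using assms by simp
  have "continuous_on UNIV (closest_point (cball (0::real^'nx) r))"
    by (rule continuous_on_closest_point[OF convex_cball closed_cball ne])
  then have "continuous_on S (\<lambda>t. closest_point (cball 0 r) (z t - c t))"
    by (rule continuous_on_compose2) (intro continuous_intros assms | simp)+
  then show ?thesis unfolding proj_def by (intro continuous_intros assms)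
qed

text \<open>Projecting onto the tube makes the reduced right-hand side globally Lipschitz and bounded, so that
  a solution exists on the whole interval; it solves the original equation as long as it stays in the tube.\<close>

lemma tube_solution:
  assumes u: "u \<in> admissible_controls a b lo hi" and xb: "continuous_on {a..b} xb" "xb ` {a..b} \<subseteq> Dx"
    and r: "0 < r" and \<kappa>: "\<kappa> \<in> Lp 4 a b" and C: "0 \<le> C" and cb: "\<And>p. p \<in> xb ` {a..b} \<Longrightarrow> cball p r \<subseteq> Dx"
    and wb: "AE t in lebesgue_on {a..b}. \<forall>p\<in>xb ` {a..b}. well_bounded C (\<kappa> t) t (cball p r)"
  obtains z h where "continuous_on {a..b} z" "integrable (lebesgue_on {a..b}) h"
    "\<And>t. t \<in> {a..b} \<Longrightarrow> z t = \<xi> + integral {a..t} h"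
    "\<And>t. t < s \<Longrightarrow> h t = 0" "\<And>t. s \<le> t \<Longrightarrow> h t = F t (proj r (xb t) (z t)) (u t)"
    "AE t in lebesgue_on {a..b}. norm (h t) \<le> C * (\<kappa> t)\<^sup>2"
proof -
  \<comment> \<open>Before \<open>s\<close> the field is zero and the solution rests at \<xi>, so
    every starting time is treated on the same interval \<open>{a..b}\<close>.\<close>
  define G where "G t z = (if t < s then 0 else F t (proj r (xb t) z) (u t))" for t z
  have int: "integrable (lebesgue_on {a..b}) (\<lambda>t. C * (\<kappa> t)\<^sup>2)" using Lp4_integrable_powers[OF \<kappa>] by simp
  note um = admissible_controlsD[OF u]
  have Lip: "AE t in lebesgue_on {a..b}. \<forall>z w. norm (G t z - G t w) \<le> C * (\<kappa> t)\<^sup>2 * norm (z - w)"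
    using wb um(2) AE_space
  proof eventually_elim
    case (elim t)
    then have W: "well_bounded C (\<kappa> t) t (cball (xb t) r)" by auto
    show ?case
    proof (intro allI)
      fix z w
      have "norm (F t (proj r (xb t) z) (u t) - F t (proj r (xb t) w) (u t)) \<le> C * (\<kappa> t)\<^sup>2 * norm (proj r (xb t) z - proj r (xb t) w)"
        using W proj_props(1)[OF r] elim(2) unfolding well_bounded_def by blast
      also have "\<dots> \<le> C * (\<kappa> t)\<^sup>2 * norm (z - w)" using C by (intro mult_left_mono proj_props(2)[OF r]) auto
      finally show "norm (G t z - G t w) \<le> C * (\<kappa> t)\<^sup>2 * norm (z - w)" using C by (simp add: G_def)
    qed
  qed
  have bd: "AE t in lebesgue_on {a..b}. \<forall>z. norm (G t z) \<le> C * (\<kappa> t)\<^sup>2"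
    using wb um(2) AE_space
  proof eventually_elim
    case (elim t)
    then have W: "well_bounded C (\<kappa> t) t (cball (xb t) r)" by auto
    show ?case
    proof
      fix z
      have "norm (F t (proj r (xb t) z) (u t)) \<le> C * (\<kappa> t)\<^sup>2"
        using W proj_props(1)[OF r] elim(2) unfolding well_bounded_def by blast
      then show "norm (G t z) \<le> C * (\<kappa> t)\<^sup>2" using C by (simp add: G_def)
    qed
  qed
  have pD: "proj r (xb t) w \<in> Dx" if "t \<in> {a..b}" for t w
    using cb[of "xb t"] that proj_props(1)[OF r, of "xb t" w] by blast
  have sm: "{t. t < s} \<inter> space (lebesgue_on {a..b}) \<in> sets (lebesgue_on {a..b})"
    unfolding sets_restrict_space by (rule image_eqI[of _ _ "{..<s}"]) auto
  have meas: "(\<lambda>t. G t (z t)) \<in> borel_measurable (lebesgue_on {a..b})" if z: "continuous_on {a..b} z" for z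
  proof -
    have "(\<lambda>t. F t (proj r (xb t) (z t)) (u t)) \<in> borel_measurable (lebesgue_on {a..b})"
      using pD by (intro YF_measurable(2)[OF proj_continuous[OF r xb(1) z] _ um(1)]) auto
    from measurable_If_set[OF borel_measurable_const this sm, of 0] show ?thesis by (simp add: G_def)
  qed
  obtain z where z: "continuous_on {a..b} z" "integrable (lebesgue_on {a..b}) (\<lambda>t. G t (z t))"
    "\<And>t. t \<in> {a..b} \<Longrightarrow> z t = \<xi> + integral {a..t} (\<lambda>s. G s (z s))"
    by (rule Caratheodory_Picard[OF _ int _ int Lip bd meas]) (use ab C in auto)
  show thesis
  proof (rule that[OF z])
    show "AE t in lebesgue_on {a..b}. norm (G t (z t)) \<le> C * (\<kappa> t)\<^sup>2" using bd by eventually_elim blast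
  qed (auto simp: G_def)
qed

end

section \<open>Identification of the algebraic component\<close>

lemma state_solutionD:
  assumes "state_solution f g a b x0 u x y"
  shows "x \<in> AC a b" "y \<in> Lp 2 a b" "x a = x0"
    "AE t in lebesgue_on {a..b}. (x has_vector_derivative f t (x t) (y t) (u t)) (at t within {a..b})"
    "AE t in lebesgue_on {a..b}. g t (x t) (y t) (u t) = 0"
  using assms unfolding state_solution_def by blast+

context dae
begin

lemma solution_continuous:
  assumes "u \<in> admissible_controls a b lo hi" "state_solution f g a b x0 u x y"
  shows "continuous_on {a..b} x" "x ` {a..b} \<subseteq> Dx" "compact (x ` {a..b})"
proof -
  show c: "continuous_on {a..b} x" by (rule AC_continuous_on[OF state_solutionD(1)[OF assms(2)]])
  show "x ` {a..b} \<subseteq> Dx" using solution_in_Dx[OF assms] by auto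
  show "compact (x ` {a..b})" by (rule compact_continuous_image[OF c]) simp
qed

text \<open>Stated from an arbitrary time \<open>s\<close> on, because during the backward
  propagation the algebraic component is identified with the root only on a final piece of the
  interval.\<close>

lemma AE_Y_imp_integral:
  assumes u: "u \<in> admissible_controls a b lo hi" and sol: "state_solution f g a b x0 u x y"
    and s: "a \<le> s" and y: "AE t in lebesgue_on {s..b}. y t = Y t (x t) (u t)" and t: "s \<le> t" "t \<le> b"
  shows "((\<lambda>\<tau>. F \<tau> (x \<tau>) (u \<tau>)) has_integral (x t - x s)) {s..t}"
proof (rule AC_has_integral[of x s b])
  have sub: "{s..b} \<subseteq> {a..b}" using s by auto
  show "x \<in> AC s b" by (rule AC_subinterval[OF state_solutionD(1)[OF sol] s order_refl])
  have 1: "AE t in lebesgue_on {s..b}. (x has_vector_derivative f t (x t) (y t) (u t)) (at t within {a..b})"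
    using sub by (intro AE_lebesgue_on_subset[OF state_solutionD(4)[OF sol]]) auto
  have 2: "AE t in lebesgue_on {s..b}. \<forall>x\<in>Dx. \<forall>u\<in>{lo..hi}. g t x (Y t x u) u = 0 \<and> f t x (Y t x u) u = F t x u"
    using sub by (intro AE_lebesgue_on_subset[OF F_root]) auto
  have 3: "AE t in lebesgue_on {s..b}. u t \<in> {lo..hi}"
    using sub by (intro AE_lebesgue_on_subset[OF admissible_controlsD(2)[OF u]]) auto
  show "AE \<tau> in lebesgue_on {s..b}. (x has_vector_derivative F \<tau> (x \<tau>) (u \<tau>)) (at \<tau> within {s..b})"
    using 1 2 3 y AE_space
  proof eventually_elim
    case (elim \<tau>)
    have "x \<tau> \<in> Dx" using elim(5) s by (intro solution_in_Dx[OF u sol]) auto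
    then have "f \<tau> (x \<tau>) (y \<tau>) (u \<tau>) = F \<tau> (x \<tau>) (u \<tau>)" using elim by auto
    then show ?case using elim(1) by (auto intro: has_vector_derivative_within_subset[OF _ sub])
  qed
qed (use t in auto)

text \<open>The equation \<open>g = 0\<close> may have roots other than \<open>Y\<close> outside of \<open>Dy\<close>. A solution that used one of
  them could, however, be modified by following \<open>Y\<close> from a slightly earlier time on, which contradicts
  uniqueness. The admissible step size is uniform, so that the argument propagates backwards from \<open>b\<close> to \<open>a\<close>.\<close>

theorem algebraic_component_eq_Y:
  assumes u: "u \<in> admissible_controls a b lo hi" and sol: "state_solution f g a b x0 u x y"
  shows "AE t in lebesgue_on {a..b}. y t = Y t (x t) (u t)"
proof -
  note xc = solution_continuous[OF u sol]
  obtain r \<kappa> C where r: "r > 0" and \<kappa>: "\<kappa> \<in> Lp 4 a b" "0 \<le> C" "\<And>t. 0 \<le> \<kappa> t"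
    and cb: "\<And>p. p \<in> x ` {a..b} \<Longrightarrow> cball p r \<subseteq> Dx"
    and wb: "AE t in lebesgue_on {a..b}. \<forall>p\<in>x ` {a..b}. well_bounded C (\<kappa> t) t (cball p r)"
    by (rule compact_tube[OF xc(3,2)]) (rule that)
  define m where "m t = C * (\<kappa> t)\<^sup>2" for t
  have mi: "integrable (lebesgue_on {a..b}) m" unfolding m_def using Lp4_integrable_powers[OF \<kappa>(1)] by simp
  have m0: "0 \<le> m t" for t using \<kappa>(2) by (simp add: m_def)
  define E where "E = exp (2 * integral {a..b} m)"
  have E1: "E \<ge> 1"
    using integral_nonneg[OF integral_lebesgue_on_interval(2)[OF mi order_refl order_refl]] m0 by (simp add: E_def)
  \<comment> \<open>On one step the trajectories may separate by at most \<open>2 * \<eta>\<close>,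
    and Gronwall's lemma afterwards multiplies this by at most \<open>2 * E\<close>; the result
    \<open>4 * \<eta> * E\<close> must stay below the tube radius.\<close>
  define \<eta> where "\<eta> = r / (4 * E + 1)"
  have \<eta>: "0 < \<eta>" "4 * \<eta> * E < r" "2 * \<eta> \<le> r"
    using r E1 by (auto simp: \<eta>_def field_simps)
  have "uniformly_continuous_on {a..b} x" by (intro compact_uniformly_continuous xc) simp
  then obtain \<delta>1 where \<delta>1: "\<delta>1 > 0" "\<And>s t. s \<in> {a..b} \<Longrightarrow> t \<in> {a..b} \<Longrightarrow> dist t s < \<delta>1 \<Longrightarrow> dist (x t) (x s) < \<eta>"
    unfolding uniformly_continuous_on_def using \<eta>(1) by meson
  have "uniformly_continuous_on {a..b} (\<lambda>t. integral {a..t} m)"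
    by (intro compact_uniformly_continuous continuous_on_integral_interval mi) simp
  then obtain \<delta>2 where \<delta>2: "\<delta>2 > 0" "\<And>s t. s \<in> {a..b} \<Longrightarrow> t \<in> {a..b} \<Longrightarrow> dist t s < \<delta>2 \<Longrightarrow> dist (integral {a..t} m) (integral {a..s} m) < \<eta>"
    unfolding uniformly_continuous_on_def using \<eta>(1) by meson
  \<comment> \<open>Over a time span of \<delta> both \<open>x\<close> and the primitive of
    \<open>m\<close> vary by less than \<eta>. The number does not depend on the position of the
    step.\<close>
  define \<delta> where "\<delta> = min \<delta>1 \<delta>2 / 2"
  have \<delta>: "\<delta> > 0" "\<delta> < \<delta>1" "\<delta> < \<delta>2" using \<delta>1(1) \<delta>2(1) by (auto simp: \<delta>_def)
  have step: "AE t in lebesgue_on {s'..b}. y t = Y t (x t) (u t)"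
    if S: "AE t in lebesgue_on {s..b}. y t = Y t (x t) (u t)" and s: "s \<in> {a..b}" "s' = max a (s - \<delta>)" for s s'
  proof -
    have s': "a \<le> s'" "s' \<le> s" "s - s' \<le> \<delta>" "s' \<in> {a..b}" using s \<delta>(1) by auto
    obtain z h where z: "continuous_on {a..b} z" "integrable (lebesgue_on {a..b}) h"
      "\<And>t. t \<in> {a..b} \<Longrightarrow> z t = x s' + integral {a..t} h"
      "\<And>t. t < s' \<Longrightarrow> h t = 0" "\<And>t. s' \<le> t \<Longrightarrow> h t = F t (proj r (x t) (z t)) (u t)"
      "AE t in lebesgue_on {a..b}. norm (h t) \<le> C * (\<kappa> t)\<^sup>2"
      by (rule tube_solution[where \<xi> = "x s'" and s = s', OF u xc(1,2) r \<kappa>(1,2) cb wb]) (assumption | rule that)+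
    have zs': "integral {a..s'} h = 0"
    proof -
      have "integral {a..s'} h = integral {a..s'} (\<lambda>_. 0)" using z(4) by (intro integral_spike[of "{s'}"]) auto
      then show ?thesis by simp
    qed
    \<comment> \<open>Between \<open>s'\<close> and \<open>s\<close> nothing is known about
      \<open>y\<close>, so the two trajectories are compared only through the smallness of the
      increments of each.\<close>
    have near: "norm (z t - x t) \<le> 2 * \<eta>" if t: "t \<in> {s'..s}" for t
    proof -
      have tab: "t \<in> {a..b}" using t s' s by auto
      have "z t = x s' + integral {s'..t} h"
        using z(3)[OF tab] integral_interval_combine[OF z(2) s'(1), of t] t tab zs' by simp
      then have "norm (z t - x t) \<le> norm (x s' - x t) + norm (integral {s'..t} h)"
        using norm_triangle_ineq[of "x s' - x t" "integral {s'..t} h"] by (simp add: algebra_simps)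
      also have "norm (x s' - x t) \<le> \<eta>"
        using \<delta>1(2)[of t s'] tab s' t \<delta> by (auto simp: dist_norm less_imp_le)
      also have "norm (integral {s'..t} h) \<le> integral {s'..t} m"
        using tab s' z(6) by (intro norm_integral_interval_le_AE[OF z(2) mi]) (auto simp: m_def)
      also have "integral {s'..t} m = integral {a..t} m - integral {a..s'} m"
        using integral_interval_combine[OF mi s'(1), of t, symmetric] t tab by simp
      also have "\<dots> \<le> dist (integral {a..t} m) (integral {a..s'} m)" unfolding dist_real_def by (rule abs_ge_self)
      also have "\<dots> \<le> \<eta>"
        using tab s' t \<delta> by (intro less_imp_le \<delta>2(2)) (auto simp: dist_real_def)
      finally show ?thesis by simp
    qed
    \<comment> \<open>After \<open>s\<close> both trajectories follow the same reduced equation, up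
      to the cut-off, and Gronwall's lemma applies with the separation at \<open>s\<close> as
      initial error.\<close>
    have near2: "norm (z t - x t) \<le> 4 * \<eta> * E" if t: "t \<in> {s..b}" for t
    proof -
      have sb: "a \<le> s" "s \<le> b" using s by auto
      have ms: "integrable (lebesgue_on {s..b}) m" by (rule integral_lebesgue_on_interval(1)[OF mi sb(1) order_refl])
      have hs: "integrable (lebesgue_on {s..b}) h" by (rule integral_lebesgue_on_interval(1)[OF z(2) sb(1) order_refl])
      have dc: "continuous_on {s..b} (\<lambda>t. norm (z t - x t))"
        using sb by (intro continuous_intros continuous_on_subset[OF z(1)] continuous_on_subset[OF xc(1)]) auto
      have "norm (z t - x t) \<le> 2 * (2 * \<eta>) * exp (2 * integral {s..b} m)"
      proof (rule Gronwall_integral[OF ms m0 dc _ _ t])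
        fix \<tau> assume \<tau>: "\<tau> \<in> {s..b}"
        have Fint: "((\<lambda>\<sigma>. F \<sigma> (x \<sigma>) (u \<sigma>)) has_integral (x \<tau> - x s)) {s..\<tau>}"
          using \<tau> by (intro AE_Y_imp_integral[OF u sol sb(1) S]) auto
        have Fm: "(\<lambda>\<sigma>. F \<sigma> (x \<sigma>) (u \<sigma>)) \<in> borel_measurable (lebesgue_on {a..b})"
          by (rule YF_measurable(2)[OF xc(1,2) admissible_controlsD(1)[OF u]])
        have Fb: "AE \<sigma> in lebesgue_on {a..b}. norm (F \<sigma> (x \<sigma>) (u \<sigma>)) \<le> m \<sigma>"
          using wb admissible_controlsD(2)[OF u] AE_space
        proof eventually_elim
          case (elim \<sigma>)
          then have "well_bounded C (\<kappa> \<sigma>) \<sigma> (cball (x \<sigma>) r)" by auto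
          moreover have "x \<sigma> \<in> cball (x \<sigma>) r" using r by simp
          ultimately show ?case using elim(2) unfolding well_bounded_def m_def by blast
        qed
        have Fi: "integrable (lebesgue_on {a..b}) (\<lambda>\<sigma>. F \<sigma> (x \<sigma>) (u \<sigma>))"
          by (rule integrable_bounded_AE[OF Fm mi Fb])
        have hF: "integrable (lebesgue_on {a..b}) (\<lambda>\<sigma>. h \<sigma> - F \<sigma> (x \<sigma>) (u \<sigma>))" using z(2) Fi by simp
        have "z \<tau> - z s = integral {s..\<tau>} h"
          using z(3)[of \<tau>] z(3)[of s] \<tau> sb integral_interval_combine[OF z(2) sb(1), of \<tau>, symmetric] by simp
        moreover have "x \<tau> - x s = integral {s..\<tau>} (\<lambda>\<sigma>. F \<sigma> (x \<sigma>) (u \<sigma>))" using Fint by (simp add: integral_unique)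
        ultimately have "z \<tau> - x \<tau> = (z s - x s) + integral {s..\<tau>} (\<lambda>\<sigma>. h \<sigma> - F \<sigma> (x \<sigma>) (u \<sigma>))"
          using integral_lebesgue_on_interval(2)[OF z(2) sb(1), of \<tau>] integral_lebesgue_on_interval(2)[OF Fi sb(1), of \<tau>] \<tau>
          by (simp add: Henstock_Kurzweil_Integration.integral_diff algebra_simps)
        then have "norm (z \<tau> - x \<tau>) \<le> norm (z s - x s) + norm (integral {s..\<tau>} (\<lambda>\<sigma>. h \<sigma> - F \<sigma> (x \<sigma>) (u \<sigma>)))"
          by (simp add: norm_triangle_ineq)
        also have "norm (integral {s..\<tau>} (\<lambda>\<sigma>. h \<sigma> - F \<sigma> (x \<sigma>) (u \<sigma>))) \<le> integral {s..\<tau>} (\<lambda>\<sigma>. m \<sigma> * norm (z \<sigma> - x \<sigma>))"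
        proof (rule norm_integral_interval_le_AE[where a = s and b = b])
          show "integrable (lebesgue_on {s..b}) (\<lambda>\<sigma>. h \<sigma> - F \<sigma> (x \<sigma>) (u \<sigma>))" by (rule integral_lebesgue_on_interval(1)[OF hF sb(1) order_refl])
          show "integrable (lebesgue_on {s..b}) (\<lambda>\<sigma>. m \<sigma> * norm (z \<sigma> - x \<sigma>))" by (rule integrable_mult_continuous[OF ms dc])
          have "AE \<sigma> in lebesgue_on {a..b}. s \<le> \<sigma> \<longrightarrow> norm (h \<sigma> - F \<sigma> (x \<sigma>) (u \<sigma>)) \<le> m \<sigma> * norm (z \<sigma> - x \<sigma>)"
            using wb admissible_controlsD(2)[OF u] AE_space
          proof eventually_elim
            case (elim \<sigma>)
            show ?case
            proof
              assume ss: "s \<le> \<sigma>"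
              have W: "well_bounded C (\<kappa> \<sigma>) \<sigma> (cball (x \<sigma>) r)" using elim by auto
              have "x \<sigma> \<in> cball (x \<sigma>) r" using r by simp
              then have "norm (F \<sigma> (proj r (x \<sigma>) (z \<sigma>)) (u \<sigma>) - F \<sigma> (x \<sigma>) (u \<sigma>)) \<le> C * (\<kappa> \<sigma>)\<^sup>2 * norm (proj r (x \<sigma>) (z \<sigma>) - x \<sigma>)"
                using W proj_props(1)[OF r] elim(2) unfolding well_bounded_def by blast
              also have "\<dots> \<le> C * (\<kappa> \<sigma>)\<^sup>2 * norm (z \<sigma> - x \<sigma>)"
                using proj_props(2)[OF r, of "x \<sigma>" "z \<sigma>" "x \<sigma>"] proj_props(3)[of r "x \<sigma>" "x \<sigma>"] r \<kappa>(2)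
                by (intro mult_left_mono) auto
              finally show "norm (h \<sigma> - F \<sigma> (x \<sigma>) (u \<sigma>)) \<le> m \<sigma> * norm (z \<sigma> - x \<sigma>)"
                using z(5)[of \<sigma>] s' ss by (simp add: m_def)
            qed
          qed
          then have "AE \<sigma> in lebesgue_on {s..b}. s \<le> \<sigma> \<longrightarrow> norm (h \<sigma> - F \<sigma> (x \<sigma>) (u \<sigma>)) \<le> m \<sigma> * norm (z \<sigma> - x \<sigma>)"
            by (rule AE_lebesgue_on_subset) (use sb in auto)
          then show "AE \<sigma> in lebesgue_on {s..b}. norm (h \<sigma> - F \<sigma> (x \<sigma>) (u \<sigma>)) \<le> m \<sigma> * norm (z \<sigma> - x \<sigma>)"
            using AE_space by eventually_elim auto
        qed (use \<tau> in auto)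
        also have "norm (z s - x s) \<le> 2 * \<eta>" using near[of s] s' by auto
        finally show "norm (z \<tau> - x \<tau>) \<le> 2 * \<eta> + integral {s..\<tau>} (\<lambda>\<sigma>. m \<sigma> * norm (z \<sigma> - x \<sigma>))" by simp
      qed (use \<eta> in auto)
      also have "\<dots> \<le> 4 * \<eta> * E"
      proof -
        have "integral {s..b} m \<le> integral {a..b} m"
          using integral_interval_combine[OF mi sb order_refl] integral_nonneg[OF integral_lebesgue_on_interval(2)[OF mi order_refl sb(2)]] m0 by simp
        then have "exp (2 * integral {s..b} m) \<le> E" by (simp add: E_def)
        then have "(2 * (2 * \<eta>)) * exp (2 * integral {s..b} m) \<le> (2 * (2 * \<eta>)) * E" using \<eta>(1) by (intro mult_left_mono) auto
        then show ?thesis by simp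
      qed
      finally show ?thesis .
    qed
    \<comment> \<open>Hence \<open>z\<close> never leaves the tube after \<open>s'\<close>, the
      projection acts as the identity there, and \<open>z\<close> solves the original reduced
      equation.\<close>
    have inr: "norm (z t - x t) \<le> r" if "t \<in> {s'..b}" for t
      using near[of t] near2[of t] \<eta> that by (cases "t \<le> s") auto
    have zD: "z ` {a..b} \<subseteq> Dx"
    proof
      fix p assume "p \<in> z ` {a..b}"
      then obtain t where t: "t \<in> {a..b}" "p = z t" by auto
      show "p \<in> Dx"
      proof (cases "s' \<le> t")
        case True
        then have "z t \<in> cball (x t) r" using inr[of t] t by (simp add: dist_norm norm_minus_commute)
        then show ?thesis using cb[of "x t"] t by auto
      next
        case False
        have "integral {a..t} h = integral {a..t} (\<lambda>_. 0)" using z(4) False by (intro integral_spike[of "{}"]) auto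
        then have "z t = x s'" using z(3)[OF t(1)] by simp
        then show ?thesis using t(2) xc(2) s'(4) by auto
      qed
    qed
    have "AE t in lebesgue_on {a..b}. s' < t \<longrightarrow> y t = Y t (x t) (u t)"
    proof (rule solution_pasting(2)[OF u sol s'(4) z(2,3) zD z(4)])
      show "AE t in lebesgue_on {a..b}. s' \<le> t \<longrightarrow> h t = F t (z t) (u t)"
      proof (rule AE_I2)
        fix t assume "t \<in> space (lebesgue_on {a..b})"
        then show "s' \<le> t \<longrightarrow> h t = F t (z t) (u t)" using z(5)[of t] proj_props(3)[OF r inr[of t]] by auto
      qed
      show "(\<lambda>t. C * \<kappa> t) \<in> Lp 2 a b" using Lp4_integrable_powers[OF \<kappa>(1)] by (simp add: Lp_def power_mult_distrib)
      show "AE t in lebesgue_on {a..b}. s' \<le> t \<longrightarrow> norm (Y t (z t) (u t)) \<le> C * \<kappa> t"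
        using wb admissible_controlsD(2)[OF u] AE_space
      proof eventually_elim
        case (elim t)
        show ?case
        proof
          assume "s' \<le> t"
          then have "z t \<in> cball (x t) r" using inr[of t] elim(3) by (simp add: dist_norm norm_minus_commute)
          moreover have "well_bounded C (\<kappa> t) t (cball (x t) r)" using elim by auto
          ultimately show "norm (Y t (z t) (u t)) \<le> C * \<kappa> t" using elim(2) unfolding well_bounded_def by blast
        qed
      qed
    qed
    then have "AE t in lebesgue_on {s'..b}. s' < t \<longrightarrow> y t = Y t (x t) (u t)"
      by (rule AE_lebesgue_on_subset) (use s' in auto)
    moreover have "AE t in lebesgue_on {s'..b}. t \<noteq> s'"
      by (subst AE_lebesgue_on_iff_negligible) (auto intro!: exI[of _ "{s'}"])
    ultimately show ?thesis using AE_space by eventually_elim auto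
  qed
  \<comment> \<open>The induction starts from the degenerate interval consisting of \<open>b\<close>
    alone, where the claim holds because a point is negligible.\<close>
  have iter: "AE t in lebesgue_on {max a (b - real n * \<delta>)..b}. y t = Y t (x t) (u t)" for n
  proof (induction n)
    case 0
    show ?case by (subst AE_lebesgue_on_iff_negligible) (use ab in \<open>auto intro!: exI[of _ "{b}"]\<close>)
  next
    case (Suc n)
    have eq: "max a (b - real (Suc n) * \<delta>) = max a (max a (b - real n * \<delta>) - \<delta>)"
      using \<delta>(1) by (auto simp: max_def algebra_simps)
    show ?case by (rule step[OF Suc.IH _ eq]) (use ab \<delta>(1) in auto)
  qed
  obtain n where n: "(b - a) / \<delta> \<le> real n" using real_arch_simple by blast
  then have e: "max a (b - real n * \<delta>) = a" using \<delta>(1) by (simp add: field_simps)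
  show ?thesis using iter[of n] unfolding e .
qed

end

section \<open>Functionals on the product space\<close>

lemma integrable_inner_bounded:
  fixes w v :: "'t \<Rightarrow> 'a::euclidean_space"
  assumes w: "integrable M w" and v: "v \<in> borel_measurable M" "AE t in M. norm (v t) \<le> R"
  shows "integrable M (\<lambda>t. w t \<bullet> v t)"
proof (rule integrable_bounded_AE[where k = "\<lambda>t. norm (w t) * R"])
  show "AE t in M. norm (w t \<bullet> v t) \<le> norm (w t) * R" using v(2)
  proof eventually_elim
    case (elim t)
    have "\<bar>w t \<bullet> v t\<bar> \<le> norm (w t) * norm (v t)" by (rule Cauchy_Schwarz_ineq2)
    also have "\<dots> \<le> norm (w t) * R" using elim by (intro mult_left_mono) auto
    finally show ?case by simp
  qed
qed (use w v in auto)

text \<open>Uniform smallness relative to a fixed integrable weight. The exceptional null set may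
  depend on \<open>n\<close>, as it does for bounds that hold for almost all times along a sequence
  of controls.\<close>

lemma integral_tendsto_0_of_small:
  fixes p :: "nat \<Rightarrow> 't \<Rightarrow> real"
  assumes k: "integrable M k" "\<And>t. 0 \<le> k t" and p: "\<And>n. p n \<in> borel_measurable M"
    and small: "\<And>e. 0 < e \<Longrightarrow> \<forall>\<^sub>F n in sequentially. AE t in M. \<bar>p n t\<bar> \<le> e * k t"
  shows "(\<lambda>n. LINT t|M. p n t) \<longlonglongrightarrow> 0"
proof (rule tendstoI)
  fix e :: real assume e: "0 < e"
  define I where "I = (LINT t|M. k t)"
  have I: "0 \<le> I" using k by (simp add: I_def)
  define e' where "e' = e / (I + 1)"
  have e': "0 < e'" "e' * I < e" using e I by (auto simp: e'_def field_simps add_nonneg_pos)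
  show "\<forall>\<^sub>F n in sequentially. dist (LINT t|M. p n t) 0 < e"
    using small[OF e'(1)]
  proof eventually_elim
    case (elim n)
    have i: "integrable M (p n)" by (rule integrable_bounded_AE[OF p, where k = "\<lambda>t. e' * k t"]) (use k elim in auto)
    have "\<bar>LINT t|M. p n t\<bar> \<le> (LINT t|M. \<bar>p n t\<bar>)" by (rule integral_abs_bound)
    also have "\<dots> \<le> (LINT t|M. e' * k t)" using i k elim by (intro integral_mono_AE) auto
    also have "\<dots> = e' * I" by (simp add: I_def)
    finally show ?case using e'(2) by simp
  qed
qed

lemma finite_measure_lebesgue_on_interval: "finite_measure (lebesgue_on {a..b::real})"
  by (rule finite_measure_lebesgue_on) simp

lemma L2_norm_eq: "L2_norm a b h = sqrt (L2_sqnorm (lebesgue_on {a..b}) h)"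
  by (simp add: L2_norm_def L2_sqnorm_def)

text \<open>Both parts of the norm are bounded by the L^1 norm of \<open>h\<close>, since the
  primitive has derivative \<open>h\<close> almost everywhere. This also settles measurability of
  the derivative appearing in the norm.\<close>

lemma AC_norm_integral_le:
  fixes h :: "real \<Rightarrow> 'a::euclidean_space"
  assumes ab: "a < b" and h: "integrable (lebesgue_on {a..b}) h"
  shows "AC_norm a b (\<lambda>t. integral {a..t} h) \<le> 2 * (LINT t|lebesgue_on {a..b}. norm (h t))"
proof -
  have nh: "integrable (lebesgue_on {a..b}) (\<lambda>t. norm (h t))" using h by simp
  have "(SUP t\<in>{a..b}. norm (integral {a..t} h)) \<le> (LINT t|lebesgue_on {a..b}. norm (h t))"
  proof (rule cSUP_least)
    fix t assume t: "t \<in> {a..b}"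
    have "norm (integral {a..t} h) \<le> integral {a..t} (\<lambda>t. norm (h t))"
      by (rule norm_integral_interval_le_AE[OF h nh]) (use t in auto)
    also have "\<dots> \<le> integral {a..b} (\<lambda>t. norm (h t))"
      using integral_interval_combine[OF nh, of t b] integral_nonneg[OF integral_lebesgue_on_interval(2)[OF nh, of t b]] t by auto
    also have "\<dots> = (LINT t|lebesgue_on {a..b}. norm (h t))" by (rule integral_lebesgue_on_interval(3)[OF nh]) auto
    finally show "norm (integral {a..t} h) \<le> (LINT t|lebesgue_on {a..b}. norm (h t))" .
  qed (use ab in auto)
  moreover have "(LINT t|lebesgue_on {a..b}. norm (vector_derivative (\<lambda>t. integral {a..t} h) (at t within {a..b}))) = (LINT t|lebesgue_on {a..b}. norm (h t))"
  proof -
    have ae: "AE t in lebesgue_on {a..b}. vector_derivative (\<lambda>t. integral {a..t} h) (at t within {a..b}) = h t"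
      using has_vector_derivative_integral_AE[OF integral_lebesgue_on_interval(2)[OF h order_refl order_refl]] AE_space
    proof eventually_elim
      case (elim t)
      then show ?case using vector_derivative_within_cbox[OF ab, of t "\<lambda>t. integral {a..t} h" "h t"] by simp
    qed
    have m: "h \<in> borel_measurable (lebesgue_on {a..b})" using h by simp
    have "(\<lambda>t. vector_derivative (\<lambda>t. integral {a..t} h) (at t within {a..b})) \<in> borel_measurable (lebesgue_on {a..b})"
      by (rule borel_measurable_lebesgue_on_AE[OF m]) (use ae in \<open>auto elim: eventually_mono\<close>)
    then show ?thesis using ae m by (intro integral_cong_AE) (auto elim: eventually_mono)
  qed
  ultimately show ?thesis by (simp add: AC_norm_def)
qed

text \<open>Elements are functions on the whole line; this is what allows bounded functionals to
  ignore their values off the interval.\<close>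

lemma AC_norm_eq_0:
  fixes x :: "real \<Rightarrow> 'a::euclidean_space"
  assumes ab: "a < b" and x: "\<And>t. t \<in> {a..b} \<Longrightarrow> x t = 0"
  shows "AC_norm a b x = 0"
proof -
  have "vector_derivative x (at t within {a..b}) = 0" if t: "t \<in> {a..b}" for t
  proof -
    have "(x has_vector_derivative 0) (at t within {a..b})"
      by (rule has_vector_derivative_transform_within[OF has_vector_derivative_const zero_less_one t]) (simp add: x)
    then show ?thesis using vector_derivative_within_cbox[OF ab, of t x 0] t by simp
  qed
  then have "(LINT t|lebesgue_on {a..b}. norm (vector_derivative x (at t within {a..b}))) = (LINT t|lebesgue_on {a..b}. 0)"
    by (intro Bochner_Integration.integral_cong) auto
  moreover have "(SUP t\<in>{a..b}. norm (x t)) = (SUP t\<in>{a..b}. 0)" by (intro SUP_cong) (auto simp: x)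
  ultimately show ?thesis using ab by (simp add: AC_norm_def)
qed

lemma L2_norm_eq_0:
  assumes "\<And>t. t \<in> {a..b} \<Longrightarrow> h t = 0"
  shows "L2_norm a b h = 0"
proof -
  have "(LINT t|lebesgue_on {a..b}. (norm (h t))\<^sup>2) = (LINT t|lebesgue_on {a..b}. 0)"
    using assms by (intro Bochner_Integration.integral_cong) auto
  then show ?thesis by (simp add: L2_norm_def)
qed

lemma XYU_triple:
  "(\<lambda>t. (x t, y t, u t)) \<in> XYU a b \<longleftrightarrow> x \<in> AC a b \<and> y \<in> L2 (lebesgue_on {a..b}) \<and> u \<in> L2 (lebesgue_on {a..b})"
  by (simp add: XYU_def Lp2_L2)

text \<open>The absolutely continuous component is represented by its derivative, whose \<open>L\<^sup>2\<close> norm dominates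
  \<^const>\<open>AC_norm\<close> of the primitive; so Riesz's theorem applies to each of the three components.\<close>

theorem XYU_functional_representation:
  fixes \<phi> :: "(real \<Rightarrow> (real^'nx) \<times> (real^'ny) \<times> (real^'nu)) \<Rightarrow> real"
  assumes ab: "a < b" and \<phi>: "bounded_functional (XYU a b) (XYU_norm a b) \<phi>"
  obtains w1 w2 w3 where "w1 \<in> L2 (lebesgue_on {a..b})" "w2 \<in> L2 (lebesgue_on {a..b})" "w3 \<in> L2 (lebesgue_on {a..b})"
    "\<And>x h y u \<xi>. h \<in> L2 (lebesgue_on {a..b}) \<Longrightarrow> y \<in> L2 (lebesgue_on {a..b}) \<Longrightarrow> u \<in> L2 (lebesgue_on {a..b}) \<Longrightarrow>
       (\<And>t. t \<in> {a..b} \<Longrightarrow> x t = \<xi> + integral {a..t} h) \<Longrightarrow>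
       \<phi> (\<lambda>t. (x t, y t, u t)) = \<phi> (\<lambda>t. (\<xi>, 0, 0)) + L2_inner (lebesgue_on {a..b}) w1 h + L2_inner (lebesgue_on {a..b}) w2 y + L2_inner (lebesgue_on {a..b}) w3 u"
proof -
  let ?M = "lebesgue_on {a..b}"
  note fin = finite_measure_lebesgue_on_interval[of a b]
  obtain C where add: "\<And>z w. z \<in> XYU a b \<Longrightarrow> w \<in> XYU a b \<Longrightarrow> \<phi> (\<lambda>t. z t + w t) = \<phi> z + \<phi> w"
    and scale: "\<And>c z. z \<in> XYU a b \<Longrightarrow> \<phi> (\<lambda>t. c *\<^sub>R z t) = c * \<phi> z"
    and bd: "\<And>z. z \<in> XYU a b \<Longrightarrow> \<bar>\<phi> z\<bar> \<le> C * XYU_norm a b z"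
    using \<phi> unfolding bounded_functional_def by blast
  have lin: "\<phi> (\<lambda>t. (x t + c *\<^sub>R x' t, y t + c *\<^sub>R y' t, u t + c *\<^sub>R u' t)) = \<phi> (\<lambda>t. (x t, y t, u t)) + c * \<phi> (\<lambda>t. (x' t, y' t, u' t))"
    if "(\<lambda>t. (x t, y t, u t)) \<in> XYU a b" "(\<lambda>t. (x' t, y' t, u' t)) \<in> XYU a b" for x y u x' y' u' c
  proof -
    have m: "(\<lambda>t. c *\<^sub>R (x' t, y' t, u' t)) \<in> XYU a b"
      using that(2) by (auto simp: XYU_triple intro: AC_scaleR L2_scaleR)
    show ?thesis using add[OF that(1) m] scale[OF that(2), of c] by simp
  qed
  \<comment> \<open>The primitive agrees with \<open>x\<close> on the interval only, so as functions
    on the line they are different arguments of \<phi>. Their difference has seminorm 0, hence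
    \<phi> vanishes on it.\<close>
  have cong: "\<phi> (\<lambda>t. (x t, y t, u t)) = \<phi> (\<lambda>t. (x' t, y t, u t))"
    if m: "(\<lambda>t. (x t, y t, u t)) \<in> XYU a b" and e: "\<And>t. t \<in> {a..b} \<Longrightarrow> x' t = x t" for x x' y u
  proof -
    have "x' \<in> AC a b" using m e by (intro AC_cong[of x a b x']) (auto simp: XYU_triple)
    then have m': "(\<lambda>t. (x' t, y t, u t)) \<in> XYU a b" using m by (simp add: XYU_triple)
    have "XYU_norm a b (\<lambda>t. (x t + (-1) *\<^sub>R x' t, y t + (-1) *\<^sub>R y t, u t + (-1) *\<^sub>R u t)) = 0"
      using AC_norm_eq_0[OF ab, of "\<lambda>t. x t + (-1) *\<^sub>R x' t"] e by (simp add: XYU_norm_def L2_norm_eq_0)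
    moreover have "(\<lambda>t. (x t + (-1) *\<^sub>R x' t, y t + (-1) *\<^sub>R y t, u t + (-1) *\<^sub>R u t)) \<in> XYU a b"
      using m m' by (auto simp only: XYU_triple intro!: AC_add AC_scaleR L2_lincomb(1))
    ultimately have "\<phi> (\<lambda>t. (x t + (-1) *\<^sub>R x' t, y t + (-1) *\<^sub>R y t, u t + (-1) *\<^sub>R u t)) = 0" using bd by fastforce
    then show ?thesis using lin[OF m m', of "-1"] by simp
  qed
  define I :: "(real \<Rightarrow> real^'nx) \<Rightarrow> real \<Rightarrow> real^'nx" where "I h t = integral {a..t} h" for h t
  have I: "I h \<in> AC a b" if "h \<in> L2 ?M" for h unfolding I_def by (rule AC_integral[OF L2_imp_integrable[OF fin that]])
  obtain w1 where w1: "w1 \<in> L2 ?M" "\<And>h. h \<in> L2 ?M \<Longrightarrow> \<phi> (\<lambda>t. (I h t, 0, 0)) = L2_inner ?M w1 h"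
  proof (rule L2_Riesz[OF fin, of "\<lambda>h. \<phi> (\<lambda>t. (I h t, 0, 0))" "\<bar>C\<bar> * 2 * sqrt (measure ?M (space ?M))"])
    fix v w :: "real \<Rightarrow> real^'nx" and s :: real assume v: "v \<in> L2 ?M" and w: "w \<in> L2 ?M"
    note vi = L2_imp_integrable[OF fin v] and wi = L2_imp_integrable[OF fin w]
    \<comment> \<open>Additivity of \<open>I\<close> is claimed on the interval only; beyond it
      \<open>v\<close> and \<open>w\<close> need not be integrable.\<close>
    have "\<phi> (\<lambda>t. (I v t + s *\<^sub>R I w t, 0, 0)) = \<phi> (\<lambda>t. (I (\<lambda>t. v t + s *\<^sub>R w t) t, 0, 0))"
    proof (rule cong)
      show "(\<lambda>t. (I v t + s *\<^sub>R I w t, 0, 0)) \<in> XYU a b"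
        using I[OF v] I[OF w] by (simp add: XYU_triple L2_zero AC_add AC_scaleR)
      show "I (\<lambda>t. v t + s *\<^sub>R w t) t = I v t + s *\<^sub>R I w t" if "t \<in> {a..b}" for t
        using that integral_lebesgue_on_interval(2)[OF vi, of a t] integral_lebesgue_on_interval(2)[OF wi, of a t]
        by (simp add: I_def Henstock_Kurzweil_Integration.integral_add integrable_cmul)
    qed
    then show "\<phi> (\<lambda>t. (I (\<lambda>t. v t + s *\<^sub>R w t) t, 0, 0)) = \<phi> (\<lambda>t. (I v t, 0, 0)) + s * \<phi> (\<lambda>t. (I w t, 0, 0))"
      using lin[of "I v" "\<lambda>_. 0" "\<lambda>_. 0" "I w" "\<lambda>_. 0" "\<lambda>_. 0" s] I[OF v] I[OF w] by (simp add: XYU_triple L2_zero)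
  next
    fix v :: "real \<Rightarrow> real^'nx" assume v: "v \<in> L2 ?M"
    have "XYU_norm a b (\<lambda>t. (I v t, 0::real^'ny, 0::real^'nu)) = AC_norm a b (I v)"
      by (simp add: XYU_norm_def L2_norm_eq_0)
    also have "\<dots> \<le> 2 * (LINT t|?M. norm (v t))"
      unfolding I_def by (rule AC_norm_integral_le[OF ab L2_imp_integrable[OF fin v]])
    also have "\<dots> \<le> 2 * (sqrt (L2_sqnorm ?M v) * sqrt (measure ?M (space ?M)))"
      using L2_imp_integrable_norm(2)[OF fin v] by simp
    finally have n: "XYU_norm a b (\<lambda>t. (I v t, 0::real^'ny, 0::real^'nu)) \<le> 2 * (sqrt (L2_sqnorm ?M v) * sqrt (measure ?M (space ?M)))" .
    have "\<bar>\<phi> (\<lambda>t. (I v t, 0, 0))\<bar> \<le> C * XYU_norm a b (\<lambda>t. (I v t, 0::real^'ny, 0::real^'nu))"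
      using I[OF v] by (intro bd) (simp add: XYU_triple L2_zero)
    \<comment> \<open>The definition of a bounded functional puts no sign on \<open>C\<close>, so
      absolute values are taken before the norm is replaced by its upper bound.\<close>
    also have "\<dots> \<le> \<bar>C\<bar> * \<bar>XYU_norm a b (\<lambda>t. (I v t, 0::real^'ny, 0::real^'nu))\<bar>"
      unfolding abs_mult[symmetric] by (rule abs_ge_self)
    also have "\<dots> \<le> \<bar>C\<bar> * (2 * (sqrt (L2_sqnorm ?M v) * sqrt (measure ?M (space ?M))))"
    proof (intro mult_left_mono)
      have "0 \<le> AC_norm a b (I v)"
      proof -
        have "compact ((\<lambda>t. norm (I v t)) ` {a..b})"
          by (intro compact_continuous_image continuous_intros AC_continuous_on I v) simp
        then have "bdd_above ((\<lambda>t. norm (I v t)) ` {a..b})" by (intro bounded_imp_bdd_above compact_imp_bounded)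
        then have "norm (I v a) \<le> (SUP t\<in>{a..b}. norm (I v t))" using ab by (intro cSUP_upper) auto
        then have "0 \<le> (SUP t\<in>{a..b}. norm (I v t))" by (rule order_trans[OF norm_ge_zero])
        then show ?thesis by (simp add: AC_norm_def)
      qed
      then show "\<bar>XYU_norm a b (\<lambda>t. (I v t, 0::real^'ny, 0::real^'nu))\<bar> \<le> 2 * (sqrt (L2_sqnorm ?M v) * sqrt (measure ?M (space ?M)))"
        using n by (simp add: XYU_norm_def L2_norm_eq_0)
    qed simp
    finally show "\<bar>\<phi> (\<lambda>t. (I v t, 0, 0))\<bar> \<le> \<bar>C\<bar> * 2 * sqrt (measure ?M (space ?M)) * sqrt (L2_sqnorm ?M v)" by (simp add: mult_ac)
  qed (rule that)
  obtain w2 where w2: "w2 \<in> L2 ?M" "\<And>y. y \<in> L2 ?M \<Longrightarrow> \<phi> (\<lambda>t. (0, y t, 0)) = L2_inner ?M w2 y"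
  proof (rule L2_Riesz[OF fin, of "\<lambda>y. \<phi> (\<lambda>t. (0, y t, 0))" C])
    show "\<phi> (\<lambda>t. (0, v t + s *\<^sub>R w t, 0)) = \<phi> (\<lambda>t. (0, v t, 0)) + s * \<phi> (\<lambda>t. (0, w t, 0))"
      if "v \<in> L2 ?M" "w \<in> L2 ?M" for v w s
      using lin[of "\<lambda>_. 0" v "\<lambda>_. 0" "\<lambda>_. 0" w "\<lambda>_. 0" s] that by (simp add: AC_const XYU_triple L2_zero)
    show "\<bar>\<phi> (\<lambda>t. (0, v t, 0))\<bar> \<le> C * sqrt (L2_sqnorm ?M v)" if "v \<in> L2 ?M" for v
      using bd[of "\<lambda>t. (0, v t, 0)"] that by (simp add: AC_const XYU_triple L2_zero XYU_norm_def AC_norm_eq_0[OF ab] L2_norm_eq_0 L2_norm_eq L2_sqnorm_def)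
  qed (rule that)
  obtain w3 where w3: "w3 \<in> L2 ?M" "\<And>u. u \<in> L2 ?M \<Longrightarrow> \<phi> (\<lambda>t. (0, 0, u t)) = L2_inner ?M w3 u"
  proof (rule L2_Riesz[OF fin, of "\<lambda>u. \<phi> (\<lambda>t. (0, 0, u t))" C])
    show "\<phi> (\<lambda>t. (0, 0, v t + s *\<^sub>R w t)) = \<phi> (\<lambda>t. (0, 0, v t)) + s * \<phi> (\<lambda>t. (0, 0, w t))"
      if "v \<in> L2 ?M" "w \<in> L2 ?M" for v w s
      using lin[of "\<lambda>_. 0" "\<lambda>_. 0" v "\<lambda>_. 0" "\<lambda>_. 0" w s] that by (simp add: AC_const XYU_triple L2_zero)
    show "\<bar>\<phi> (\<lambda>t. (0, 0, v t))\<bar> \<le> C * sqrt (L2_sqnorm ?M v)" if "v \<in> L2 ?M" for v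
      using bd[of "\<lambda>t. (0, 0, v t)"] that by (simp add: AC_const XYU_triple L2_zero XYU_norm_def AC_norm_eq_0[OF ab] L2_norm_eq_0 L2_norm_eq L2_sqnorm_def)
  qed (rule that)
  \<comment> \<open>The contribution of the initial value stays unevaluated as \<phi> of a constant
    function; along states with a common initial value it does not change.\<close>
  show thesis
  proof (rule that[OF w1(1) w2(1) w3(1)])
    fix x h :: "real \<Rightarrow> real^'nx" and y :: "real \<Rightarrow> real^'ny" and u :: "real \<Rightarrow> real^'nu" and \<xi> :: "real^'nx"
    assume h: "h \<in> L2 ?M" and y: "y \<in> L2 ?M" and u: "u \<in> L2 ?M" and x: "\<And>t. t \<in> {a..b} \<Longrightarrow> x t = \<xi> + integral {a..t} h"
    note m = AC_add[OF AC_const I[OF h], of \<xi>] I[OF h] y u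
    have "\<phi> (\<lambda>t. (x t, y t, u t)) = \<phi> (\<lambda>t. (\<xi> + I h t, y t, u t))"
    proof (rule cong[symmetric])
      show "(\<lambda>t. (\<xi> + I h t, y t, u t)) \<in> XYU a b" using m by (simp add: XYU_triple L2_zero AC_const)
      show "x t = \<xi> + I h t" if "t \<in> {a..b}" for t using x[OF that] by (simp add: I_def)
    qed
    also have "\<dots> = \<phi> (\<lambda>t. (\<xi> + I h t, y t, 0)) + \<phi> (\<lambda>t. (0, 0, u t))"
      using lin[of "\<lambda>t. \<xi> + I h t" y "\<lambda>_. 0" "\<lambda>_. 0" "\<lambda>_. 0" u 1] m by (simp add: XYU_triple L2_zero AC_const)
    also have "\<phi> (\<lambda>t. (\<xi> + I h t, y t, 0)) = \<phi> (\<lambda>t. (\<xi> + I h t, 0, 0)) + \<phi> (\<lambda>t. (0, y t, 0))"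
      using lin[of "\<lambda>t. \<xi> + I h t" "\<lambda>_. 0" "\<lambda>_. 0" "\<lambda>_. 0" y "\<lambda>_. 0" 1] m by (simp add: XYU_triple L2_zero AC_const)
    also have "\<phi> (\<lambda>t. (\<xi> + I h t, 0, 0)) = \<phi> (\<lambda>t. (\<xi>, 0, 0)) + \<phi> (\<lambda>t. (I h t, 0, 0))"
      using lin[of "\<lambda>t. \<xi>" "\<lambda>_. 0" "\<lambda>_. 0" "I h" "\<lambda>_. 0" "\<lambda>_. 0" 1] m by (simp add: XYU_triple L2_zero AC_const)
    finally show "\<phi> (\<lambda>t. (x t, y t, u t)) = \<phi> (\<lambda>t. (\<xi>, 0, 0)) + L2_inner ?M w1 h + L2_inner ?M w2 y + L2_inner ?M w3 u"
      using w1(2)[OF h] w2(2)[OF y] w3(2)[OF u] by simp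
  qed
qed

section \<open>Weak continuity of the control-to-state map\<close>

context dae
begin

lemma solution_integral:
  assumes u: "u \<in> admissible_controls a b lo hi" and sol: "state_solution f g a b x0 u x y" and t: "t \<in> {a..b}"
  shows "x t = x0 + integral {a..t} (\<lambda>s. F s (x s) (u s))"
proof -
  have "((\<lambda>s. F s (x s) (u s)) has_integral (x t - x a)) {a..t}"
    using t by (intro AE_Y_imp_integral[OF u sol order_refl algebraic_component_eq_Y[OF u sol]]) auto
  then show ?thesis using state_solutionD(3)[OF sol] by (simp add: integral_unique)
qed

text \<open>The state of \<open>v\<close> cannot be estimated directly, since it is not known to lie
  in the tube around \<open>x\<close>. Instead the cut-off solution \<open>z\<close> for
  \<open>v\<close> is compared with \<open>x\<close>; the condition on \<open>c\<close> keeps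
  \<open>z\<close> inside the tube, where the cut-off is inactive, and uniqueness turns
  \<open>z\<close> into the state of \<open>v\<close>.\<close>

lemma solution_perturbation:
  assumes u: "u \<in> admissible_controls a b lo hi" and sol: "state_solution f g a b x0 u x y"
    and v: "v \<in> admissible_controls a b lo hi" and sol': "state_solution f g a b x0 v x' y'"
    and r: "0 < r" and \<kappa>: "\<kappa> \<in> Lp 4 a b" "0 \<le> C" and cb: "\<And>p. p \<in> x ` {a..b} \<Longrightarrow> cball p r \<subseteq> Dx"
    and wb: "AE t in lebesgue_on {a..b}. \<forall>p\<in>x ` {a..b}. well_bounded C (\<kappa> t) t (cball p r)"
    and c: "0 \<le> c" "2 * c * exp (2 * integral {a..b} (\<lambda>t. C * (\<kappa> t)\<^sup>2)) \<le> r"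
    and small: "\<And>t. t \<in> {a..b} \<Longrightarrow> norm (integral {a..t} (\<lambda>s. F s (x s) (v s) - F s (x s) (u s))) \<le> c"
    and t: "t \<in> {a..b}"
  shows "norm (x' t - x t) \<le> 2 * c * exp (2 * integral {a..b} (\<lambda>t. C * (\<kappa> t)\<^sup>2))"
proof -
  note xc = solution_continuous[OF u sol]
  define m where "m t = C * (\<kappa> t)\<^sup>2" for t
  have mi: "integrable (lebesgue_on {a..b}) m" unfolding m_def using Lp4_integrable_powers[OF \<kappa>(1)] by simp
  have m0: "0 \<le> m t" for t using \<kappa>(2) by (simp add: m_def)
  obtain z h where z: "continuous_on {a..b} z" "integrable (lebesgue_on {a..b}) h"
      "\<And>t. t \<in> {a..b} \<Longrightarrow> z t = x0 + integral {a..t} h"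
      "\<And>t. t < a \<Longrightarrow> h t = 0" "\<And>t. a \<le> t \<Longrightarrow> h t = F t (proj r (x t) (z t)) (v t)"
      "AE t in lebesgue_on {a..b}. norm (h t) \<le> C * (\<kappa> t)\<^sup>2"
    by (rule tube_solution[where \<xi> = "x0" and s = a, OF v xc(1,2) r \<kappa>(1,2) cb wb]) (assumption | rule that)+
  have Fi: "integrable (lebesgue_on {a..b}) (\<lambda>s. F s (x s) (w s))" if w: "w \<in> admissible_controls a b lo hi" for w
  proof (rule integrable_bounded_AE[OF YF_measurable(2)[OF xc(1,2) admissible_controlsD(1)[OF w]] mi])
    show "AE s in lebesgue_on {a..b}. norm (F s (x s) (w s)) \<le> m s"
      using wb admissible_controlsD(2)[OF w] AE_space
    proof eventually_elim
      case (elim s)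
      then have "well_bounded C (\<kappa> s) s (cball (x s) r)" by auto
      moreover have "x s \<in> cball (x s) r" using r by simp
      ultimately show ?case using elim(2) unfolding well_bounded_def m_def by blast
    qed
  qed
  have dc: "continuous_on {a..b} (\<lambda>t. norm (z t - x t))" by (intro continuous_intros z xc)
  have est: "norm (z t - x t) \<le> 2 * c * exp (2 * integral {a..b} m)" if t: "t \<in> {a..b}" for t
  proof (rule Gronwall_integral[OF mi m0 dc c(1) _ t])
    fix \<tau> assume \<tau>: "\<tau> \<in> {a..b}"
    have on: "h integrable_on {a..\<tau>}" "(\<lambda>s. F s (x s) (u s)) integrable_on {a..\<tau>}" "(\<lambda>s. F s (x s) (v s)) integrable_on {a..\<tau>}"
      using integral_lebesgue_on_interval(2)[OF z(2), of a \<tau>] integral_lebesgue_on_interval(2)[OF Fi[OF u], of a \<tau>]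
        integral_lebesgue_on_interval(2)[OF Fi[OF v], of a \<tau>] \<tau> by auto
    \<comment> \<open>The first integral compares different states under the same control and is
      handled by the Lipschitz bound; the second compares different controls at the fixed state
      \<open>x\<close> and is small by assumption.\<close>
    have "z \<tau> - x \<tau> = integral {a..\<tau>} (\<lambda>s. h s - F s (x s) (v s)) + integral {a..\<tau>} (\<lambda>s. F s (x s) (v s) - F s (x s) (u s))"
      using z(3)[OF \<tau>] solution_integral[OF u sol \<tau>] on by (simp add: Henstock_Kurzweil_Integration.integral_diff)
    then have "norm (z \<tau> - x \<tau>) \<le> norm (integral {a..\<tau>} (\<lambda>s. h s - F s (x s) (v s))) + norm (integral {a..\<tau>} (\<lambda>s. F s (x s) (v s) - F s (x s) (u s)))"
      by (simp add: norm_triangle_ineq)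
    also have "\<dots> \<le> integral {a..\<tau>} (\<lambda>s. m s * norm (z s - x s)) + c"
    proof (intro add_mono small \<tau> norm_integral_interval_le_AE[where a = a and b = b])
      show "integrable (lebesgue_on {a..b}) (\<lambda>s. h s - F s (x s) (v s))" using z(2) Fi[OF v] by simp
      show "integrable (lebesgue_on {a..b}) (\<lambda>s. m s * norm (z s - x s))" by (rule integrable_mult_continuous[OF mi dc])
      show "AE s in lebesgue_on {a..b}. norm (h s - F s (x s) (v s)) \<le> m s * norm (z s - x s)"
        using wb admissible_controlsD(2)[OF v] AE_space
      proof eventually_elim
        case (elim s)
        have W: "well_bounded C (\<kappa> s) s (cball (x s) r)" using elim by auto
        have "x s \<in> cball (x s) r" using r by simp
        then have "norm (F s (proj r (x s) (z s)) (v s) - F s (x s) (v s)) \<le> C * (\<kappa> s)\<^sup>2 * norm (proj r (x s) (z s) - x s)"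
          using W proj_props(1)[OF r] elim(2) unfolding well_bounded_def by blast
        also have "\<dots> \<le> C * (\<kappa> s)\<^sup>2 * norm (z s - x s)"
          using proj_props(2)[OF r, of "x s" "z s" "x s"] proj_props(3)[of r "x s" "x s"] r \<kappa>(2)
          by (intro mult_left_mono) auto
        finally show ?case using z(5)[of s] elim(3) by (simp add: m_def)
      qed
    qed (use \<tau> in auto)
    finally show "norm (z \<tau> - x \<tau>) \<le> c + integral {a..\<tau>} (\<lambda>s. m s * norm (z s - x s))" by simp
  qed
  have inr: "norm (z t - x t) \<le> r" if "t \<in> {a..b}" for t using est[OF that] c(2) unfolding m_def by linarith
  have zD: "z ` {a..b} \<subseteq> Dx"
  proof
    fix p assume "p \<in> z ` {a..b}"
    then obtain t where t: "t \<in> {a..b}" "p = z t" by auto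
    then have "z t \<in> cball (x t) r" using inr[of t] by (simp add: dist_norm norm_minus_commute)
    then show "p \<in> Dx" using cb[of "x t"] t by auto
  qed
  \<comment> \<open>Pasting at the initial time replaces the entire trajectory, so uniqueness
    applies on the whole interval.\<close>
  have "x' t = z t"
  proof (rule solution_pasting(1)[OF v sol', where s = a and h = h])
    show "a \<in> {a..b}" "t \<in> {a..b}" using ab t by auto
    show "integrable (lebesgue_on {a..b}) h" "z ` {a..b} \<subseteq> Dx" by fact+
    show "z t = x' a + integral {a..t} h" if "t \<in> {a..b}" for t using z(3)[OF that] state_solutionD(3)[OF sol'] by simp
    show "h t = 0" if "t < a" for t using z(4)[OF that] .
    show "AE t in lebesgue_on {a..b}. a \<le> t \<longrightarrow> h t = F t (z t) (v t)"
    proof (rule AE_I2)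
      fix t assume "t \<in> space (lebesgue_on {a..b})"
      then show "a \<le> t \<longrightarrow> h t = F t (z t) (v t)" using z(5)[of t] proj_props(3)[OF r inr[of t]] by auto
    qed
    show "(\<lambda>t. C * \<kappa> t) \<in> Lp 2 a b" using Lp4_integrable_powers[OF \<kappa>(1)] by (simp add: Lp_def power_mult_distrib)
    show "AE t in lebesgue_on {a..b}. a \<le> t \<longrightarrow> norm (Y t (z t) (v t)) \<le> C * \<kappa> t"
      using wb admissible_controlsD(2)[OF v] AE_space
    proof eventually_elim
      case (elim t)
      then have "z t \<in> cball (x t) r" using inr[of t] by (simp add: dist_norm norm_minus_commute)
      moreover have "well_bounded C (\<kappa> t) t (cball (x t) r)" using elim by auto
      ultimately show ?case using elim(2) unfolding well_bounded_def by blast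
    qed
  qed
  then show ?thesis using est[OF t] unfolding m_def by simp
qed

lemma control_bound:
  obtains R where "0 \<le> R" "\<And>u. u \<in> {lo..hi} \<Longrightarrow> norm u \<le> R"
    "\<And>u. u \<in> admissible_controls a b lo hi \<Longrightarrow> AE t in lebesgue_on {a..b}. norm (u t) \<le> R"
proof -
  obtain R where R: "\<And>u. u \<in> {lo..hi} \<Longrightarrow> norm u \<le> R" "R > 0"
    using bounded_cbox[of lo hi] unfolding bounded_pos interval_cbox_cart by blast
  show thesis
  proof (rule that[OF less_imp_le[OF R(2)] R(1)])
    fix u :: "real \<Rightarrow> real^'nu" assume "u \<in> admissible_controls a b lo hi"
    from admissible_controlsD(2)[OF this] show "AE t in lebesgue_on {a..b}. norm (u t) \<le> R"
      by eventually_elim (rule R(1))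
  qed
qed

text \<open>For a fixed trajectory the difference of two values of \<open>F\<close> is linear in the
  difference of the controls; the terms with \<open>y2\<close> and \<open>f3\<close> cancel.
  Transposing the matrices moves them to \<phi>, and the resulting test function for the control is
  integrable, though in general no better.\<close>

lemma weak_star_F:
  fixes \<phi> :: "real \<Rightarrow> real^'nx"
  assumes x: "continuous_on {a..b} x" "x ` {a..b} \<subseteq> Dx"
    and kb: "AE t in lebesgue_on {a..b}. norm (f1 t (x t)) \<le> \<kappa> t \<and> norm (f2 t (x t)) \<le> \<kappa> t \<and> norm (y1 t (x t)) \<le> \<kappa> t"
    and us: "\<And>n. us n \<in> admissible_controls a b lo hi" and u: "u \<in> admissible_controls a b lo hi"
    and ws: "\<And>w. integrable (lebesgue_on {a..b}) w \<Longrightarrow> (\<lambda>n. LINT t|lebesgue_on {a..b}. w t \<bullet> us n t) \<longlonglongrightarrow> (LINT t|lebesgue_on {a..b}. w t \<bullet> u t)"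
    and \<phi>: "\<phi> \<in> borel_measurable (lebesgue_on {a..b})" "integrable (lebesgue_on {a..b}) (\<lambda>t. ((\<kappa> t)\<^sup>2 + \<kappa> t) * norm (\<phi> t))"
  shows "(\<lambda>n. LINT t|lebesgue_on {a..b}. \<phi> t \<bullet> (F t (x t) (us n t) - F t (x t) (u t))) \<longlonglongrightarrow> 0"
proof -
  obtain R where R: "\<And>u. u \<in> admissible_controls a b lo hi \<Longrightarrow> AE t in lebesgue_on {a..b}. norm (u t) \<le> R"
    using control_bound by metis
  note [measurable] = superposition[OF x] \<phi>(1)
  define w where "w t = (\<phi> t v* f1 t (x t)) v* y1 t (x t) + \<phi> t v* f2 t (x t)" for t
  have w: "integrable (lebesgue_on {a..b}) w"
  proof (rule integrable_bounded_AE[OF _ \<phi>(2)])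
    show "w \<in> borel_measurable (lebesgue_on {a..b})" unfolding w_def by measurable
    show "AE t in lebesgue_on {a..b}. norm (w t) \<le> ((\<kappa> t)\<^sup>2 + \<kappa> t) * norm (\<phi> t)" using kb
    proof eventually_elim
      case (elim t)
      have k0: "0 \<le> \<kappa> t" using elim norm_ge_zero order_trans by blast
      have "norm (w t) \<le> norm (y1 t (x t)) * (norm (f1 t (x t)) * norm (\<phi> t)) + norm (f2 t (x t)) * norm (\<phi> t)"
        unfolding w_def
        by (intro norm_triangle_le add_mono order_trans[OF norm_vector_matrix_le] mult_left_mono norm_vector_matrix_le) auto
      also have "\<dots> \<le> \<kappa> t * (\<kappa> t * norm (\<phi> t)) + \<kappa> t * norm (\<phi> t)"
        using elim k0 by (intro add_mono mult_mono) auto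
      finally show ?case by (simp add: power2_eq_square algebra_simps)
    qed
  qed
  have eq: "\<phi> t \<bullet> (F t (x t) p - F t (x t) q) = w t \<bullet> p - w t \<bullet> q" for t p q
  proof -
    have "F t (x t) p - F t (x t) q = f1 t (x t) *v (y1 t (x t) *v (p - q)) + f2 t (x t) *v (p - q)"
      by (simp add: F_def Y_def matrix_vector_mult_diff_distrib matrix_vector_right_distrib)
    then have "\<phi> t \<bullet> (F t (x t) p - F t (x t) q) = w t \<bullet> (p - q)"
      by (simp add: w_def inner_add_left inner_add_right dot_lmul_matrix)
    then show ?thesis by (simp add: inner_diff_right)
  qed
  have int: "integrable (lebesgue_on {a..b}) (\<lambda>t. w t \<bullet> v t)" if "v \<in> admissible_controls a b lo hi" for v
    by (rule integrable_inner_bounded[OF w admissible_controlsD(1)[OF that] R[OF that]])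
  have "(\<lambda>n. (LINT t|lebesgue_on {a..b}. w t \<bullet> us n t) - (LINT t|lebesgue_on {a..b}. w t \<bullet> u t)) \<longlonglongrightarrow> 0"
    using tendsto_diff[OF ws[OF w] tendsto_const[of "LINT t|lebesgue_on {a..b}. w t \<bullet> u t"]] by simp
  then show ?thesis unfolding eq using int[OF us] int[OF u] by simp
qed

lemma weak_star_Y:
  fixes \<phi> :: "real \<Rightarrow> real^'ny"
  assumes x: "continuous_on {a..b} x" "x ` {a..b} \<subseteq> Dx"
    and kb: "AE t in lebesgue_on {a..b}. norm (y1 t (x t)) \<le> \<kappa> t"
    and us: "\<And>n. us n \<in> admissible_controls a b lo hi" and u: "u \<in> admissible_controls a b lo hi"
    and ws: "\<And>w. integrable (lebesgue_on {a..b}) w \<Longrightarrow> (\<lambda>n. LINT t|lebesgue_on {a..b}. w t \<bullet> us n t) \<longlonglongrightarrow> (LINT t|lebesgue_on {a..b}. w t \<bullet> u t)"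
    and \<phi>: "\<phi> \<in> borel_measurable (lebesgue_on {a..b})" "integrable (lebesgue_on {a..b}) (\<lambda>t. \<kappa> t * norm (\<phi> t))"
  shows "(\<lambda>n. LINT t|lebesgue_on {a..b}. \<phi> t \<bullet> (Y t (x t) (us n t) - Y t (x t) (u t))) \<longlonglongrightarrow> 0"
proof -
  obtain R where R: "\<And>u. u \<in> admissible_controls a b lo hi \<Longrightarrow> AE t in lebesgue_on {a..b}. norm (u t) \<le> R"
    using control_bound by metis
  note [measurable] = superposition[OF x] \<phi>(1)
  define w where "w t = \<phi> t v* y1 t (x t)" for t
  have w: "integrable (lebesgue_on {a..b}) w"
  proof (rule integrable_bounded_AE[OF _ \<phi>(2)])
    show "w \<in> borel_measurable (lebesgue_on {a..b})" unfolding w_def by measurable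
    show "AE t in lebesgue_on {a..b}. norm (w t) \<le> \<kappa> t * norm (\<phi> t)" using kb
    proof eventually_elim
      case (elim t)
      have "norm (w t) \<le> norm (y1 t (x t)) * norm (\<phi> t)" unfolding w_def by (rule norm_vector_matrix_le)
      also have "\<dots> \<le> \<kappa> t * norm (\<phi> t)" using elim by (intro mult_right_mono) auto
      finally show ?case .
    qed
  qed
  have eq: "\<phi> t \<bullet> (Y t (x t) p - Y t (x t) q) = w t \<bullet> p - w t \<bullet> q" for t p q
  proof -
    have "Y t (x t) p - Y t (x t) q = y1 t (x t) *v (p - q)"
      by (simp add: Y_def matrix_vector_mult_diff_distrib)
    then have "\<phi> t \<bullet> (Y t (x t) p - Y t (x t) q) = w t \<bullet> (p - q)" by (simp add: w_def dot_lmul_matrix)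
    then show ?thesis by (simp add: inner_diff_right)
  qed
  have int: "integrable (lebesgue_on {a..b}) (\<lambda>t. w t \<bullet> v t)" if "v \<in> admissible_controls a b lo hi" for v
    by (rule integrable_inner_bounded[OF w admissible_controlsD(1)[OF that] R[OF that]])
  have "(\<lambda>n. (LINT t|lebesgue_on {a..b}. w t \<bullet> us n t) - (LINT t|lebesgue_on {a..b}. w t \<bullet> u t)) \<longlonglongrightarrow> 0"
    using tendsto_diff[OF ws[OF w] tendsto_const[of "LINT t|lebesgue_on {a..b}. w t \<bullet> u t"]] by simp
  then show ?thesis unfolding eq using int[OF us] int[OF u] by simp
qed

text \<open>The squared norm is at most C^2 \<kappa>^4. This puts the derivative of each state into
  L^2, as the representation of functionals demands.\<close>

lemma solution_rhs_L2:
  assumes u: "u \<in> admissible_controls a b lo hi" and sol: "state_solution f g a b x0 u x y"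
  shows "(\<lambda>t. F t (x t) (u t)) \<in> L2 (lebesgue_on {a..b})"
proof -
  note xc = solution_continuous[OF u sol]
  obtain r \<kappa> C where r: "r > 0" and \<kappa>: "\<kappa> \<in> Lp 4 a b" "0 \<le> C" "\<And>t. 0 \<le> \<kappa> t"
    and cb: "\<And>p. p \<in> x ` {a..b} \<Longrightarrow> cball p r \<subseteq> Dx"
    and wb: "AE t in lebesgue_on {a..b}. \<forall>p\<in>x ` {a..b}. well_bounded C (\<kappa> t) t (cball p r)"
    by (rule compact_tube[OF xc(3,2)]) (rule that)
  have Fm: "(\<lambda>t. F t (x t) (u t)) \<in> borel_measurable (lebesgue_on {a..b})"
    by (rule YF_measurable(2)[OF xc(1,2) admissible_controlsD(1)[OF u]])
  have "integrable (lebesgue_on {a..b}) (\<lambda>t. (norm (F t (x t) (u t)))\<^sup>2)"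
  proof (rule integrable_bounded_AE[where k = "\<lambda>t. C\<^sup>2 * \<kappa> t ^ 4"])
    show "AE t in lebesgue_on {a..b}. norm ((norm (F t (x t) (u t)))\<^sup>2) \<le> C\<^sup>2 * \<kappa> t ^ 4"
      using wb admissible_controlsD(2)[OF u] AE_space
    proof eventually_elim
      case (elim t)
      then have "well_bounded C (\<kappa> t) t (cball (x t) r)" by auto
      moreover have "x t \<in> cball (x t) r" using r by simp
      ultimately have "norm (F t (x t) (u t)) \<le> C * (\<kappa> t)\<^sup>2" using elim(2) unfolding well_bounded_def by blast
      then have "(norm (F t (x t) (u t)))\<^sup>2 \<le> (C * (\<kappa> t)\<^sup>2)\<^sup>2" by (rule power_mono) simp
      then show ?case by (simp add: power_mult_distrib)
    qed
  qed (use Fm Lp4_integrable_powers[OF \<kappa>(1)] in auto)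
  then show ?thesis by (rule L2I[OF Fm])
qed

text \<open>By the representation of functionals, weak convergence of the triple reduces to weak L^2
  convergence of derivatives, algebraic components and controls. The products of state and control
  are treated by freezing the coefficients at the limit trajectory: only there does weak-*
  convergence of the controls apply, and the error of freezing is uniformly small.\<close>

theorem state_weakly_continuous:
  assumes us: "\<And>n. us n \<in> admissible_controls a b lo hi" and u: "u \<in> admissible_controls a b lo hi"
    and ws: "\<And>w. integrable (lebesgue_on {a..b}) w \<Longrightarrow> (\<lambda>n. LINT t|lebesgue_on {a..b}. w t \<bullet> us n t) \<longlonglongrightarrow> (LINT t|lebesgue_on {a..b}. w t \<bullet> u t)"
    and sols: "\<And>n. state_solution f g a b x0 (us n) (xs n) (ys n)" and sol: "state_solution f g a b x0 u x y"
  shows "weakly_converges (XYU a b) (XYU_norm a b) (\<lambda>n t. (xs n t, ys n t, us n t)) (\<lambda>t. (x t, y t, u t))"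
proof -
  let ?M = "lebesgue_on {a..b}"
  note fin = finite_measure_lebesgue_on_interval[of a b]
  note xc = solution_continuous[OF u sol]
  obtain r \<kappa> C where r: "r > 0" and \<kappa>: "\<kappa> \<in> Lp 4 a b" "0 \<le> C" "\<And>t. 0 \<le> \<kappa> t"
    and cb: "\<And>p. p \<in> x ` {a..b} \<Longrightarrow> cball p r \<subseteq> Dx"
    and wb: "AE t in ?M. \<forall>p\<in>x ` {a..b}. well_bounded C (\<kappa> t) t (cball p r)"
    by (rule compact_tube[OF xc(3,2)]) (rule that)
  note \<kappa>p = Lp4_integrable_powers[OF \<kappa>(1)]
  have wbx: "AE t in ?M. well_bounded C (\<kappa> t) t (cball (x t) r)"
    using wb AE_space by eventually_elim auto
  have xin: "x t \<in> cball (x t) r" for t using r by simp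
  have Fm: "(\<lambda>t. F t (x t) (v t)) \<in> borel_measurable ?M" if "v \<in> admissible_controls a b lo hi" for v
    by (rule YF_measurable(2)[OF xc(1,2) admissible_controlsD(1)[OF that]])
  have Fb: "AE t in ?M. norm (F t (x t) (v t)) \<le> C * (\<kappa> t)\<^sup>2" if "v \<in> admissible_controls a b lo hi" for v
    using wbx admissible_controlsD(2)[OF that] by eventually_elim (use xin in \<open>unfold well_bounded_def, blast\<close>)
  have kb: "AE t in ?M. norm (f1 t (x t)) \<le> \<kappa> t \<and> norm (f2 t (x t)) \<le> \<kappa> t \<and> norm (y1 t (x t)) \<le> \<kappa> t"
    using wbx by eventually_elim (use xin in \<open>unfold well_bounded_def, blast\<close>)
  have mi: "integrable ?M (\<lambda>t. C * (\<kappa> t)\<^sup>2)" using \<kappa>p by simp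
  have kk: "integrable ?M (\<lambda>t. (\<kappa> t)\<^sup>2 + \<kappa> t)" using \<kappa>p by simp
  define D where "D n t = F t (x t) (us n t) - F t (x t) (u t)" for n t
  have Di: "integrable ?M (D n)" for n
    unfolding D_def
    by (intro Bochner_Integration.integrable_diff integrable_bounded_AE[OF Fm mi Fb] us u)
  have pw: "(\<lambda>n. integral {a..t} (D n)) \<longlonglongrightarrow> 0" if t: "t \<in> {a..b}" for t
  proof -
    have "(\<lambda>n. integral {a..t} (D n) \<bullet> i) \<longlonglongrightarrow> 0 \<bullet> i" if i: "i \<in> Basis" for i
    proof -
      \<comment> \<open>A component of the integral up to \<open>t\<close> is a pairing over the
        whole interval with an indicator times a basis vector, which is an admissible test function
        for \<open>weak_star_F\<close>.\<close>
      have eq: "integral {a..t} (D n) \<bullet> i = (LINT s|?M. (indicator {a..t} s *\<^sub>R i) \<bullet> D n s)" for n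
      proof -
        have "integral {a..t} (D n) = (LINT s|lebesgue_on {a..t}. D n s)"
          by (rule integral_lebesgue_on_interval(3)[OF Di]) (use t in auto)
        also have "\<dots> = (LINT s|lebesgue. indicator {a..t} s *\<^sub>R D n s)" by (rule integral_restrict_space) simp
        also have "\<dots> = (LINT s|lebesgue. indicator {a..b} s *\<^sub>R (indicator {a..t} s *\<^sub>R D n s))"
          using t by (intro Bochner_Integration.integral_cong) (auto simp: indicator_def)
        also have "\<dots> = (LINT s|?M. indicator {a..t} s *\<^sub>R D n s)" by (rule integral_restrict_space[symmetric]) simp
        finally have e: "integral {a..t} (D n) = (LINT s|?M. indicator {a..t} s *\<^sub>R D n s)" .
        have "integrable ?M (\<lambda>s. indicator {a..t} s *\<^sub>R D n s)"
        proof (rule integrable_bounded_AE[OF _ integrable_norm[OF Di]])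
          have "(\<lambda>s. indicator {a..t} s :: real) \<in> borel_measurable ?M" by (intro measurable_restrict_space1 borel_measurable_indicator) simp
          then show "(\<lambda>s. indicator {a..t} s *\<^sub>R D n s) \<in> borel_measurable ?M" using Di[of n] by measurable
          show "AE s in ?M. norm (indicator {a..t} s *\<^sub>R D n s) \<le> norm (D n s)" by (simp add: indicator_def)
        qed
        then have "(LINT s|?M. indicator {a..t} s *\<^sub>R D n s) \<bullet> i = (LINT s|?M. (indicator {a..t} s *\<^sub>R D n s) \<bullet> i)"
          by (rule integral_inner_left[symmetric])
        then show ?thesis using e by (simp add: inner_commute)
      qed
      have im: "(\<lambda>s. indicator {a..t} s *\<^sub>R i) \<in> borel_measurable ?M"
        by (intro measurable_restrict_space1 borel_measurable_scaleR borel_measurable_indicator) auto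
      have "(\<lambda>n. LINT s|?M. (indicator {a..t} s *\<^sub>R i) \<bullet> (F s (x s) (us n s) - F s (x s) (u s))) \<longlonglongrightarrow> 0"
      proof (rule weak_star_F[OF xc(1,2) kb us u ws im])
        show "integrable ?M (\<lambda>s. ((\<kappa> s)\<^sup>2 + \<kappa> s) * norm (indicator {a..t} s *\<^sub>R i))"
        proof (rule integrable_bounded_AE[OF _ kk])
          show "(\<lambda>s. ((\<kappa> s)\<^sup>2 + \<kappa> s) * norm (indicator {a..t} s *\<^sub>R i)) \<in> borel_measurable ?M" using im \<kappa>p(4) by measurable
          show "AE s in ?M. norm (((\<kappa> s)\<^sup>2 + \<kappa> s) * norm (indicator {a..t} s *\<^sub>R i)) \<le> (\<kappa> s)\<^sup>2 + \<kappa> s"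
            using \<kappa>(3) i by (auto simp: indicator_def)
        qed
      qed
      then show ?thesis unfolding eq D_def by simp
    qed
    then show ?thesis by (subst tendsto_componentwise_iff) auto
  qed
  define E where "E = exp (2 * integral {a..b} (\<lambda>t. C * (\<kappa> t)\<^sup>2))"
  have E: "E > 0" by (simp add: E_def)
  have unif: "\<forall>\<^sub>F n in sequentially. \<forall>t\<in>{a..b}. norm (xs n t - x t) \<le> e" if e: "0 < e" for e
  proof -
    \<comment> \<open>Chosen so that the bound of \<open>solution_perturbation\<close> equals
      \<open>min e r\<close>: at most \<open>e\<close> as desired, and at most \<open>r\<close> as
      its hypothesis requires.\<close>
    define c where "c = min e r / (2 * E)"
    have c: "0 < c" "2 * c * E = min e r" using e r E by (auto simp: c_def)
    have "\<forall>\<^sub>F n in sequentially. \<forall>t\<in>{a..b}. norm (integral {a..t} (D n)) < c"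
    proof (rule uniform_integral_convergence[OF Di _ _ pw c(1)])
      show "integrable ?M (\<lambda>t. 2 * (C * (\<kappa> t)\<^sup>2))" using mi by simp
      show "AE t in ?M. norm (D n t) \<le> 2 * (C * (\<kappa> t)\<^sup>2)" for n
        using Fb[OF us[of n]] Fb[OF u]
      proof eventually_elim
        case (elim t)
        then show ?case unfolding D_def using norm_triangle_ineq4[of "F t (x t) (us n t)" "F t (x t) (u t)"] by linarith
      qed
    qed
    then show ?thesis
    proof eventually_elim
      case (elim n)
      show ?case
      proof
        fix t assume t: "t \<in> {a..b}"
        have "norm (xs n t - x t) \<le> 2 * c * exp (2 * integral {a..b} (\<lambda>t. C * (\<kappa> t)\<^sup>2))"
        proof (rule solution_perturbation[OF u sol us[of n] sols[of n] r \<kappa>(1,2) cb wb _ _ _ t])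
          show "2 * c * exp (2 * integral {a..b} (\<lambda>t. C * (\<kappa> t)\<^sup>2)) \<le> r" using c(2) by (simp add: E_def)
          show "norm (integral {a..t} (\<lambda>s. F s (x s) (us n s) - F s (x s) (u s))) \<le> c" if "t \<in> {a..b}" for t
            using elim that unfolding D_def by (meson less_imp_le)
        qed (use c in auto)
        also have "\<dots> \<le> e" using c(2) by (simp add: E_def)
        finally show "norm (xs n t - x t) \<le> e" .
      qed
    qed
  qed
  have close: "\<forall>\<^sub>F n in sequentially. AE t in ?M. norm (F t (xs n t) (us n t) - F t (x t) (us n t)) \<le> e * (C * (\<kappa> t)\<^sup>2) \<and>
      norm (Y t (xs n t) (us n t) - Y t (x t) (us n t)) \<le> e * (C * \<kappa> t)" if e: "0 < e" for e
  proof -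
    \<comment> \<open>The minimum with \<open>r\<close> places \<open>xs n\<close> in the tube,
      where the Lipschitz bounds are valid.\<close>
    have mr: "0 < min e r" using e r by simp
    show ?thesis using unif[OF mr]
    proof eventually_elim
      case (elim n)
      note en = elim
      show ?case using wbx admissible_controlsD(2)[OF us[of n]] AE_space
      proof eventually_elim
        case (elim t)
        have d: "norm (xs n t - x t) \<le> min e r" using en elim(3) by auto
        then have xn: "xs n t \<in> cball (x t) r" by (simp add: dist_norm norm_minus_commute)
        have "norm (F t (xs n t) (us n t) - F t (x t) (us n t)) \<le> C * (\<kappa> t)\<^sup>2 * norm (xs n t - x t)"
          "norm (Y t (xs n t) (us n t) - Y t (x t) (us n t)) \<le> C * \<kappa> t * norm (xs n t - x t)"
          using elim(1,2) xn xin unfolding well_bounded_def by blast+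
        moreover have "C * (\<kappa> t)\<^sup>2 * norm (xs n t - x t) \<le> C * (\<kappa> t)\<^sup>2 * e" "C * \<kappa> t * norm (xs n t - x t) \<le> C * \<kappa> t * e"
          using d \<kappa>(2,3) by (auto intro!: mult_left_mono)
        ultimately show ?case by (simp add: mult_ac)
      qed
    qed
  qed
  have \<kappa>L: "(\<lambda>t. (\<kappa> t)\<^sup>2) \<in> L2 ?M" "\<kappa> \<in> L2 ?M" using \<kappa>p by (auto simp: L2_def)
  have prod: "integrable ?M (\<lambda>t. k t * norm (w t))" if k: "k \<in> L2 ?M" and w: "w \<in> L2 ?M"
    for k :: "real \<Rightarrow> real" and w :: "real \<Rightarrow> 'z::euclidean_space"
  proof -
    have "(\<lambda>t. norm (w t)) \<in> L2 ?M" using w by (auto simp: L2_def)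
    then show ?thesis using L2_inner_integrable[OF k, of "\<lambda>t. norm (w t)"] by simp
  qed
  have ysL: "ys n \<in> L2 ?M" "xs n \<in> AC a b" "us n \<in> L2 ?M" for n
    using state_solutionD[OF sols[of n]] us[of n] by (auto simp: Lp2_L2 admissible_controls_def)
  have yL: "y \<in> L2 ?M" "x \<in> AC a b" "u \<in> L2 ?M"
    using state_solutionD[OF sol] u by (auto simp: Lp2_L2 admissible_controls_def)
  have xcn: "continuous_on {a..b} (xs n)" "xs n ` {a..b} \<subseteq> Dx" for n using solution_continuous[OF us[of n] sols[of n]] by auto
  have lim1: "(\<lambda>n. L2_inner ?M w (\<lambda>t. F t (xs n t) (us n t))) \<longlonglongrightarrow> L2_inner ?M w (\<lambda>t. F t (x t) (u t))" if w: "w \<in> L2 ?M" for w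
  proof -
    have [measurable]: "w \<in> borel_measurable ?M" using w by measurable
    have [measurable]: "(\<lambda>t. F t (xs n t) (us n t)) \<in> borel_measurable ?M" "(\<lambda>t. F t (x t) (us n t)) \<in> borel_measurable ?M" for n
      using YF_measurable(2)[OF xcn[of n] admissible_controlsD(1)[OF us[of n]]] Fm[OF us[of n]] by auto
    \<comment> \<open>\<open>A\<close> is the error of replacing \<open>xs n\<close> by
      \<open>x\<close> under the same control; \<open>B\<close> then changes the control with
      coefficients frozen at \<open>x\<close>.\<close>
    have A: "(\<lambda>n. LINT t|?M. w t \<bullet> (F t (xs n t) (us n t) - F t (x t) (us n t))) \<longlonglongrightarrow> 0"
    proof (rule integral_tendsto_0_of_small)
      show "integrable ?M (\<lambda>t. C * ((\<kappa> t)\<^sup>2 * norm (w t)))" using prod[OF \<kappa>L(1) w] by simp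
      show "0 \<le> C * ((\<kappa> t)\<^sup>2 * norm (w t))" for t using \<kappa>(2) by simp
      show "(\<lambda>t. w t \<bullet> (F t (xs n t) (us n t) - F t (x t) (us n t))) \<in> borel_measurable ?M" for n by measurable
      fix e :: real assume "0 < e"
      from close[OF this]
      show "\<forall>\<^sub>F n in sequentially. AE t in ?M. \<bar>w t \<bullet> (F t (xs n t) (us n t) - F t (x t) (us n t))\<bar> \<le> e * (C * ((\<kappa> t)\<^sup>2 * norm (w t)))"
      proof eventually_elim
        case (elim n)
        then show ?case
        proof eventually_elim
          case (elim t)
          have "\<bar>w t \<bullet> (F t (xs n t) (us n t) - F t (x t) (us n t))\<bar> \<le> norm (w t) * norm (F t (xs n t) (us n t) - F t (x t) (us n t))"
            by (rule Cauchy_Schwarz_ineq2)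
          also have "\<dots> \<le> norm (w t) * (e * (C * (\<kappa> t)\<^sup>2))" using elim by (intro mult_left_mono) auto
          finally show ?case by (simp add: mult_ac)
        qed
      qed
    qed
    have B: "(\<lambda>n. LINT t|?M. w t \<bullet> (F t (x t) (us n t) - F t (x t) (u t))) \<longlonglongrightarrow> 0"
    proof (rule weak_star_F[OF xc(1,2) kb us u ws])
      show "integrable ?M (\<lambda>t. ((\<kappa> t)\<^sup>2 + \<kappa> t) * norm (w t))"
        using prod[OF \<kappa>L(1) w] prod[OF \<kappa>L(2) w] by (simp add: distrib_right)
    qed measurable
    have FL: "(\<lambda>t. F t (x t) (v t)) \<in> L2 ?M" if v: "v \<in> admissible_controls a b lo hi" for v
    proof (rule L2I[OF Fm[OF v] integrable_bounded_AE[where k = "\<lambda>t. C\<^sup>2 * \<kappa> t ^ 4"]])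
      show "AE t in ?M. norm ((norm (F t (x t) (v t)))\<^sup>2) \<le> C\<^sup>2 * \<kappa> t ^ 4" using Fb[OF v]
      proof eventually_elim
        case (elim t)
        then have "(norm (F t (x t) (v t)))\<^sup>2 \<le> (C * (\<kappa> t)\<^sup>2)\<^sup>2" by (rule power_mono) simp
        then show ?case by (simp add: power_mult_distrib)
      qed
    qed (use Fm[OF v] \<kappa>p in auto)
    have "L2_inner ?M w (\<lambda>t. F t (xs n t) (us n t)) = (LINT t|?M. w t \<bullet> (F t (xs n t) (us n t) - F t (x t) (us n t))) +
      (LINT t|?M. w t \<bullet> (F t (x t) (us n t) - F t (x t) (u t))) + L2_inner ?M w (\<lambda>t. F t (x t) (u t))" for n
      using L2_inner_diff[OF solution_rhs_L2[OF us[of n] sols[of n]] FL[OF us[of n]] w] L2_inner_diff[OF FL[OF us[of n]] FL[OF u] w]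
      by (simp add: L2_inner_def)
    then show ?thesis using tendsto_add[OF tendsto_add[OF A B] tendsto_const, of "L2_inner ?M w (\<lambda>t. F t (x t) (u t))"] by simp
  qed
  have lim2: "(\<lambda>n. L2_inner ?M w (ys n)) \<longlonglongrightarrow> L2_inner ?M w y" if w: "w \<in> L2 ?M" for w
  proof -
    have [measurable]: "w \<in> borel_measurable ?M" using w by measurable
    have Ym: "(\<lambda>t. Y t (x t) (v t)) \<in> borel_measurable ?M" if "v \<in> admissible_controls a b lo hi" for v
      by (rule YF_measurable(1)[OF xc(1,2) admissible_controlsD(1)[OF that]])
    have YL: "(\<lambda>t. Y t (x t) (v t)) \<in> L2 ?M" if v: "v \<in> admissible_controls a b lo hi" for v
    proof (rule L2I[OF Ym[OF v] integrable_bounded_AE[where k = "\<lambda>t. C\<^sup>2 * (\<kappa> t)\<^sup>2"]])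
      show "AE t in ?M. norm ((norm (Y t (x t) (v t)))\<^sup>2) \<le> C\<^sup>2 * (\<kappa> t)\<^sup>2"
        using wbx admissible_controlsD(2)[OF v]
      proof eventually_elim
        case (elim t)
        then have "norm (Y t (x t) (v t)) \<le> C * \<kappa> t" using xin unfolding well_bounded_def by blast
        then have "(norm (Y t (x t) (v t)))\<^sup>2 \<le> (C * \<kappa> t)\<^sup>2" by (rule power_mono) simp
        then show ?case by (simp add: power_mult_distrib)
      qed
    qed (use Ym[OF v] \<kappa>p in auto)
    note yn = algebraic_component_eq_Y[OF us sols]
    have A: "(\<lambda>n. LINT t|?M. w t \<bullet> (ys n t - Y t (x t) (us n t))) \<longlonglongrightarrow> 0"
    proof (rule integral_tendsto_0_of_small)
      show "integrable ?M (\<lambda>t. C * (\<kappa> t * norm (w t)))" using prod[OF \<kappa>L(2) w] by simp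
      show "0 \<le> C * (\<kappa> t * norm (w t))" for t using \<kappa>(2,3) by simp
      show "(\<lambda>t. w t \<bullet> (ys n t - Y t (x t) (us n t))) \<in> borel_measurable ?M" for n
        using ysL(1)[of n] Ym[OF us[of n]] by measurable
      fix e :: real assume "0 < e"
      from close[OF this]
      show "\<forall>\<^sub>F n in sequentially. AE t in ?M. \<bar>w t \<bullet> (ys n t - Y t (x t) (us n t))\<bar> \<le> e * (C * (\<kappa> t * norm (w t)))"
      proof eventually_elim
        case (elim n)
        then show ?case using yn[of n]
        proof eventually_elim
          case (elim t)
          have "\<bar>w t \<bullet> (ys n t - Y t (x t) (us n t))\<bar> \<le> norm (w t) * norm (ys n t - Y t (x t) (us n t))"
            by (rule Cauchy_Schwarz_ineq2)
          also have "\<dots> \<le> norm (w t) * (e * (C * \<kappa> t))" using elim by (intro mult_left_mono) auto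
          finally show ?case by (simp add: mult_ac)
        qed
      qed
    qed
    have B: "(\<lambda>n. LINT t|?M. w t \<bullet> (Y t (x t) (us n t) - Y t (x t) (u t))) \<longlonglongrightarrow> 0"
    proof (rule weak_star_Y[OF xc(1,2) _ us u ws])
      show "AE t in ?M. norm (y1 t (x t)) \<le> \<kappa> t" using kb by eventually_elim auto
    qed (use prod[OF \<kappa>L(2) w] in auto)
    have "L2_inner ?M w y = L2_inner ?M w (\<lambda>t. Y t (x t) (u t))"
      unfolding L2_inner_def using algebraic_component_eq_Y[OF u sol] yL(1) YL[OF u]
      by (intro integral_cong_AE) (auto elim: eventually_mono)
    then have "L2_inner ?M w (ys n) = (LINT t|?M. w t \<bullet> (ys n t - Y t (x t) (us n t))) +
      (LINT t|?M. w t \<bullet> (Y t (x t) (us n t) - Y t (x t) (u t))) + L2_inner ?M w y" for n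
      using L2_inner_diff[OF ysL(1)[of n] YL[OF us[of n]] w] L2_inner_diff[OF YL[OF us[of n]] YL[OF u] w]
      by (simp add: L2_inner_def)
    then show ?thesis using tendsto_add[OF tendsto_add[OF A B] tendsto_const, of "L2_inner ?M w y"] by simp
  qed
  have lim3: "(\<lambda>n. L2_inner ?M w (us n)) \<longlonglongrightarrow> L2_inner ?M w u" if w: "w \<in> L2 ?M" for w
    using ws[OF L2_imp_integrable[OF fin w]] by (simp add: L2_inner_def)
  show ?thesis
    unfolding weakly_converges_def
  proof (intro conjI allI impI)
    show "(\<lambda>t. (xs n t, ys n t, us n t)) \<in> XYU a b" for n using ysL by (simp add: XYU_triple)
    show "(\<lambda>t. (x t, y t, u t)) \<in> XYU a b" using yL by (simp add: XYU_triple)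
    fix \<phi> :: "(real \<Rightarrow> (real^'nx) \<times> (real^'ny) \<times> (real^'nu)) \<Rightarrow> real"
    assume \<phi>: "bounded_functional (XYU a b) (XYU_norm a b) \<phi>"
    show "(\<lambda>n. \<phi> (\<lambda>t. (xs n t, ys n t, us n t))) \<longlonglongrightarrow> \<phi> (\<lambda>t. (x t, y t, u t))"
    proof (rule XYU_functional_representation[OF ab \<phi>])
      fix w1 w2 w3
      assume w: "w1 \<in> L2 ?M" "w2 \<in> L2 ?M" "w3 \<in> L2 ?M"
        and rep: "\<And>x h y u \<xi>. h \<in> L2 ?M \<Longrightarrow> y \<in> L2 ?M \<Longrightarrow> u \<in> L2 ?M \<Longrightarrow> (\<And>t. t \<in> {a..b} \<Longrightarrow> x t = \<xi> + integral {a..t} h) \<Longrightarrow>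
          \<phi> (\<lambda>t. (x t, y t, u t)) = \<phi> (\<lambda>t. (\<xi>, 0, 0)) + L2_inner ?M w1 h + L2_inner ?M w2 y + L2_inner ?M w3 u"
      have "\<phi> (\<lambda>t. (xs n t, ys n t, us n t)) = \<phi> (\<lambda>t. (x0, 0, 0)) + L2_inner ?M w1 (\<lambda>t. F t (xs n t) (us n t)) + L2_inner ?M w2 (ys n) + L2_inner ?M w3 (us n)" for n
        by (rule rep[OF solution_rhs_L2[OF us sols] ysL(1,3) solution_integral[OF us sols]])
      moreover have "\<phi> (\<lambda>t. (x t, y t, u t)) = \<phi> (\<lambda>t. (x0, 0, 0)) + L2_inner ?M w1 (\<lambda>t. F t (x t) (u t)) + L2_inner ?M w2 y + L2_inner ?M w3 u"
        by (rule rep[OF solution_rhs_L2[OF u sol] yL(1,3) solution_integral[OF u sol]])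
      ultimately show ?thesis
        by (simp only:) (intro tendsto_intros lim1 lim2 lim3 w)
    qed
  qed
qed

end

section \<open>Existence of an optimal control by the direct method\<close>

theorem theorem3p9:
  fixes t0 tf te :: real
    and ua ub :: "real^'nu"
    and f0 :: "real \<Rightarrow> real^'nx \<Rightarrow> real^'ny \<Rightarrow> real^'nu \<Rightarrow> real"
    and f :: "real \<Rightarrow> real^'nx \<Rightarrow> real^'ny \<Rightarrow> real^'nu \<Rightarrow> real^'nx"
    and g :: "real \<Rightarrow> real^'nx \<Rightarrow> real^'ny \<Rightarrow> real^'nu \<Rightarrow> real^'ny"
    and X0 Dx :: "(real^'nx) set" and Dy :: "(real^'ny) set"
    and x0 :: "real^'nx"
  assumes "0 \<le> t0" and "t0 < tf" and "ua \<le> ub"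
    and index1: "\<forall>u\<in>admissible_controls t0 tf ua ub. index_one g t0 tf Dx Dy u"
    and consistent: "\<exists>u\<in>admissible_controls t0 tf ua ub. x0 \<in> X0 \<inter> consistent_values g Dx Dy u t0"
    and F: "assumption_F f t0 tf ua ub Dx Dy"
    and Y: "assumption_Y f g t0 tf ua ub X0 Dx Dy"
    and te: "existence_time f g t0 tf ua ub Dx x0 te"
    and T: "te = tf"
    and J_real: "\<forall>x\<in>AC t0 tf. \<forall>y\<in>Lp 2 t0 tf. \<forall>u\<in>admissible_controls t0 tf ua ub.
                   integrable (lebesgue_on {t0..tf}) (\<lambda>t. f0 t (x t) (y t) (u t))"
    and J_nonneg: "\<forall>x\<in>AC t0 tf. \<forall>y\<in>Lp 2 t0 tf. \<forall>u\<in>admissible_controls t0 tf ua ub.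
                     0 \<le> cost f0 t0 tf x y u"
    and J_wlsc: "weakly_lsc_cost (cost f0 t0 tf) t0 tf ua ub"
  shows "\<exists>x\<in>AC t0 tf. \<exists>y\<in>Lp 2 t0 tf. \<exists>u\<in>admissible_controls t0 tf ua ub.
           feasible f g t0 tf ua ub x0 x y u \<and>
           (\<forall>x' y' u'. feasible f g t0 tf ua ub x0 x' y' u' \<longrightarrow>
              cost f0 t0 tf x y u \<le> cost f0 t0 tf x' y' u')"
proof -
  let ?M = "lebesgue_on {t0..tf}"
  obtain f1 :: "real \<Rightarrow> real^'nx \<Rightarrow> real^'ny^'nx" and f2 :: "real \<Rightarrow> real^'nx \<Rightarrow> real^'nu^'nx" and f3 :: "real \<Rightarrow> real^'nx \<Rightarrow> real^'nx" where
    D: "open Dx" "Dx \<noteq> {}" "open Dy" "Dy \<noteq> {}"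
    and F1: "\<forall>t\<in>{t0..tf}. \<forall>x\<in>Dx. \<forall>y\<in>Dy. \<forall>u\<in>{ua..ub}. f t x y u = f1 t x *v y + f2 t x *v u + f3 t x"
    and F2: "\<forall>x\<in>Dx. (\<lambda>t. f1 t x) \<in> borel_measurable ?M \<and> (\<lambda>t. f2 t x) \<in> borel_measurable ?M \<and> (\<lambda>t. f3 t x) \<in> borel_measurable ?M"
    and F3: "AE t in ?M. continuous_on Dx (f1 t) \<and> continuous_on Dx (f2 t) \<and> continuous_on Dx (f3 t)"
    and F4: "\<forall>z0\<in>Dx \<times> Dy. \<exists>\<rho>>0. \<exists>\<alpha>1\<in>Lp 4 t0 tf. \<exists>\<alpha>2\<in>Lp 4 t0 tf. ball z0 \<rho> \<subseteq> Dx \<times> Dy \<and>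
           (AE t in ?M. \<forall>z\<in>ball z0 \<rho>. \<forall>w\<in>ball z0 \<rho>. \<forall>u\<in>{ua..ub}.
              norm (f t (fst z) (snd z) u - f t (fst w) (snd w) u) \<le> (\<alpha>1 t * norm u + \<alpha>2 t) * norm (z - w))"
    and F5: "\<forall>xc\<in>Dx. \<exists>\<rho>>0. \<exists>\<iota>1\<in>Lp 4 t0 tf. \<exists>\<iota>2\<in>Lp 4 t0 tf. \<exists>\<iota>3\<in>Lp 4 t0 tf. ball xc \<rho> \<subseteq> Dx \<and>
           (AE t in ?M. \<forall>x\<in>ball xc \<rho>. norm (f1 t x) \<le> \<iota>1 t \<and> norm (f2 t x) \<le> \<iota>2 t \<and> norm (f3 t x) \<le> \<iota>3 t)"
    using F unfolding assumption_F_def by (elim conjE exE) (rule that)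
  obtain yy :: "real \<Rightarrow> real^'nx \<Rightarrow> real^'nu \<Rightarrow> real^'ny" and y1 :: "real \<Rightarrow> real^'nx \<Rightarrow> real^'nu^'ny" and y2 :: "real \<Rightarrow> real^'nx \<Rightarrow> real^'ny" where
    Y1: "AE t in ?M. \<forall>x\<in>Dx. \<forall>u\<in>{ua..ub}. g t x (yy t x u) u = 0"
    and Y2: "AE t in ?M. \<forall>x\<in>Dx. \<forall>u\<in>{ua..ub}. yy t x u = y1 t x *v u + y2 t x"
    and Y3: "AE t in ?M. \<forall>x\<in>Dx. \<forall>u\<in>{ua..ub}. yy t x u \<in> Dy"
    and Y4: "\<forall>x\<in>Dx. (\<lambda>t. y1 t x) \<in> borel_measurable ?M \<and> (\<lambda>t. y2 t x) \<in> borel_measurable ?M"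
    and Y5: "AE t in ?M. continuous_on Dx (y1 t) \<and> continuous_on Dx (y2 t)"
    and Y6: "\<forall>xc\<in>Dx. \<exists>\<rho>>0. \<exists>\<gamma>1\<in>Lp 4 t0 tf. \<exists>\<gamma>2\<in>Lp 4 t0 tf. ball xc \<rho> \<subseteq> Dx \<and>
           (AE t in ?M. \<forall>x\<in>ball xc \<rho>. \<forall>w\<in>ball xc \<rho>.
              norm (y1 t x - y1 t w) \<le> \<gamma>1 t * norm (x - w) \<and> norm (y2 t x - y2 t w) \<le> \<gamma>2 t * norm (x - w))"
    and Y7: "\<forall>xc\<in>Dx. \<exists>\<rho>>0. \<exists>\<kappa>1\<in>Lp 4 t0 tf. \<exists>\<kappa>2\<in>Lp 4 t0 tf. ball xc \<rho> \<subseteq> Dx \<and>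
           (AE t in ?M. \<forall>x\<in>ball xc \<rho>. norm (y1 t x) \<le> \<kappa>1 t \<and> norm (y2 t x) \<le> \<kappa>2 t)"
    using Y unfolding assumption_Y_def by (elim conjE exE) (rule that)
  have E: "\<forall>u\<in>admissible_controls t0 tf ua ub. (\<exists>x y. state_solution f g t0 tf x0 u x y) \<and>
        (\<forall>x y x' y'. state_solution f g t0 tf x0 u x y \<and> state_solution f g t0 tf x0 u x' y' \<longrightarrow>
           (\<forall>t\<in>{t0..tf}. x t = x' t) \<and> (AE t in ?M. y t = y' t))"
    using te unfolding T existence_time_def by (elim conjE)
  obtain \<rho> where B: "ball x0 \<rho> \<subseteq> Dx" "\<forall>u\<in>admissible_controls t0 tf ua ub. \<forall>x y. state_solution f g t0 tf x0 u x y \<longrightarrow>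
           (\<forall>t\<in>{t0..tf}. x t \<in> ball x0 \<rho>)"
    using te unfolding T existence_time_def by (elim conjE exE) (rule that)
  interpret dae t0 tf ua ub f g Dx Dy x0 f1 f2 f3 y1 y2
  proof
    show "AE t in ?M. \<forall>x\<in>Dx. \<forall>u\<in>{ua..ub}. g t x (y1 t x *v u + y2 t x) u = 0 \<and> y1 t x *v u + y2 t x \<in> Dy"
      using Y1 Y2 Y3
    proof eventually_elim
      case (elim t)
      show ?case
      proof (intro ballI)
        fix x u assume xu: "x \<in> Dx" "u \<in> {ua..ub}"
        have e: "yy t x u = y1 t x *v u + y2 t x" using elim(2) xu by blast
        show "g t x (y1 t x *v u + y2 t x) u = 0 \<and> y1 t x *v u + y2 t x \<in> Dy"
          unfolding e[symmetric] using elim(1,3) xu by blast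
      qed
    qed
    show "x t \<in> Dx" if "u \<in> admissible_controls t0 tf ua ub" "state_solution f g t0 tf x0 u x y" "t \<in> {t0..tf}" for u x y t
      using B that by blast
  qed (use assms(2) D F1 F2 F3 F4 F5 Y4 Y5 Y6 Y7 E in \<open>blast\<close>)+
  define feas where "feas = (\<lambda>(x, y, u). feasible f g t0 tf ua ub x0 x y u)"
  define J where "J = (\<lambda>(x, y, u). cost f0 t0 tf x y u)"
  have mem: "x \<in> AC t0 tf" "y \<in> Lp 2 t0 tf" "u \<in> admissible_controls t0 tf ua ub" "state_solution f g t0 tf x0 u x y"
    if "feas (x, y, u)" for x y u
    using that state_solutionD[of f g t0 tf x0 u x y] by (auto simp: feas_def feasible_def)
  have J0: "0 \<le> J z" if "feas z" for z
    using J_nonneg mem that by (cases z) (auto simp: J_def)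
  define S where "S = J ` {z. feas z}"
  \<comment> \<open>The consistency assumption supplies an admissible control, and every admissible
    control has a state; so the infimum is that of a nonempty set.\<close>
  have "S \<noteq> {}"
  proof -
    obtain u where u: "u \<in> admissible_controls t0 tf ua ub" using consistent by blast
    then obtain x y where "state_solution f g t0 tf x0 u x y" using solution_exists by blast
    then have "feas (x, y, u)" using u by (simp add: feas_def feasible_def)
    then show ?thesis by (auto simp: S_def)
  qed
  have bdd: "bdd_below S" using J0 by (auto simp: S_def intro!: bdd_belowI2)
  have "\<exists>z. feas z \<and> J z < Inf S + 1 / real (Suc n)" for n
    using cInf_lessD[OF \<open>S \<noteq> {}\<close>, of "Inf S + 1 / real (Suc n)"] by (auto simp: S_def)
  then obtain z where z: "\<And>n. feas (z n)" "\<And>n. J (z n) < Inf S + 1 / real (Suc n)" by metis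
  define xs where "xs n = fst (z n)" for n
  define ys where "ys n = fst (snd (z n))" for n
  define us where "us n = snd (snd (z n))" for n
  have zn: "z n = (xs n, ys n, us n)" for n by (simp add: xs_def ys_def us_def)
  have us: "us n \<in> admissible_controls t0 tf ua ub" and sols: "state_solution f g t0 tf x0 (us n) (xs n) (ys n)"
    and xsAC: "xs n \<in> AC t0 tf" and ysL: "ys n \<in> Lp 2 t0 tf" for n
    using mem[of "xs n" "ys n" "us n"] z(1)[of n] by (simp_all add: zn)
  have usb: "AE t in ?M. us n t \<in> cbox ua ub" for n
    using admissible_controlsD(2)[OF us[of n]] by (simp add: interval_cbox_cart)
  obtain r u where r: "strict_mono (r :: nat \<Rightarrow> nat)" and um: "u \<in> borel_measurable ?M" and uc: "AE t in ?M. u t \<in> cbox ua ub"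
    and ws: "\<And>w. integrable ?M w \<Longrightarrow> (\<lambda>n. LINT t|?M. w t \<bullet> us (r n) t) \<longlonglongrightarrow> (LINT t|?M. w t \<bullet> u t)"
    by (rule weak_star_compact_cbox[OF finite_measure_lebesgue_on_interval admissible_controlsD(1)[OF us] usb]) (rule that)
  have u: "u \<in> admissible_controls t0 tf ua ub"
    by (rule admissible_controlsI[OF um]) (use uc in \<open>simp add: interval_cbox_cart\<close>)
  obtain x y where sol: "state_solution f g t0 tf x0 u x y" using solution_exists[OF u] by blast
  have fz: "feas (x, y, u)" using sol u by (simp add: feas_def feasible_def)
  have wc: "weakly_converges (XYU t0 tf) (XYU_norm t0 tf) (\<lambda>n t. (xs (r n) t, ys (r n) t, us (r n) t)) (\<lambda>t. (x t, y t, u t))"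
    by (rule state_weakly_continuous[OF us u ws sols sol])
  \<comment> \<open>The limit triple consists of \<open>u\<close> and the state belonging to
    \<open>u\<close>, so it is feasible by construction; no limit has to be taken in the equations.
    The costs along the subsequence still tend to \<open>Inf S\<close>.\<close>
  have "ereal (cost f0 t0 tf x y u) \<le> liminf (\<lambda>n. ereal (cost f0 t0 tf (xs (r n)) (ys (r n)) (us (r n))))"
    using J_wlsc[unfolded weakly_lsc_cost_def, rule_format, OF mem(1-3)[OF fz], of "\<lambda>n. xs (r n)" "\<lambda>n. ys (r n)" "\<lambda>n. us (r n)"] wc xsAC ysL us by blast
  also have "\<dots> = ereal (Inf S)"
  proof (rule lim_imp_Liminf[OF trivial_limit_sequentially], rule tendsto_ereal)
    have "(\<lambda>n. J (z n)) \<longlonglongrightarrow> Inf S"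
    proof (rule tendsto_sandwich[of "\<lambda>_. Inf S" _ _ "\<lambda>n. Inf S + 1 / real (Suc n)"])
      show "\<forall>\<^sub>F n in sequentially. Inf S \<le> J (z n)"
        using z(1) bdd by (intro always_eventually allI cInf_lower) (auto simp: S_def)
      show "\<forall>\<^sub>F n in sequentially. J (z n) \<le> Inf S + 1 / real (Suc n)"
        using z(2) by (intro always_eventually allI less_imp_le)
      show "(\<lambda>n. Inf S + 1 / real (Suc n)) \<longlonglongrightarrow> Inf S"
        using tendsto_add[OF tendsto_const[of "Inf S"] LIMSEQ_Suc[OF lim_1_over_n]] by simp
    qed simp
    then have "(\<lambda>n. J (z (r n))) \<longlonglongrightarrow> Inf S" using LIMSEQ_subseq_LIMSEQ[OF _ r] by (auto simp: o_def)
    then show "(\<lambda>n. cost f0 t0 tf (xs (r n)) (ys (r n)) (us (r n))) \<longlonglongrightarrow> Inf S" by (simp add: zn J_def)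
  qed
  finally have le: "cost f0 t0 tf x y u \<le> Inf S" by simp
  have "cost f0 t0 tf x y u \<le> cost f0 t0 tf x' y' u'" if "feasible f g t0 tf ua ub x0 x' y' u'" for x' y' u'
  proof -
    have "J (x', y', u') \<in> S" using that by (auto simp: S_def feas_def)
    then show ?thesis using cInf_lower[OF _ bdd] le by (fastforce simp: J_def)
  qed
  then show ?thesis
    using mem[OF fz] fz by (auto simp: feas_def)
qed

end
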